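(* Let $d\ge1$, let $X_1,X_2,\ldots$ be independent uniformly distributed points in $[0,1]^d$, and let $\mathcal{X}_n=\{X_1,\ldots,X_n\}$. Let $\kappa\ge2$ and let $\Gamma$ be a fixed feasible connected graph with $\kappa$ vertices. Let $(r_n)_{n\ge1}$ be a sequence of positive numbers with $r_n\to0$ such that the limit $\rho:=\lim_{n\to\infty}nr_n^d$ exists in $[0,\infty)$ and $\tau_n^2:=n(nr_n^d)^{\kappa-1}\to\infty$ as $n\to\infty$. Let $G_n$ be the number of induced subgraphs of $\mathcal{G}(\mathcal{X}_n,r_n)$ isomorphic to $\Gamma$, and let $\sigma>0$ be the constant given by $\sigma^2=\lim_{n\to\infty}\tau_n^{-2}\mathrm{Var}(G_n)$. Then as $n\to\infty$, $$\sup_{j\in\mathbb{Z}}\left|\tau_nP[G_n=j]-\sigma^{-1}\phi\!\left(\frac{j-\mathbb{E}G_n}{\sigma\tau_n}\right)\right|\to0.$$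
   Context: For locally finite $\mathcal{X}\subset\mathbb{R}^d$ and $r>0$, $\mathcal{G}(\mathcal{X},r)$ is the graph with vertex set $\mathcal{X}$ and an edge between each pair of (distinct) vertices $x,y\in\mathcal{X}$ with $|y-x|\le r$, where $|\cdot|$ is the Euclidean norm. $G_n$ is precisely the number of $\kappa$-element subsets $\mathcal{Y}$ of $\mathcal{X}_n$ such that $\mathcal{G}(\mathcal{Y},r_n)$ is isomorphic to $\Gamma$. The graph $\Gamma$ is feasible if $\mathcal{G}(\mathcal{X}_\kappa,r)$ is isomorphic to $\Gamma$ with strictly positive probability for some $r>0$. Under the stated assumptions it is known (Penrose, Random Geometric Graphs, Theorems 3.12 and 3.13) that the limit $\sigma^2=\lim\tau_n^{-2}\mathrm{Var}(G_n)$ exists and is finite and strictly positive, it depends only on $d$, $\Gamma$ and $\rho$, and that $\tau_n^{-1}(G_n-\mathbb{E}G_n)$ converges in distribution to $\mathcal{N}(0,\sigma^2)$. $\phi(x)=(2\pi)^{-1/2}e^{-x^2/2}$. *)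

theory Defs
  imports
    "HOL-Probability.Probability"
    "Graph_Theory.Digraph_Isomorphism"
begin

text \<open>
  A simple undirected graph is a \<^locale>\<open>pair_graph\<close>: a finite vertex set together with an
  irreflexive symmetric relation, so that each undirected edge is a pair of opposite arcs.
\<close>

definition geometric_graph :: "'a::real_normed_vector set \<Rightarrow> real \<Rightarrow> 'a pair_pre_digraph" where
  "geometric_graph S r =
     \<lparr> pverts = S, parcs = {(x, y). x \<in> S \<and> y \<in> S \<and> x \<noteq> y \<and> norm (y - x) \<le> r} \<rparr>"

abbreviation graph_iso :: "'a pair_pre_digraph \<Rightarrow> 'b pair_pre_digraph \<Rightarrow> bool" where
  "graph_iso G H \<equiv> digraph_iso (with_proj G) (with_proj H)"

lemma graph_iso_iff:
  assumes "pair_wf_digraph G"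
  shows "graph_iso G H \<longleftrightarrow>
    (\<exists>f. bij_betw f (pverts G) (pverts H) \<and> parcs H = map_prod f f ` parcs G)"
proof
  assume "graph_iso G H"
  then obtain h where h: "pre_digraph.digraph_isomorphism (with_proj G) h"
      "with_proj H = app_iso h (with_proj G)"
    by (auto simp: digraph_iso_def)
  have e: "pverts H = iso_verts h ` pverts G" "parcs H = iso_arcs h ` parcs G"
      "iso_tail h = fst" "iso_head h = snd"
    using h(2) by (simp_all add: with_proj_def app_iso_def)
  have i: "inj_on (iso_verts h) (pverts G)"
      "\<And>a. a \<in> parcs G \<Longrightarrow> iso_arcs h a = map_prod (iso_verts h) (iso_verts h) a"
    using h(1) e(3,4)
    by (auto simp: pre_digraph.digraph_isomorphism_def with_proj_def intro!: prod_eqI)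
  have "parcs H = map_prod (iso_verts h) (iso_verts h) ` parcs G"
    unfolding e(2) using i(2) by (rule image_cong[OF refl])
  then show "\<exists>f. bij_betw f (pverts G) (pverts H) \<and> parcs H = map_prod f f ` parcs G"
    using i(1) e(1) by (auto simp: bij_betw_def)
next
  assume "\<exists>f. bij_betw f (pverts G) (pverts H) \<and> parcs H = map_prod f f ` parcs G"
  then obtain f where f: "inj_on f (pverts G)" "pverts H = f ` pverts G"
      "parcs H = map_prod f f ` parcs G"
    by (auto simp: bij_betw_def)
  interpret pair_wf_digraph G by fact
  let ?h = "\<lparr> iso_verts = f, iso_arcs = map_prod f f, iso_head = snd, iso_tail = fst \<rparr>"
  have "inj_on (map_prod f f) (parcs G)"
    by (rule inj_onI) (metis arc_fst_in_verts arc_snd_in_verts f(1) fst_map_prod inj_on_eq_iff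
        prod_eqI snd_map_prod)
  then have "pre_digraph.digraph_isomorphism (with_proj G) ?h"
    using f(1) wf_digraph by (auto simp: pre_digraph.digraph_isomorphism_def)
  moreover have "with_proj H = app_iso ?h (with_proj G)"
    using f by (simp add: app_iso_def with_proj_def)
  ultimately show "graph_iso G H"
    unfolding digraph_iso_def by blast
qed

text \<open>The points are indexed from 1; \<open>X 0\<close> is never used.\<close>

definition sample :: "(nat \<Rightarrow> 'w \<Rightarrow> 'a) \<Rightarrow> nat \<Rightarrow> 'w \<Rightarrow> 'a set" where
  "sample X n \<omega> = (\<lambda>i. X i \<omega>) ` {1..n}"

definition feasible ::
  "'w measure \<Rightarrow> (nat \<Rightarrow> 'w \<Rightarrow> 'a::real_normed_vector) \<Rightarrow> 'v pair_pre_digraph \<Rightarrow> bool" where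
  "feasible M X \<Gamma> \<longleftrightarrow>
     (\<exists>r>0. measure M {\<omega> \<in> space M.
        graph_iso (geometric_graph (sample X (card (pverts \<Gamma>)) \<omega>) r) \<Gamma>} > 0)"

text \<open>
  An induced subgraph is determined by its vertex set, so the induced subgraphs isomorphic
  to \<open>\<Gamma>\<close> are counted by vertex set.
\<close>

definition induced_count :: "'v pair_pre_digraph \<Rightarrow> 'a::real_normed_vector set \<Rightarrow> real \<Rightarrow> nat" where
  "induced_count \<Gamma> S r =
     card {Y. Y \<subseteq> S \<and> card Y = card (pverts \<Gamma>) \<and> graph_iso (geometric_graph Y r) \<Gamma>}"

definition tau :: "nat \<Rightarrow> nat \<Rightarrow> (nat \<Rightarrow> real) \<Rightarrow> nat \<Rightarrow> real" where
  "tau d \<kappa> r n = sqrt (real n * (real n * r n ^ d) ^ (\<kappa> - 1))"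

end

theory Submission
  imports Defs
begin

text \<open>
  Let \<open>G\<close> be the number of induced copies of the graph in a sample of size \<open>n\<close>. Fourier inversion
  writes \<open>\<tau> P[G = j]\<close> as an integral over \<open>\<bar>t\<bar> \<le> \<pi> \<tau>\<close> of the characteristic function of
  \<open>(G - E G) / \<tau>\<close>, and the Gaussian density is the same integral of \<open>exp (- \<sigma>\<^sup>2 t\<^sup>2 / 2)\<close>
  over the whole line. The difference is at most the \<open>L\<^sup>1\<close> distance of the two integrands, whatever
  \<open>j\<close> is. By dominated convergence (\<open>local_limit_from_char\<close>) it remains to prove that the
  characteristic functions converge pointwise, and that for \<open>\<bar>t\<bar> \<le> \<pi> \<tau>\<close> they are at most
  \<open>exp (- c t\<^sup>2) + C / \<tau>\<^sup>2\<close>; the second term is dominated because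
  \<open>1 / \<tau>\<^sup>2 \<le> (1 + \<pi>\<^sup>2) / (1 + t\<^sup>2)\<close> in that range as soon as \<open>\<tau> \<ge> 1\<close>.

  Pointwise convergence is a central limit theorem. Up to null sets \<open>G\<close> is a U-statistic
  \<open>W = f(X) = \<Sum>\<^sub>I h\<^sub>I\<close>, where \<open>I\<close> runs over the \<open>\<kappa>\<close>-element sets of indices and \<open>h\<^sub>I\<close> says that the
  points with index in \<open>I\<close> form the graph. Let \<open>W\<^sup>I\<close> be the statistic after the points in \<open>I\<close>
  have been replaced by independent ones. Then \<open>W\<^sup>I\<close> is independent of \<open>h\<^sub>I\<close> and distributed like
  \<open>W\<close>, so \<open>E (W - E W) g(W) = \<Sum>\<^sub>I E h\<^sub>I (g(W) - g(W\<^sup>I))\<close> for every \<open>g\<close> (\<open>stein_identity\<close>).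
  For \<open>g = exp (i \<theta> (\<cdot> - E W))\<close> and to first order in \<open>W - W\<^sup>I\<close> the right-hand side is \<open>i \<theta> E T g(W)\<close>
  with \<open>T = \<Sum>\<^sub>I h\<^sub>I (W - W\<^sup>I)\<close>, and \<open>E T = Var W\<close>. If \<open>T\<close> is concentrated, the characteristic
  function \<open>\<phi>\<close> of \<open>W - E W\<close> therefore almost satisfies \<open>\<phi>' = - \<theta> Var W \<phi>\<close>, the equation of
  the Gaussian one. Both error terms, \<open>Var T\<close> and the second-order remainder, are sums over
  quadruples of index sets that hang together. As the graph is connected, the points of such
  a quadruple with \<open>k\<close> indices are chained at distance \<open>O(r)\<close>, which has probability at most
  \<open>p ^ (k - 1)\<close> with \<open>p = O(r ^ d)\<close>. Summation gives \<open>O(n (n p) ^ (\<kappa> - 1)) = O(\<tau>\<^sup>2)\<close>, and the error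
  in the characteristic function of \<open>(W - E W) / \<tau>\<close> is \<open>O(1 / \<tau>)\<close> (\<open>char_gaussian_bound\<close>).

  For the dominating bound, the unit cube is cut into cells of width proportional to \<open>r\<close>. A cell
  is good if exactly \<open>\<kappa>\<close> points lie in it and all of them lie in a central core, at a distance
  from the boundary of the cell that separates them from all other points. Conditionally on everything
  except the positions inside the cores, a good cell adds an independent Bernoulli variable to
  \<open>G\<close>, with a parameter strictly between 0 and 1 that depends neither on the cell nor on \<open>n\<close>. Each good cell
  multiplies the characteristic function by a factor of modulus at most \<open>exp (- c \<theta>\<^sup>2)\<close>. The
  number of good cells has mean of order \<open>\<tau>\<^sup>2\<close>, and Chebyshev's inequality shows that it is
  below half its mean with probability \<open>O(1 / \<tau>\<^sup>2)\<close> only (\<open>prob_few_good_cells\<close>,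
  \<open>norm_char_copies\<close>).
\<close>

section \<open>Preliminaries\<close>

lemma (in prob_space) integrable_event: "A \<in> events \<Longrightarrow> integrable M (indicat_real A)"
  by (intro integrable_real_indicator) (auto simp: emeasure_eq_measure)

lemma (in prob_space) expectation_event:
  assumes "A \<in> events"
  shows "expectation (indicat_real A) = prob A"
  using Bochner_Integration.integral_indicator[of M A] Int_absorb2[OF sets.sets_into_space[OF assms]] by (simp only:)

lemma integral_of_bool_eq_prob:
  assumes "prob_space M" "Measurable.pred M p"
  shows "(\<integral>x. of_bool (p x) \<partial>M) = measure M {x \<in> space M. p x}"
proof -
  have "(\<integral>x. of_bool (p x) \<partial>M) = (\<integral>x. indicat_real {x \<in> space M. p x} x \<partial>M)"
    by (intro Bochner_Integration.integral_cong refl) (auto simp: indicator_def)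
  then show ?thesis
    using prob_space.expectation_event[OF assms(1), of "{x \<in> space M. p x}"] assms(2) by (simp add: pred_def)
qed

lemma (in prob_space) expectation_bounded_nat:
  fixes g :: "nat \<Rightarrow> 'b::{banach, second_countable_topology}"
  assumes X: "X \<in> measurable M (count_space UNIV)" and K: "\<And>x. x \<in> space M \<Longrightarrow> X x \<le> K"
  shows "expectation (\<lambda>x. g (X x)) = (\<Sum>k\<le>K. prob {x \<in> space M. X x = k} *\<^sub>R g k)"
proof -
  let ?A = "\<lambda>k. {x \<in> space M. X x = k}"
  have "?A k \<in> events" for k using X by measurable
  note A = integrable_event[OF this] and pA = expectation_event[OF this]
  have "expectation (\<lambda>x. g (X x)) = expectation (\<lambda>x. \<Sum>k\<le>K. indicator (?A k) x *\<^sub>R g k)"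
  proof (rule Bochner_Integration.integral_cong[OF refl])
    fix x assume x: "x \<in> space M"
    have "(\<Sum>k\<le>K. indicator (?A k) x *\<^sub>R g k) = (\<Sum>k\<le>K. if k = X x then g (X x) else 0)"
      using x by (intro sum.cong) (auto simp: indicator_def)
    then show "g (X x) = (\<Sum>k\<le>K. indicator (?A k) x *\<^sub>R g k)" using K[OF x] by simp
  qed
  also have "\<dots> = (\<Sum>k\<le>K. expectation (\<lambda>x. indicator (?A k) x *\<^sub>R g k))"
    by (intro Bochner_Integration.integral_sum integrable_scaleR_left A)
  also have "\<dots> = (\<Sum>k\<le>K. prob (?A k) *\<^sub>R g k)"
  proof (intro sum.cong refl)
    fix k
    have "expectation (\<lambda>x. indicator (?A k) x *\<^sub>R g k) = expectation (indicat_real (?A k)) *\<^sub>R g k"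
      by (rule integral_scaleR_left) (rule A)
    then show "expectation (\<lambda>x. indicator (?A k) x *\<^sub>R g k) = prob (?A k) *\<^sub>R g k"
      by (simp only: pA)
  qed
  finally show ?thesis .
qed

lemma cis_has_vector_derivative:
  "((\<lambda>\<theta>. cis (\<theta> * a)) has_vector_derivative (\<i> * of_real a * cis (\<theta> * a))) (at \<theta> within S)"
  by (auto simp: has_vector_derivative_complex_iff intro!: derivative_eq_intros)

section \<open>Functions of disjoint blocks of independent coordinates\<close>

text \<open>
  Independence is always read off syntactically: a function of a product space that depends on the
  coordinates in \<open>A\<close> only is independent of one that depends on the coordinates in a set disjoint from \<open>A\<close>.
\<close>

definition depends_on :: "(('i \<Rightarrow> 'a) \<Rightarrow> 'b) \<Rightarrow> 'i set \<Rightarrow> bool" where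
  "depends_on F A \<longleftrightarrow> (\<forall>z z'. (\<forall>v\<in>A. z v = z' v) \<longrightarrow> F z = F z')"

lemma depends_onI: "(\<And>z z'. (\<And>v. v \<in> A \<Longrightarrow> z v = z' v) \<Longrightarrow> F z = F z') \<Longrightarrow> depends_on F A"
  unfolding depends_on_def by blast

lemma depends_onD: "depends_on F A \<Longrightarrow> (\<And>v. v \<in> A \<Longrightarrow> z v = z' v) \<Longrightarrow> F z = F z'"
  unfolding depends_on_def by blast

lemma depends_on_mono: "depends_on F A \<Longrightarrow> A \<subseteq> B \<Longrightarrow> depends_on F B"
  unfolding depends_on_def by blast

lemma depends_on_comp:
  "depends_on F A \<Longrightarrow> depends_on (\<lambda>z. g (F z)) A"
  unfolding depends_on_def by metis

lemma depends_on_comp2: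
  assumes "depends_on F A" "depends_on G A"
  shows "depends_on (\<lambda>z. g (F z) (G z)) A"
  using assms unfolding depends_on_def by metis

context
  fixes \<mu> :: "'a measure"
  assumes prob_\<mu>: "prob_space \<mu>"
begin

interpretation prob_space \<mu> by (rule prob_\<mu>)

lemma prob_space_PiM_iid: "prob_space (PiM V (\<lambda>_. \<mu>))"
  by (rule prob_space_PiM) (rule prob_\<mu>)

lemma indep_vars_coordinates:
  "prob_space.indep_vars (PiM V (\<lambda>_. \<mu>)) (\<lambda>_. \<mu>) (\<lambda>v z. z v) V"
proof (cases "V = {}")
  case True
  interpret N: prob_space "PiM V (\<lambda>_. \<mu>)" by (rule prob_space_PiM_iid)
  show ?thesis unfolding N.indep_vars_def N.indep_sets_def using True by auto
next
  case False
  interpret N: prob_space "PiM V (\<lambda>_. \<mu>)" by (rule prob_space_PiM_iid)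
  have "distr (PiM V (\<lambda>_. \<mu>)) (PiM V (\<lambda>_. \<mu>)) (\<lambda>z. \<lambda>v\<in>V. z v)
      = distr (PiM V (\<lambda>_. \<mu>)) (PiM V (\<lambda>_. \<mu>)) (\<lambda>z. z)"
    by (rule distr_cong) (auto simp: space_PiM)
  also have "\<dots> = PiM V (\<lambda>v. distr (PiM V (\<lambda>_. \<mu>)) \<mu> (\<lambda>z. z v))"
    by (simp, rule PiM_cong) (auto simp: distr_PiM_component[OF prob_\<mu>])
  finally show ?thesis
    using False by (subst N.indep_vars_iff_distr_eq_PiM') auto
qed

text \<open>
  A function that depends on a block of coordinates factors through the restriction to that block
  (the other coordinates are filled in with an arbitrary point), and restrictions to disjoint blocks
  are independent.
\<close>

lemma indep_vars_depends_on:
  fixes F :: "'j \<Rightarrow> ('i \<Rightarrow> 'a) \<Rightarrow> 'b::topological_space"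
  assumes K: "disjoint_family_on K J" "\<And>j. j \<in> J \<Longrightarrow> K j \<subseteq> V"
    and F: "\<And>j. j \<in> J \<Longrightarrow> F j \<in> borel_measurable (PiM V (\<lambda>_. \<mu>))"
      "\<And>j. j \<in> J \<Longrightarrow> depends_on (F j) (K j)"
  shows "prob_space.indep_vars (PiM V (\<lambda>_. \<mu>)) (\<lambda>_. borel) F J"
proof -
  interpret N: prob_space "PiM V (\<lambda>_. \<mu>)" by (rule prob_space_PiM_iid)
  obtain a where a: "a \<in> space \<mu>" using not_empty by auto
  define ext where "ext j y = (\<lambda>v\<in>V. if v \<in> K j then y v else a)" for j and y :: "'i \<Rightarrow> 'a"
  have ext: "ext j \<in> PiM (K j) (\<lambda>_. \<mu>) \<rightarrow>\<^sub>M PiM V (\<lambda>_. \<mu>)" if "j \<in> J" for j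
    unfolding ext_def
  proof (rule measurable_restrict)
    fix v show "(\<lambda>y. if v \<in> K j then y v else a) \<in> PiM (K j) (\<lambda>_. \<mu>) \<rightarrow>\<^sub>M \<mu>"
      using a by (cases "v \<in> K j") auto
  qed
  have "N.indep_vars (\<lambda>j. PiM (K j) (\<lambda>_. \<mu>)) (\<lambda>j z. restrict (\<lambda>i. z i) (K j)) J"
    using K by (intro N.indep_vars_restrict[OF indep_vars_coordinates]) auto
  then have "N.indep_vars (\<lambda>_. borel) (\<lambda>j z. F j (ext j (restrict (\<lambda>i. z i) (K j)))) J"
    by (rule N.indep_vars_compose2) (use F(1) ext in measurable)
  moreover have "F j (ext j (restrict (\<lambda>i. z i) (K j))) = F j z" if "j \<in> J" for j z
    using K(2)[OF that] by (intro depends_onD[OF F(2)[OF that]]) (auto simp: ext_def)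
  ultimately show ?thesis
    by (subst N.indep_vars_cong[OF refl _ refl]) auto
qed

lemma integral_mult_depends_on:
  fixes F G :: "('i \<Rightarrow> 'a) \<Rightarrow> 'b::{real_normed_field, banach, second_countable_topology}"
  assumes "A \<inter> B = {}" "A \<subseteq> V" "B \<subseteq> V" "depends_on F A" "depends_on G B"
    and int: "integrable (PiM V (\<lambda>_. \<mu>)) F" "integrable (PiM V (\<lambda>_. \<mu>)) G"
  shows "(\<integral>z. F z * G z \<partial>PiM V (\<lambda>_. \<mu>))
    = (\<integral>z. F z \<partial>PiM V (\<lambda>_. \<mu>)) * (\<integral>z. G z \<partial>PiM V (\<lambda>_. \<mu>))"
proof -
  interpret N: prob_space "PiM V (\<lambda>_. \<mu>)" by (rule prob_space_PiM_iid)
  have "N.indep_vars (\<lambda>_. borel) (case_bool F G) UNIV"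
    using assms by (intro indep_vars_depends_on[where K="case_bool A B"])
      (auto simp: disjoint_family_on_def split: bool.splits)
  also have "(\<lambda>_::bool. borel) = case_bool borel borel"
    by (auto split: bool.splits)
  finally have "N.indep_var borel F borel G"
    unfolding N.indep_var_def .
  then show ?thesis using int by (rule N.indep_var_lebesgue_integral)
qed

lemma integral_prod_depends_on:
  fixes F :: "'j \<Rightarrow> ('i \<Rightarrow> 'a) \<Rightarrow> 'b::{real_normed_field, banach, second_countable_topology}"
  assumes "finite J" "disjoint_family_on K J" "\<And>j. j \<in> J \<Longrightarrow> K j \<subseteq> V"
    "\<And>j. j \<in> J \<Longrightarrow> depends_on (F j) (K j)"
    "\<And>j. j \<in> J \<Longrightarrow> integrable (PiM V (\<lambda>_. \<mu>)) (F j)"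
  shows "(\<integral>z. (\<Prod>j\<in>J. F j z) \<partial>PiM V (\<lambda>_. \<mu>)) = (\<Prod>j\<in>J. \<integral>z. F j z \<partial>PiM V (\<lambda>_. \<mu>))"
proof -
  interpret N: prob_space "PiM V (\<lambda>_. \<mu>)" by (rule prob_space_PiM_iid)
  have "N.indep_vars (\<lambda>_. borel) F J"
    using assms by (intro indep_vars_depends_on[where K=K]) auto
  then show ?thesis using assms by (intro N.indep_vars_lebesgue_integral) auto
qed

lemma measurable_reindex:
  assumes "\<And>i. i \<in> I \<Longrightarrow> f i \<in> V"
  shows "(\<lambda>z. \<lambda>i\<in>I. z (f i)) \<in> PiM V (\<lambda>_. \<mu>) \<rightarrow>\<^sub>M PiM I (\<lambda>_. \<mu>)"
  using assms by (intro measurable_restrict) auto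

lemma borel_measurable_reindex:
  assumes "depends_on F I" "F \<in> borel_measurable (PiM I (\<lambda>_. \<mu>))" "\<And>i. i \<in> I \<Longrightarrow> f i \<in> V"
  shows "(\<lambda>z. F (\<lambda>i. z (f i))) \<in> borel_measurable (PiM V (\<lambda>_. \<mu>))"
proof -
  have "(\<lambda>z. F (\<lambda>i. z (f i))) = (\<lambda>z. F (\<lambda>i\<in>I. z (f i)))"
    by (intro ext depends_onD[OF assms(1)]) auto
  then show ?thesis
    using measurable_compose[OF measurable_reindex assms(2)] assms(3) by auto
qed

lemma integral_reindex:
  fixes F :: "('i \<Rightarrow> 'a) \<Rightarrow> 'b::{banach, second_countable_topology}"
  assumes "depends_on F I" "F \<in> borel_measurable (PiM I (\<lambda>_. \<mu>))"
    and f: "inj_on f I" "\<And>i. i \<in> I \<Longrightarrow> f i \<in> V"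
  shows "(\<integral>z. F (\<lambda>i. z (f i)) \<partial>PiM V (\<lambda>_. \<mu>)) = (\<integral>x. F x \<partial>PiM I (\<lambda>_. \<mu>))"
proof -
  have "(\<integral>z. F (\<lambda>i. z (f i)) \<partial>PiM V (\<lambda>_. \<mu>)) = (\<integral>z. F (\<lambda>i\<in>I. z (f i)) \<partial>PiM V (\<lambda>_. \<mu>))"
    by (intro Bochner_Integration.integral_cong refl depends_onD[OF assms(1)]) auto
  also have "\<dots> = (\<integral>x. F x \<partial>distr (PiM V (\<lambda>_. \<mu>)) (PiM I (\<lambda>_. \<mu>)) (\<lambda>z. \<lambda>i\<in>I. z (f i)))"
    using f assms(2) by (intro integral_distr[symmetric] measurable_reindex) auto
  also have "distr (PiM V (\<lambda>_. \<mu>)) (PiM I (\<lambda>_. \<mu>)) (\<lambda>z. \<lambda>i\<in>I. z (f i)) = PiM I (\<lambda>_. \<mu>)"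
    using f by (intro distr_PiM_reindex[of V "\<lambda>_. \<mu>"] prob_\<mu>) auto
  finally show ?thesis .
qed

text \<open>
  Integrate out the coordinate \<open>l\<close> first: whatever the point \<open>z u\<close> is, \<open>z l\<close> is close to it with probability
  at most \<open>p\<close>. Repeating this for a tree of closeness conditions costs one factor \<open>p\<close> for
  each edge.
\<close>

lemma nn_integral_peel:
  assumes V: "finite V" "l \<in> V" "u \<in> V" "u \<noteq> l"
    and F: "F \<in> borel_measurable (PiM V (\<lambda>_. \<mu>))" "depends_on F (V - {l})"
    and C: "Measurable.pred (\<mu> \<Otimes>\<^sub>M \<mu>) (\<lambda>(x, y). C x y)"
    and p: "\<And>x. x \<in> space \<mu> \<Longrightarrow> emeasure \<mu> {y \<in> space \<mu>. C x y} \<le> p"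
  shows "(\<integral>\<^sup>+z. F z * of_bool (C (z u) (z l)) \<partial>PiM V (\<lambda>_. \<mu>)) \<le> p * (\<integral>\<^sup>+z. F z \<partial>PiM V (\<lambda>_. \<mu>))"
proof -
  interpret product_sigma_finite "\<lambda>_. \<mu>" by standard
  let ?V = "V - {l}"
  have ins: "insert l ?V = V" using V by auto
  have Cm: "Measurable.pred (PiM V (\<lambda>_. \<mu>)) (\<lambda>z. C (z u) (z l))"
    using measurable_compose[OF _ C, of "\<lambda>z. (z u, z l)" "PiM V (\<lambda>_. \<mu>)"] V by auto
  have upd: "F (x(l := y)) = F x" for x y
    by (rule depends_onD[OF F(2)]) auto
  have "(\<integral>\<^sup>+z. F z * of_bool (C (z u) (z l)) \<partial>PiM V (\<lambda>_. \<mu>))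
    = (\<integral>\<^sup>+x. (\<integral>\<^sup>+y. F (x(l := y)) * of_bool (C ((x(l := y)) u) ((x(l := y)) l)) \<partial>\<mu>) \<partial>PiM ?V (\<lambda>_. \<mu>))"
    using V(1) F(1) Cm
    by (subst product_nn_integral_insert[of ?V l, unfolded ins, symmetric]) (auto simp: ins)
  also have "\<dots> \<le> (\<integral>\<^sup>+x. p * F x \<partial>PiM ?V (\<lambda>_. \<mu>))"
  proof (rule nn_integral_mono)
    fix x assume x: "x \<in> space (PiM ?V (\<lambda>_. \<mu>))"
    then have xu: "x u \<in> space \<mu>" using V by (auto simp: space_PiM)
    have Cx: "{y \<in> space \<mu>. C (x u) y} \<in> sets \<mu>"
      using measurable_compose[OF measurable_Pair1'[OF xu] C] by (simp add: pred_def)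
    have "(\<integral>\<^sup>+y. F (x(l := y)) * of_bool (C ((x(l := y)) u) ((x(l := y)) l)) \<partial>\<mu>)
      = (\<integral>\<^sup>+y. F x * indicator {y \<in> space \<mu>. C (x u) y} y \<partial>\<mu>)"
      using V upd by (intro nn_integral_cong) (auto simp: indicator_def)
    also have "\<dots> = F x * emeasure \<mu> {y \<in> space \<mu>. C (x u) y}"
      using Cx by (rule nn_integral_cmult_indicator)
    also have "\<dots> \<le> p * F x"
      using p[OF xu] by (subst mult.commute) (rule mult_right_mono, auto)
    finally show "(\<integral>\<^sup>+y. F (x(l := y)) * of_bool (C ((x(l := y)) u) ((x(l := y)) l)) \<partial>\<mu>) \<le> p * F x" .
  qed
  also have "\<dots> = (\<integral>\<^sup>+x. (\<integral>\<^sup>+y. p * F (x(l := y)) \<partial>\<mu>) \<partial>PiM ?V (\<lambda>_. \<mu>))"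
    by (simp add: upd emeasure_space_1)
  also have "\<dots> = (\<integral>\<^sup>+z. p * F z \<partial>PiM V (\<lambda>_. \<mu>))"
    using V(1) F(1)
    by (subst product_nn_integral_insert[of ?V l, unfolded ins]) (auto simp: ins)
  also have "\<dots> = p * (\<integral>\<^sup>+z. F z \<partial>PiM V (\<lambda>_. \<mu>))"
    using F(1) by (rule nn_integral_cmult)
  finally show ?thesis .
qed

lemma nn_integral_peel_set:
  assumes V: "finite V" "u \<in> A" "A \<subseteq> V" "S \<subseteq> V" "A \<inter> S = {}"
    and F: "F \<in> borel_measurable (PiM V (\<lambda>_. \<mu>))" "depends_on F A"
    and C: "Measurable.pred (\<mu> \<Otimes>\<^sub>M \<mu>) (\<lambda>(x, y). C x y)"
    and p: "\<And>x. x \<in> space \<mu> \<Longrightarrow> emeasure \<mu> {y \<in> space \<mu>. C x y} \<le> p"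
  shows "(\<integral>\<^sup>+z. F z * (\<Prod>l\<in>S. of_bool (C (z u) (z l))) \<partial>PiM V (\<lambda>_. \<mu>))
    \<le> p ^ card S * (\<integral>\<^sup>+z. F z \<partial>PiM V (\<lambda>_. \<mu>))"
proof -
  have "finite S" using V(4,1) by (rule finite_subset)
  from this V show ?thesis
  proof (induction S)
    case (insert l S)
    have Cm: "Measurable.pred (PiM V (\<lambda>_. \<mu>)) (\<lambda>z. C (z u) (z v))" if "v \<in> V" for v
      using measurable_compose[OF _ C, of "\<lambda>z. (z u, z v)" "PiM V (\<lambda>_. \<mu>)"] insert.prems that
      by auto
    let ?G = "\<lambda>z. F z * (\<Prod>l\<in>S. of_bool (C (z u) (z l)))"
    have "(\<integral>\<^sup>+z. F z * (\<Prod>l\<in>insert l S. of_bool (C (z u) (z l))) \<partial>PiM V (\<lambda>_. \<mu>))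
        = (\<integral>\<^sup>+z. ?G z * of_bool (C (z u) (z l)) \<partial>PiM V (\<lambda>_. \<mu>))"
      using insert.hyps by (simp add: mult_ac)
    also have "\<dots> \<le> p * (\<integral>\<^sup>+z. ?G z \<partial>PiM V (\<lambda>_. \<mu>))"
    proof (rule nn_integral_peel)
      show "?G \<in> borel_measurable (PiM V (\<lambda>_. \<mu>))"
        using F(1) Cm insert.prems
        by (intro borel_measurable_times_ennreal borel_measurable_prod_ennreal measurable_of_bool) auto
      show "depends_on ?G (V - {l})"
      proof (rule depends_onI)
        fix z z' :: "'b \<Rightarrow> 'a" assume eq: "\<And>v. v \<in> V - {l} \<Longrightarrow> z v = z' v"
        have "F z = F z'" using insert.prems by (intro depends_onD[OF F(2)] eq) auto
        moreover have "z u = z' u" "\<And>v. v \<in> S \<Longrightarrow> z v = z' v"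
          using insert.prems insert.hyps by (auto intro!: eq)
        ultimately show "?G z = ?G z'" by simp
      qed
    qed (use insert.prems C p in auto)
    also have "\<dots> \<le> p * (p ^ card S * (\<integral>\<^sup>+z. F z \<partial>PiM V (\<lambda>_. \<mu>)))"
      using insert by (intro mult_left_mono) auto
    finally show ?case using insert.hyps by (simp add: mult_ac)
  qed simp
qed

end

section \<open>A normal approximation for local U-statistics\<close>

text \<open>
  The sum of a \<open>{0, 1}\<close>-valued kernel over the \<open>\<kappa>\<close>-element sets of indices. The kernel is local: it
  vanishes unless its points are pairwise in the relation \<open>C\<close>, which two independent points satisfy with
  probability at most \<open>p\<close>.
\<close>

locale local_ustatistic = prob_space \<mu> for \<mu> :: "'a measure" +
  fixes n \<kappa> :: nat and h :: "nat set \<Rightarrow> (nat \<Rightarrow> 'a) \<Rightarrow> bool"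
    and C :: "'a \<Rightarrow> 'a \<Rightarrow> bool" and p :: real
  assumes \<kappa>_pos: "\<kappa> \<ge> 1"
    and pred_h: "\<And>I. I \<subseteq> {1..n} \<Longrightarrow> Measurable.pred (PiM {1..n} (\<lambda>_. \<mu>)) (h I)"
    and depends_on_h: "\<And>I. depends_on (h I) I"
    and h_close: "\<And>I x i j. h I x \<Longrightarrow> i \<in> I \<Longrightarrow> j \<in> I \<Longrightarrow> C (x i) (x j)"
    and pred_C: "Measurable.pred (\<mu> \<Otimes>\<^sub>M \<mu>) (\<lambda>(x, y). C x y)"
    and emeasure_C: "\<And>x. x \<in> space \<mu> \<Longrightarrow> emeasure \<mu> {y \<in> space \<mu>. C x y} \<le> ennreal p"
    and p_nonneg: "0 \<le> p" and p_le_1: "p \<le> 1"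
begin

text \<open>
  Coordinate \<open>(i, False)\<close> is the point number \<open>i\<close> and \<open>(i, True)\<close> is its independent replacement, so
  \<open>swap S\<close> selects the sample in which the points with index in \<open>S\<close> have been replaced.
\<close>

definition "V = {1..n} \<times> (UNIV :: bool set)"
definition "N = PiM V (\<lambda>_. \<mu>)"
definition "subsets = {I. I \<subseteq> {1..n} \<and> card I = \<kappa>}"
definition swap :: "nat set \<Rightarrow> (nat \<times> bool \<Rightarrow> 'a) \<Rightarrow> nat \<Rightarrow> 'a" where
  "swap S z = (\<lambda>i. z (i, i \<in> S))"
definition H :: "nat set \<Rightarrow> (nat \<Rightarrow> 'a) \<Rightarrow> real" where "H I x = of_bool (h I x)"
definition "f x = (\<Sum>I\<in>subsets. H I x)"

sublocale N: prob_space N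
  unfolding N_def by (rule prob_space_PiM_iid) unfold_locales

lemma finite_subsets: "finite subsets" by (simp add: subsets_def)
lemma subsetsD: "I \<in> subsets \<Longrightarrow> I \<subseteq> {1..n}" "I \<in> subsets \<Longrightarrow> card I = \<kappa>"
  "I \<in> subsets \<Longrightarrow> I \<noteq> {}" "I \<in> subsets \<Longrightarrow> finite I"
  using \<kappa>_pos by (auto simp: subsets_def intro: finite_subset)

lemma H_bounds: "0 \<le> H I x" "H I x \<le> 1" "\<bar>H I x\<bar> \<le> 1" "H I x * H I x = H I x"
  by (auto simp: H_def)

lemma depends_on_H: "depends_on (H I) I"
  unfolding H_def[abs_def] by (rule depends_on_comp[OF depends_on_h])

lemma measurable_H: "I \<subseteq> {1..n} \<Longrightarrow> H I \<in> borel_measurable (PiM {1..n} (\<lambda>_. \<mu>))"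
  unfolding H_def using pred_h by measurable

lemma measurable_f: "f \<in> borel_measurable (PiM {1..n} (\<lambda>_. \<mu>))"
  unfolding f_def by (intro borel_measurable_sum measurable_H subsetsD)

lemma depends_on_f: "depends_on f {1..n}"
  unfolding f_def
  by (intro depends_onI sum.cong refl depends_onD[OF depends_on_H]) (use subsetsD in blast)

lemma depends_on_swap:
  assumes "depends_on F I"
  shows "depends_on (\<lambda>z. F (swap S z)) ((\<lambda>i. (i, i \<in> S)) ` I)"
  by (rule depends_onI, rule depends_onD[OF assms]) (auto simp: swap_def)

lemma measurable_swap:
  assumes "F \<in> borel_measurable (PiM {1..n} (\<lambda>_. \<mu>))" "depends_on F {1..n}"
  shows "(\<lambda>z. F (swap S z)) \<in> borel_measurable N"
  unfolding N_def swap_def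
  by (rule borel_measurable_reindex[OF _ assms(2,1)]) (unfold_locales, auto simp: V_def)

lemma measurable_H_swap [measurable]: "I \<subseteq> {1..n} \<Longrightarrow> (\<lambda>z. H I (swap S z)) \<in> borel_measurable N"
  by (intro measurable_swap measurable_H depends_on_mono[OF depends_on_H])

lemma measurable_f_swap [measurable]: "(\<lambda>z. f (swap S z)) \<in> borel_measurable N"
  by (intro measurable_swap measurable_f depends_on_f)

lemma integrable_bdd:
  fixes F :: "_ \<Rightarrow> 'b::{banach, second_countable_topology}"
  shows "F \<in> borel_measurable N \<Longrightarrow> (\<And>z. norm (F z) \<le> B) \<Longrightarrow> integrable N F"
  by (rule N.integrable_const_bound) auto

text \<open>
  If the set \<open>I\<close> of indices meets the set \<open>A\<close> of indices seen so far, say in \<open>u\<close>, then for each new index of \<open>I\<close>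
  the relevant one of its two points has to be close to the point used for \<open>u\<close>. The new points are
  independent of the past, whichever of the two copies is used. This is why an index costs a factor
  \<open>p\<close> only once, although both of its copies may occur in a configuration.
\<close>

lemma nn_cluster_step:
  assumes I: "I \<subseteq> {1..n}" "A \<subseteq> {1..n}" "I \<inter> A \<noteq> {}"
    and F: "F \<in> borel_measurable N" "depends_on F (A \<times> UNIV)"
  shows "(\<integral>\<^sup>+z. F z * ennreal (H I (swap S z)) \<partial>N) \<le> ennreal p ^ card (I - A) * (\<integral>\<^sup>+z. F z \<partial>N)"
proof -
  obtain u where u: "u \<in> I" "u \<in> A" using I by auto
  let ?L = "(\<lambda>i. (i, i \<in> S)) ` (I - A)"
  have "(\<integral>\<^sup>+z. F z * ennreal (H I (swap S z)) \<partial>N)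
      \<le> (\<integral>\<^sup>+z. F z * (\<Prod>l\<in>?L. of_bool (C (z (u, u \<in> S)) (z l))) \<partial>N)"
  proof (rule nn_integral_mono)
    fix z
    have "ennreal (H I (swap S z)) \<le> (\<Prod>l\<in>?L. of_bool (C (z (u, u \<in> S)) (z l)))"
    proof (cases "h I (swap S z)")
      case True
      then have "C (z (u, u \<in> S)) (z l)" if "l \<in> ?L" for l
        using h_close[OF True u(1)] that by (auto simp: swap_def)
      then have "(\<Prod>l\<in>?L. of_bool (C (z (u, u \<in> S)) (z l))) = (1::ennreal)"
        by (intro prod.neutral) auto
      then show ?thesis by (simp add: H_def)
    qed (simp add: H_def)
    then show "F z * ennreal (H I (swap S z)) \<le> F z * (\<Prod>l\<in>?L. of_bool (C (z (u, u \<in> S)) (z l)))"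
      by (rule mult_left_mono) simp
  qed
  also have "\<dots> \<le> ennreal p ^ card ?L * (\<integral>\<^sup>+z. F z \<partial>N)"
    unfolding N_def
  proof (rule nn_integral_peel_set[where A="A \<times> UNIV" and V=V])
    show "prob_space \<mu>" by unfold_locales
  qed (use I u F emeasure_C pred_C in \<open>auto simp: V_def N_def\<close>)
  also have "card ?L = card (I - A)"
    by (rule card_image) (auto simp: inj_on_def)
  finally show ?thesis .
qed

lemma depends_on_HS: "depends_on (\<lambda>z. H I (swap S z)) (I \<times> UNIV)"
  by (rule depends_on_mono[OF depends_on_swap[OF depends_on_H]]) auto

lemma nn_cluster_1:
  assumes "I \<in> subsets"
  shows "(\<integral>\<^sup>+z. ennreal (H I (swap S z)) \<partial>N) \<le> ennreal p ^ (card I - 1)"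
proof -
  obtain i where i: "i \<in> I" using subsetsD[OF assms] by auto
  have "(\<integral>\<^sup>+z. 1 * ennreal (H I (swap S z)) \<partial>N) \<le> ennreal p ^ card (I - {i}) * (\<integral>\<^sup>+z. 1 \<partial>N)"
    using subsetsD[OF assms] i by (intro nn_cluster_step) (auto simp: depends_on_def)
  then show ?thesis using i subsetsD[OF assms] by (simp add: N.emeasure_space_1)
qed

lemma nn_cluster_add:
  assumes F: "F \<in> borel_measurable N" "depends_on F (A \<times> UNIV)" "(\<integral>\<^sup>+z. F z \<partial>N) \<le> ennreal p ^ (card A - 1)"
    and A: "A \<subseteq> {1..n}" and I: "I \<in> subsets" "I \<inter> A \<noteq> {}"
  shows "(\<integral>\<^sup>+z. F z * ennreal (H I (swap S z)) \<partial>N) \<le> ennreal p ^ (card (A \<union> I) - 1)"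
proof -
  have "(\<integral>\<^sup>+z. F z * ennreal (H I (swap S z)) \<partial>N) \<le> ennreal p ^ card (I - A) * (\<integral>\<^sup>+z. F z \<partial>N)"
    using assms subsetsD[OF I(1)] by (intro nn_cluster_step) auto
  also have "\<dots> \<le> ennreal p ^ card (I - A) * ennreal p ^ (card A - 1)"
    by (intro mult_left_mono assms) auto
  also have "\<dots> = ennreal p ^ (card (I - A) + (card A - 1))" by (simp add: power_add)
  also have "card (I - A) + (card A - 1) = card (A \<union> I) - 1"
  proof -
    have fin: "finite A" "finite I" using A subsetsD[OF I(1)] finite_subset by auto
    have "card (A \<union> I) = card A + card (I - A)"
      using card_Un_disjoint[of A "I - A"] fin by auto
    moreover have "card A > 0" using fin I by (auto simp: card_gt_0_iff)
    ultimately show ?thesis by auto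
  qed
  finally show ?thesis .
qed

lemma nn_cluster_2:
  assumes "I \<in> subsets" "J \<in> subsets" "J \<inter> I \<noteq> {}"
  shows "(\<integral>\<^sup>+z. ennreal (H I (swap S1 z)) * ennreal (H J (swap S2 z)) \<partial>N)
    \<le> ennreal p ^ (card (I \<union> J) - 1)"
proof (rule nn_cluster_add)
  show "depends_on (\<lambda>z. ennreal (H I (swap S1 z))) (I \<times> UNIV)"
    by (rule depends_on_comp[OF depends_on_HS])
qed (use assms subsetsD nn_cluster_1 in auto)

lemma nn_cluster_4:
  assumes s: "I \<in> subsets" "J \<in> subsets" "K \<in> subsets" "L \<in> subsets"
    and c: "J \<inter> I \<noteq> {}" "K \<inter> (I \<union> J) \<noteq> {}" "L \<inter> (I \<union> J \<union> K) \<noteq> {}"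
  shows "(\<integral>\<^sup>+z. ennreal (H I (swap S1 z)) * ennreal (H J (swap S2 z)) * ennreal (H K (swap S3 z))
      * ennreal (H L (swap S4 z)) \<partial>N) \<le> ennreal p ^ (card (I \<union> J \<union> K \<union> L) - 1)"
proof -
  note sub = subsetsD(1)[OF s(1)] subsetsD(1)[OF s(2)] subsetsD(1)[OF s(3)] subsetsD(1)[OF s(4)]
  let ?F2 = "\<lambda>z. ennreal (H I (swap S1 z)) * ennreal (H J (swap S2 z))"
  let ?F3 = "\<lambda>z. ?F2 z * ennreal (H K (swap S3 z))"
  have d2: "depends_on ?F2 ((I \<union> J) \<times> UNIV)"
    by (intro depends_on_comp2[where g="(*)"] depends_on_comp[where g=ennreal]
        depends_on_mono[OF depends_on_HS]) auto
  have d3: "depends_on ?F3 ((I \<union> J \<union> K) \<times> UNIV)"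
    by (intro depends_on_comp2[where g="(*)"] depends_on_comp[where g=ennreal]
        depends_on_mono[OF depends_on_HS]) auto
  have m: "(\<lambda>z. ennreal (H I (swap S z))) \<in> borel_measurable N" if "I \<in> subsets" for I S
    using measurable_H_swap[OF subsetsD(1)[OF that]] by measurable
  have "(\<integral>\<^sup>+z. ?F3 z \<partial>N) \<le> ennreal p ^ (card ((I \<union> J) \<union> K) - 1)"
    by (rule nn_cluster_add[OF _ d2 nn_cluster_2[OF s(1,2) c(1)] _ s(3) c(2)])
      (use sub s in \<open>auto intro!: borel_measurable_times_ennreal m\<close>)
  then show ?thesis
    by (rule nn_cluster_add[OF _ d3 _ _ s(4) c(3), rotated])
      (use sub s in \<open>auto intro!: borel_measurable_times_ennreal m\<close>)
qed

text \<open>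
  \<open>T = \<Sum> U\<^sub>a\<close> over the pairs \<open>a = (I, J)\<close> below is the sum of \<open>h\<^sub>I (W - W\<^sup>I)\<close>: replacing the points
  in \<open>I\<close> only affects the terms whose index set \<open>J\<close> meets \<open>I\<close>. Two pairs that do not meet yield
  independent \<open>U\<^sub>a\<close>, and \<open>Q\<close> is the resulting bound for everything of second order.
\<close>

definition "pairs = {(I, J). I \<in> subsets \<and> J \<in> subsets \<and> I \<inter> J \<noteq> {}}"
definition meets :: "nat set \<times> nat set \<Rightarrow> nat set \<times> nat set \<Rightarrow> bool" where
  "meets a b \<longleftrightarrow> (fst a \<union> snd a) \<inter> (fst b \<union> snd b) \<noteq> {}"
definition join :: "nat set \<times> nat set \<Rightarrow> nat set \<times> nat set \<Rightarrow> nat set" where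
  "join a b = fst a \<union> snd a \<union> fst b \<union> snd b"
definition "linked = {(a, b). a \<in> pairs \<and> b \<in> pairs \<and> meets a b}"
definition "Q = (\<Sum>(a, b)\<in>linked. p ^ (card (join a b) - 1))"

definition "U a z = H (fst a) (swap {} z) * (H (snd a) (swap {} z) - H (snd a) (swap (fst a) z))"

lemma finite_pairs: "finite pairs"
  by (rule finite_subset[of _ "subsets \<times> subsets"]) (auto simp: pairs_def finite_subsets)

lemma finite_linked: "finite linked"
  by (rule finite_subset[of _ "pairs \<times> pairs"]) (auto simp: linked_def finite_pairs)

lemma integral_le_nn:
  assumes "F \<in> borel_measurable N" "\<And>z. 0 \<le> F z" "(\<integral>\<^sup>+z. ennreal (F z) \<partial>N) \<le> ennreal c" "0 \<le> c"
  shows "(\<integral>z. F z \<partial>N) \<le> c"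
proof -
  have "(\<integral>z. F z \<partial>N) = enn2real (\<integral>\<^sup>+z. ennreal (F z) \<partial>N)"
    using assms by (intro integral_eq_nn_integral) auto
  also have "\<dots> \<le> c" using assms(3,4) by (simp add: enn2real_leI)
  finally show ?thesis .
qed

text \<open>
  The four sets can be visited in an order in which each meets the union of its predecessors: the first pair is
  followed by that member of the second pair which meets it.
\<close>

lemma cluster_4:
  assumes "a \<in> pairs" "b \<in> pairs" "meets a b"
  shows "(\<integral>z. H (fst a) (swap S1 z) * H (snd a) (swap S2 z) * (H (fst b) (swap S3 z)
      * H (snd b) (swap S4 z)) \<partial>N) \<le> p ^ (card (join a b) - 1)"
proof -
  obtain I J K L where ab: "a = (I, J)" "b = (K, L)" by (cases a, cases b)
  have s: "I \<in> subsets" "J \<in> subsets" "K \<in> subsets" "L \<in> subsets" and c: "J \<inter> I \<noteq> {}" "L \<inter> K \<noteq> {}"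
    using assms ab by (auto simp: pairs_def)
  have "(\<integral>\<^sup>+z. ennreal (H I (swap S1 z) * H J (swap S2 z) * (H K (swap S3 z) * H L (swap S4 z))) \<partial>N)
     = (\<integral>\<^sup>+z. ennreal (H I (swap S1 z)) * ennreal (H J (swap S2 z)) * ennreal (H K (swap S3 z))
      * ennreal (H L (swap S4 z)) \<partial>N)"
    by (simp add: ennreal_mult H_bounds mult.assoc)
  also have "\<dots> \<le> ennreal p ^ (card (join a b) - 1)"
  proof (cases "K \<inter> (I \<union> J) = {}")
    case False
    show ?thesis unfolding join_def ab fst_conv snd_conv
      by (rule nn_cluster_4[OF s c(1) False]) (use c in auto)
  next
    case True
    then have L: "L \<inter> (I \<union> J) \<noteq> {}" using assms(3) ab by (auto simp: meets_def)
    have "(\<integral>\<^sup>+z. ennreal (H I (swap S1 z)) * ennreal (H J (swap S2 z)) * ennreal (H L (swap S4 z))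
      * ennreal (H K (swap S3 z)) \<partial>N) \<le> ennreal p ^ (card (I \<union> J \<union> L \<union> K) - 1)"
      by (rule nn_cluster_4[OF s(1,2,4,3) c(1) L]) (use c in auto)
    then show ?thesis by (simp add: join_def ab Un_ac mult_ac)
  qed
  finally show ?thesis
    using s subsetsD(1) p_nonneg unfolding ab fst_conv snd_conv
    by (intro integral_le_nn) (auto simp: H_bounds ennreal_power)
qed

lemma cluster_2:
  assumes "a \<in> pairs"
  shows "(\<integral>z. H (fst a) (swap S1 z) * H (snd a) (swap S2 z) \<partial>N)
    \<le> p ^ (card (fst a \<union> snd a) - 1)"
proof -
  have s: "fst a \<in> subsets" "snd a \<in> subsets" "snd a \<inter> fst a \<noteq> {}"
    using assms by (auto simp: pairs_def)
  show ?thesis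
    using nn_cluster_2[OF s] s subsetsD(1) p_nonneg
    by (intro integral_le_nn) (auto simp: H_bounds ennreal_power ennreal_mult)
qed

lemma pairsD: "a \<in> pairs \<Longrightarrow> fst a \<in> subsets" "a \<in> pairs \<Longrightarrow> snd a \<in> subsets"
  by (auto simp: pairs_def)

lemma measurable_H_subsets: "I \<in> subsets \<Longrightarrow> (\<lambda>z. H I (swap S z)) \<in> borel_measurable N"
  by (rule measurable_H_swap[OF subsetsD(1)])

lemma abs_U_le:
  "\<bar>U a z\<bar> \<le> H (fst a) (swap {} z) * (H (snd a) (swap {} z) + H (snd a) (swap (fst a) z))"
  unfolding U_def abs_mult using H_bounds
  by (auto intro!: mult_mono abs_leI simp: add_increasing add_increasing2)

lemma abs_U_le_1: "\<bar>U a z\<bar> \<le> 1"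
  unfolding U_def H_def by auto

lemma measurable_U [measurable]: "a \<in> pairs \<Longrightarrow> U a \<in> borel_measurable N"
  unfolding U_def[abs_def]
  by (intro borel_measurable_times borel_measurable_diff measurable_H_subsets pairsD)

lemma depends_on_U: "depends_on (U a) ((fst a \<union> snd a) \<times> UNIV)"
  unfolding U_def[abs_def]
  by (intro depends_on_comp2[where g="(*)"] depends_on_comp2[where g="(-)"]
      depends_on_mono[OF depends_on_HS]) auto

lemma integrable_U: "a \<in> pairs \<Longrightarrow> integrable N (U a)"
  using abs_U_le_1 by (intro integrable_bdd[where B=1]) auto

lemma integrable_UU: "a \<in> pairs \<Longrightarrow> b \<in> pairs \<Longrightarrow> integrable N (\<lambda>z. U a z * U b z)"
  using mult_le_one[OF abs_U_le_1 abs_ge_zero abs_U_le_1]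
  by (intro integrable_bdd[where B=1]) (auto simp: abs_mult simp del: split_paired_All)

lemma abs_integral_UU:
  assumes a: "a \<in> pairs" and b: "b \<in> pairs" and m: "meets a b"
  shows "\<bar>\<integral>z. U a z * U b z \<partial>N\<bar> \<le> 4 * p ^ (card (join a b) - 1)"
proof -
  define A where "A S S' z = H (fst a) (swap {} z) * H (snd a) (swap S z) *
    (H (fst b) (swap {} z) * H (snd b) (swap S' z))" for S S' z
  have A_m: "A S S' \<in> borel_measurable N" for S S'
    unfolding A_def[abs_def]
    by (intro borel_measurable_times measurable_H_subsets pairsD a b)
  have A_bd: "0 \<le> A S S' z" "A S S' z \<le> 1" for S S' z
    unfolding A_def by (auto simp: H_def)
  have A_int: "integrable N (A S S')" for S S'
    using A_bd A_m by (intro integrable_bdd[where B=1]) auto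
  have A_le: "(\<integral>z. A S S' z \<partial>N) \<le> p ^ (card (join a b) - 1)" for S S'
    unfolding A_def by (rule cluster_4[OF a b m])
  have "\<bar>\<integral>z. U a z * U b z \<partial>N\<bar> \<le> (\<integral>z. \<bar>U a z * U b z\<bar> \<partial>N)"
    by (rule integral_abs_bound)
  also have "\<dots> \<le> (\<integral>z. A {} {} z + A {} (fst b) z + (A (fst a) {} z + A (fst a) (fst b) z) \<partial>N)"
  proof (rule integral_mono)
    fix z
    have "\<bar>U a z * U b z\<bar> \<le> (H (fst a) (swap {} z) * (H (snd a) (swap {} z) + H (snd a) (swap (fst a) z)))
      * (H (fst b) (swap {} z) * (H (snd b) (swap {} z) + H (snd b) (swap (fst b) z)))"
      unfolding abs_mult using H_bounds by (intro mult_mono abs_U_le) auto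
    also have "\<dots> = A {} {} z + A {} (fst b) z + (A (fst a) {} z + A (fst a) (fst b) z)"
      by (simp add: A_def algebra_simps)
    finally show "\<bar>U a z * U b z\<bar> \<le> A {} {} z + A {} (fst b) z + (A (fst a) {} z + A (fst a) (fst b) z)" .
  qed (use A_int integrable_UU a b in auto)
  also have "\<dots> = (\<integral>z. A {} {} z \<partial>N) + (\<integral>z. A {} (fst b) z \<partial>N)
     + ((\<integral>z. A (fst a) {} z \<partial>N) + (\<integral>z. A (fst a) (fst b) z \<partial>N))"
    using A_int by simp
  also have "\<dots> \<le> 4 * p ^ (card (join a b) - 1)"
    using A_le[of "{}" "{}"] A_le[of "{}" "fst b"] A_le[of "fst a" "{}"] A_le[of "fst a" "fst b"] by linarith
  finally show ?thesis .
qed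

lemma abs_integral_U:
  assumes a: "a \<in> pairs"
  shows "\<bar>\<integral>z. U a z \<partial>N\<bar> \<le> 2 * p ^ (card (fst a \<union> snd a) - 1)"
proof -
  define A where "A S z = H (fst a) (swap {} z) * H (snd a) (swap S z)" for S z
  have A_m: "A S \<in> borel_measurable N" for S
    unfolding A_def[abs_def]
    by (intro borel_measurable_times measurable_H_subsets pairsD a)
  have A_bd: "0 \<le> A S z" "A S z \<le> 1" for S z
    unfolding A_def by (auto simp: H_def)
  have A_int: "integrable N (A S)" for S
    using A_bd A_m by (intro integrable_bdd[where B=1]) auto
  have A_le: "(\<integral>z. A S z \<partial>N) \<le> p ^ (card (fst a \<union> snd a) - 1)" for S
    unfolding A_def by (rule cluster_2[OF a])
  have "\<bar>\<integral>z. U a z \<partial>N\<bar> \<le> (\<integral>z. \<bar>U a z\<bar> \<partial>N)"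
    by (rule integral_abs_bound)
  also have "\<dots> \<le> (\<integral>z. A {} z + A (fst a) z \<partial>N)"
  proof (rule integral_mono)
    show "\<bar>U a z\<bar> \<le> A {} z + A (fst a) z" for z
      using abs_U_le[of a z] by (simp add: A_def algebra_simps)
  qed (use A_int integrable_U[OF a] in auto)
  also have "\<dots> = (\<integral>z. A {} z \<partial>N) + (\<integral>z. A (fst a) z \<partial>N)"
    using A_int by simp
  also have "\<dots> \<le> 2 * p ^ (card (fst a \<union> snd a) - 1)"
    using A_le[of "{}"] A_le[of "fst a"] by linarith
  finally show ?thesis .
qed

text \<open>
  For pairs that meet, the product of the means is no larger than the bound for the mean of the product: the
  two exponents add up to \<open>card A + card B - 2\<close>, which is at least \<open>card (A \<union> B) - 1\<close> because \<open>A\<close> and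
  \<open>B\<close> share an index.
\<close>

lemma covariance_U:
  assumes a: "a \<in> pairs" and b: "b \<in> pairs"
  shows "(\<integral>z. U a z * U b z \<partial>N) - (\<integral>z. U a z \<partial>N) * (\<integral>z. U b z \<partial>N)
    \<le> (if meets a b then 8 * p ^ (card (join a b) - 1) else 0)"
proof (cases "meets a b")
  case False
  have "(\<integral>z. U a z * U b z \<partial>N) = (\<integral>z. U a z \<partial>N) * (\<integral>z. U b z \<partial>N)"
    unfolding N_def
  proof (rule integral_mult_depends_on[OF _ _ _ _ depends_on_U depends_on_U])
    show "prob_space \<mu>" by unfold_locales
    show "(fst a \<union> snd a) \<times> UNIV \<inter> (fst b \<union> snd b) \<times> UNIV = ({} :: (nat \<times> bool) set)"
      using False unfolding meets_def by blast
    show "(fst a \<union> snd a) \<times> UNIV \<subseteq> V" "(fst b \<union> snd b) \<times> UNIV \<subseteq> V"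
      using a b subsetsD(1) unfolding V_def pairs_def by fastforce+
  qed (use integrable_U[OF a] integrable_U[OF b] in \<open>simp_all add: N_def\<close>)
  then show ?thesis using False by simp
next
  case True
  let ?A = "fst a \<union> snd a" and ?B = "fst b \<union> snd b"
  have fin: "finite ?A" "finite ?B" using a b subsetsD(4) by (auto simp: pairs_def)
  have "card (join a b) + card (?A \<inter> ?B) = card ?A + card ?B"
    using card_Un_Int[OF fin] by (simp add: join_def Un_assoc)
  moreover have "card (?A \<inter> ?B) > 0" "card ?A > 0" "card ?B > 0"
    using True fin by (auto simp: meets_def card_gt_0_iff)
  ultimately have le: "card (join a b) - 1 \<le> (card ?A - 1) + (card ?B - 1)" by linarith
  have "\<bar>(\<integral>z. U a z \<partial>N) * (\<integral>z. U b z \<partial>N)\<bar>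
      \<le> (2 * p ^ (card ?A - 1)) * (2 * p ^ (card ?B - 1))"
    unfolding abs_mult using p_nonneg by (intro mult_mono abs_integral_U a b) auto
  also have "\<dots> = 4 * p ^ ((card ?A - 1) + (card ?B - 1))"
    by (simp add: power_add)
  also have "\<dots> \<le> 4 * p ^ (card (join a b) - 1)"
    using power_decreasing[OF le p_nonneg p_le_1] by simp
  finally show ?thesis using abs_integral_UU[OF a b True] True by auto
qed

definition "T z = (\<Sum>a\<in>pairs. U a z)"

lemma measurable_T [measurable]: "T \<in> borel_measurable N"
  unfolding T_def[abs_def] by (intro borel_measurable_sum measurable_U)

lemma abs_T_le: "\<bar>T z\<bar> \<le> card pairs"
  unfolding T_def using sum_norm_le[of pairs "\<lambda>a. U a z" "\<lambda>_. 1"] abs_U_le_1 by simp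

lemma variance_T_le: "(\<integral>z. (T z - (\<integral>z. T z \<partial>N))\<^sup>2 \<partial>N) \<le> 8 * Q"
proof -
  have T2: "(T z)\<^sup>2 = (\<Sum>a\<in>pairs. \<Sum>b\<in>pairs. U a z * U b z)" for z
    by (simp add: T_def power2_eq_square sum_product)
  have ET: "(\<integral>z. T z \<partial>N) = (\<Sum>a\<in>pairs. \<integral>z. U a z \<partial>N)"
    unfolding T_def by (rule Bochner_Integration.integral_sum) (rule integrable_U)
  have ET2: "(\<integral>z. (T z)\<^sup>2 \<partial>N) = (\<Sum>a\<in>pairs. \<Sum>b\<in>pairs. \<integral>z. U a z * U b z \<partial>N)"
    unfolding T2 using integrable_UU by simp
  have "integrable N T" by (rule integrable_bdd[where B="card pairs"]) (auto simp: abs_T_le)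
  moreover have "integrable N (\<lambda>z. (T z)\<^sup>2)"
  proof (rule integrable_bdd)
    show "norm ((T z)\<^sup>2) \<le> (real (card pairs))\<^sup>2" for z
      using power_mono[OF abs_T_le[of z], of 2] by simp
  qed simp
  ultimately have "(\<integral>z. (T z - (\<integral>z. T z \<partial>N))\<^sup>2 \<partial>N) = (\<integral>z. (T z)\<^sup>2 \<partial>N) - (\<integral>z. T z \<partial>N)\<^sup>2"
    by (rule N.variance_eq)
  also have "\<dots> = (\<Sum>a\<in>pairs. \<Sum>b\<in>pairs. (\<integral>z. U a z * U b z \<partial>N) - (\<integral>z. U a z \<partial>N) * (\<integral>z. U b z \<partial>N))"
    unfolding ET ET2 by (simp add: power2_eq_square sum_product sum_subtractf)
  also have "\<dots> \<le> (\<Sum>a\<in>pairs. \<Sum>b\<in>pairs. if meets a b then 8 * p ^ (card (join a b) - 1) else 0)"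
    by (intro sum_mono covariance_U)
  also have "\<dots> = (\<Sum>(a, b)\<in>pairs \<times> pairs. if meets a b then 8 * p ^ (card (join a b) - 1) else 0)"
    by (simp add: sum.cartesian_product)
  also have "\<dots> = (\<Sum>(a, b)\<in>linked. 8 * p ^ (card (join a b) - 1))"
    by (rule sum.mono_neutral_cong_right) (auto simp: finite_pairs linked_def split: if_splits)
  finally show ?thesis by (simp add: Q_def sum_distrib_left case_prod_unfold)
qed

lemma f_diff:
  assumes "I \<in> subsets"
  shows "H I (swap {} z) * (f (swap {} z) - f (swap I z)) = (\<Sum>J\<in>{J \<in> subsets. I \<inter> J \<noteq> {}}. U (I, J) z)"
proof -
  have "f (swap {} z) - f (swap I z) = (\<Sum>J\<in>subsets. H J (swap {} z) - H J (swap I z))"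
    by (simp add: f_def sum_subtractf)
  also have "\<dots> = (\<Sum>J\<in>{J \<in> subsets. I \<inter> J \<noteq> {}}. H J (swap {} z) - H J (swap I z))"
  proof (rule sum.mono_neutral_right)
    show "\<forall>J\<in>subsets - {J \<in> subsets. I \<inter> J \<noteq> {}}. H J (swap {} z) - H J (swap I z) = 0"
      by (intro ballI right_minus_eq[THEN iffD2] depends_onD[OF depends_on_H])
        (simp add: swap_def, metis (full_types) disjoint_iff)
  qed (auto simp: finite_subsets)
  finally show ?thesis by (simp add: sum_distrib_left U_def)
qed

lemma T_eq: "T z = (\<Sum>I\<in>subsets. H I (swap {} z) * (f (swap {} z) - f (swap I z)))"
proof -
  have "T z = (\<Sum>a\<in>(SIGMA I:subsets. {J \<in> subsets. I \<inter> J \<noteq> {}}). U a z)"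
    unfolding T_def by (rule sum.cong) (auto simp: pairs_def)
  also have "\<dots> = (\<Sum>I\<in>subsets. \<Sum>J\<in>{J \<in> subsets. I \<inter> J \<noteq> {}}. U (I, J) z)"
    by (subst sum.Sigma) (auto simp: finite_subsets intro!: sum.cong)
  finally show ?thesis by (simp add: f_diff)
qed

text \<open>
  As \<open>h\<^sub>I\<^sup>2 = h\<^sub>I\<close>, the second-order term \<open>h\<^sub>I (W - W\<^sup>I)\<^sup>2\<close> is the square of \<open>\<Sum>\<^sub>J U\<^sub>I\<^sub>J\<close>, hence a
  sum over pairs of pairs with a common first component; these are linked.
\<close>

lemma second_order_le:
  "(\<Sum>I\<in>subsets. \<integral>z. H I (swap {} z) * (f (swap {} z) - f (swap I z))\<^sup>2 \<partial>N) \<le> 4 * Q"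
proof -
  let ?nb = "\<lambda>I. {J \<in> subsets. I \<inter> J \<noteq> {}}"
  have pr: "(I, J) \<in> pairs" if "I \<in> subsets" "J \<in> ?nb I" for I J
    using that by (auto simp: pairs_def)
  have "(\<Sum>I\<in>subsets. \<integral>z. H I (swap {} z) * (f (swap {} z) - f (swap I z))\<^sup>2 \<partial>N)
    = (\<Sum>I\<in>subsets. \<Sum>J\<in>?nb I. \<Sum>K\<in>?nb I. \<integral>z. U (I, J) z * U (I, K) z \<partial>N)"
  proof (rule sum.cong[OF refl])
    fix I assume I: "I \<in> subsets"
    have "H I (swap {} z) * (f (swap {} z) - f (swap I z))\<^sup>2
      = (\<Sum>J\<in>?nb I. \<Sum>K\<in>?nb I. U (I, J) z * U (I, K) z)" for z
    proof -
      have "H I (swap {} z) * (f (swap {} z) - f (swap I z))\<^sup>2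
        = (H I (swap {} z) * (f (swap {} z) - f (swap I z)))\<^sup>2"
        unfolding power_mult_distrib by (simp add: power2_eq_square[of "H I (swap {} z)"] H_bounds(4))
      then show ?thesis by (simp add: f_diff[OF I] power2_eq_square sum_product)
    qed
    then have "(\<integral>z. H I (swap {} z) * (f (swap {} z) - f (swap I z))\<^sup>2 \<partial>N)
      = (\<integral>z. (\<Sum>J\<in>?nb I. \<Sum>K\<in>?nb I. U (I, J) z * U (I, K) z) \<partial>N)"
      by simp
    also have "\<dots> = (\<Sum>J\<in>?nb I. \<integral>z. (\<Sum>K\<in>?nb I. U (I, J) z * U (I, K) z) \<partial>N)"
      by (intro Bochner_Integration.integral_sum Bochner_Integration.integrable_sum integrable_UU pr I)
    also have "\<dots> = (\<Sum>J\<in>?nb I. \<Sum>K\<in>?nb I. \<integral>z. U (I, J) z * U (I, K) z \<partial>N)"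
      by (intro sum.cong refl Bochner_Integration.integral_sum integrable_UU pr I)
    finally show "(\<integral>z. H I (swap {} z) * (f (swap {} z) - f (swap I z))\<^sup>2 \<partial>N)
      = (\<Sum>J\<in>?nb I. \<Sum>K\<in>?nb I. \<integral>z. U (I, J) z * U (I, K) z \<partial>N)" .
  qed
  also have "\<dots> \<le> (\<Sum>I\<in>subsets. \<Sum>J\<in>?nb I. \<Sum>K\<in>?nb I. 4 * p ^ (card (join (I, J) (I, K)) - 1))"
  proof (intro sum_mono)
    fix I J K assume "I \<in> subsets" "J \<in> ?nb I" "K \<in> ?nb I"
    then have "(I, J) \<in> pairs" "(I, K) \<in> pairs" "meets (I, J) (I, K)"
      using pr subsetsD(3)[of I] by (auto simp: meets_def)
    from abs_integral_UU[OF this]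
    show "(\<integral>z. U (I, J) z * U (I, K) z \<partial>N) \<le> 4 * p ^ (card (join (I, J) (I, K)) - 1)" by linarith
  qed
  also have "\<dots> = (\<Sum>(I, J, K)\<in>(SIGMA I:subsets. ?nb I \<times> ?nb I). 4 * p ^ (card (join (I, J) (I, K)) - 1))"
    by (simp add: sum.Sigma finite_subsets sum.cartesian_product)
  also have "\<dots> = (\<Sum>(a, b)\<in>(\<lambda>(I, J, K). ((I, J), (I, K))) ` (SIGMA I:subsets. ?nb I \<times> ?nb I).
      4 * p ^ (card (join a b) - 1))"
    by (subst sum.reindex) (auto simp: inj_on_def intro!: sum.cong)
  also have "\<dots> \<le> (\<Sum>(a, b)\<in>linked. 4 * p ^ (card (join a b) - 1))"
    using p_nonneg finite_linked
    by (intro sum_mono2) (auto simp: linked_def pairs_def meets_def dest: subsetsD(3))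
  finally show ?thesis by (simp add: Q_def sum_distrib_left case_prod_unfold)
qed

section \<open>The differential equation of the characteristic function\<close>

lemma integral_swap:
  fixes F :: "(nat \<Rightarrow> 'a) \<Rightarrow> 'b::{banach, second_countable_topology}"
  assumes "F \<in> borel_measurable (PiM {1..n} (\<lambda>_. \<mu>))" "depends_on F {1..n}"
  shows "(\<integral>z. F (swap S z) \<partial>N) = (\<integral>x. F x \<partial>PiM {1..n} (\<lambda>_. \<mu>))"
  unfolding N_def swap_def
  by (rule integral_reindex[OF _ assms(2,1)]) (unfold_locales, auto simp: V_def inj_on_def)

definition "M = card subsets"

lemma f_nat: "\<exists>k\<le>M. f x = real k"
proof -
  have "f x = real (card (subsets \<inter> {I. h I x}))"
    unfolding f_def H_def by (subst sum_of_bool_eq) (simp_all add: finite_subsets)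
  moreover have "card (subsets \<inter> {I. h I x}) \<le> M"
    unfolding M_def using finite_subsets by (intro card_mono) auto
  ultimately show ?thesis by blast
qed

lemma f_bounds: "0 \<le> f x" "f x \<le> M" "\<bar>f x\<bar> \<le> M"
  using f_nat[of x] by auto

definition "W z = f (swap {} z)"
definition "m = (\<integral>z. W z \<partial>N)"
definition "v = (\<integral>z. (W z - m)\<^sup>2 \<partial>N)"
definition "\<phi> \<theta> = (\<integral>z. cis (\<theta> * (W z - m)) \<partial>N)"

lemma measurable_W [measurable]: "W \<in> borel_measurable N"
  unfolding W_def[abs_def] by measurable

lemma W_bounds: "0 \<le> W z" "W z \<le> M" "\<bar>W z\<bar> \<le> M"
  unfolding W_def by (rule f_bounds)+

lemma integrable_W: "integrable N W"
  using W_bounds(3) by (intro integrable_bdd[where B=M]) auto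

text \<open>
  \<open>W\<^sup>I\<close> does not involve the original points with index in \<open>I\<close>, so it is independent of \<open>h\<^sub>I\<close>; and it has the
  law of \<open>W\<close>. Hence \<open>E h\<^sub>I E g(W) = E h\<^sub>I E g(W\<^sup>I) = E h\<^sub>I g(W\<^sup>I)\<close>.
\<close>

lemma stein_identity:
  fixes g :: "real \<Rightarrow> complex"
  assumes g [measurable]: "g \<in> borel_measurable borel" and B: "\<And>x. norm (g (f x)) \<le> B"
  shows "(\<integral>z. of_real (W z - m) * g (W z) \<partial>N)
    = (\<Sum>I\<in>subsets. \<integral>z. of_real (H I (swap {} z)) * (g (W z) - g (f (swap I z))) \<partial>N)"
proof -
  have gS: "(\<lambda>z. g (f (swap S z))) \<in> borel_measurable N" for S by measurable
  have int_g: "integrable N (\<lambda>z. g (f (swap S z)))" for S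
    using B by (intro integrable_bdd[OF gS]) auto
  have HS: "integrable N (\<lambda>z. H I (swap {} z))" if "I \<in> subsets" for I
    using that H_bounds by (intro integrable_bdd[OF measurable_H_subsets, where B=1]) auto
  have HgS: "integrable N (\<lambda>z. of_real (H I (swap {} z)) * g (f (swap S z)))" if "I \<in> subsets" for I S
  proof (rule integrable_bdd)
    show "norm (complex_of_real (H I (swap {} z)) * g (f (swap S z))) \<le> 1 * B" for z
      unfolding norm_mult using H_bounds B by (intro mult_mono) auto
  qed (use measurable_H_subsets[OF that] in measurable)
  have eq: "(\<integral>z. g (f (swap I z)) \<partial>N) = (\<integral>z. g (W z) \<partial>N)" for I
  proof -
    have "(\<lambda>x. g (f x)) \<in> borel_measurable (PiM {1..n} (\<lambda>_. \<mu>))"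
      using measurable_f by measurable
    from integral_swap[OF this depends_on_comp[OF depends_on_f]] show ?thesis
      unfolding W_def by metis
  qed
  have ind: "(\<integral>z. of_real (H I (swap {} z)) * g (f (swap I z)) \<partial>N)
      = of_real (\<integral>z. H I (swap {} z) \<partial>N) * (\<integral>z. g (W z) \<partial>N)" if I: "I \<in> subsets" for I
  proof -
    have "(\<integral>z. of_real (H I (swap {} z)) * g (f (swap I z)) \<partial>N)
      = (\<integral>z. of_real (H I (swap {} z)) \<partial>N) * (\<integral>z. g (f (swap I z)) \<partial>N)"
      unfolding N_def
    proof (rule integral_mult_depends_on)
      show "prob_space \<mu>" by unfold_locales
      show "depends_on (\<lambda>z. complex_of_real (H I (swap {} z))) ((\<lambda>i. (i, i \<in> {})) ` I)"
        by (rule depends_on_comp[OF depends_on_swap[OF depends_on_H]])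
      show "depends_on (\<lambda>z. g (f (swap I z))) ((\<lambda>i. (i, i \<in> I)) ` {1..n})"
        by (rule depends_on_comp[OF depends_on_swap[OF depends_on_f]])
      show "(\<lambda>i. (i, i \<in> {})) ` I \<inter> (\<lambda>i. (i, i \<in> I)) ` {1..n} = {}" by auto
    qed (use int_g HS[OF I] subsetsD(1)[OF I] in \<open>auto simp: V_def N_def\<close>)
    then show ?thesis by (simp add: eq)
  qed
  have m: "m = (\<Sum>I\<in>subsets. \<integral>z. H I (swap {} z) \<partial>N)"
    unfolding m_def W_def f_def by (rule Bochner_Integration.integral_sum) (rule HS)
  have "(\<integral>z. of_real (W z - m) * g (W z) \<partial>N)
      = (\<integral>z. (\<Sum>I\<in>subsets. of_real (H I (swap {} z)) * g (W z)) - of_real m * g (W z) \<partial>N)"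
    by (simp add: W_def f_def sum_distrib_right algebra_simps)
  also have "\<dots> = (\<integral>z. (\<Sum>I\<in>subsets. of_real (H I (swap {} z)) * g (W z)) \<partial>N) - (\<integral>z. of_real m * g (W z) \<partial>N)"
    unfolding W_def
    by (intro Bochner_Integration.integral_diff Bochner_Integration.integrable_sum HgS integrable_mult_right int_g)
  also have "(\<integral>z. (\<Sum>I\<in>subsets. of_real (H I (swap {} z)) * g (W z)) \<partial>N)
      = (\<Sum>I\<in>subsets. \<integral>z. of_real (H I (swap {} z)) * g (W z) \<partial>N)"
    unfolding W_def by (intro Bochner_Integration.integral_sum HgS)
  also have "(\<integral>z. of_real m * g (W z) \<partial>N) = (\<Sum>I\<in>subsets. \<integral>z. of_real (H I (swap {} z)) * g (f (swap I z)) \<partial>N)"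
  proof -
    have "(\<integral>z. of_real m * g (W z) \<partial>N) = of_real m * (\<integral>z. g (W z) \<partial>N)" by simp
    also have "\<dots> = (\<Sum>I\<in>subsets. of_real (\<integral>z. H I (swap {} z) \<partial>N) * (\<integral>z. g (W z) \<partial>N))"
      by (simp add: m sum_distrib_right)
    also have "\<dots> = (\<Sum>I\<in>subsets. \<integral>z. of_real (H I (swap {} z)) * g (f (swap I z)) \<partial>N)"
      by (intro sum.cong refl ind[symmetric])
    finally show ?thesis .
  qed
  also have "(\<Sum>I\<in>subsets. \<integral>z. of_real (H I (swap {} z)) * g (W z) \<partial>N) - \<dots>
      = (\<Sum>I\<in>subsets. \<integral>z. of_real (H I (swap {} z)) * (g (W z) - g (f (swap I z))) \<partial>N)"
    unfolding sum_subtractf[symmetric] W_def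
  proof (rule sum.cong[OF refl])
    fix I assume "I \<in> subsets"
    from Bochner_Integration.integral_diff[OF HgS[OF this, of "{}"] HgS[OF this, of I]]
    show "(\<integral>z. of_real (H I (swap {} z)) * g (f (swap {} z)) \<partial>N)
        - (\<integral>z. of_real (H I (swap {} z)) * g (f (swap I z)) \<partial>N)
      = (\<integral>z. of_real (H I (swap {} z)) * (g (f (swap {} z)) - g (f (swap I z))) \<partial>N)"
      by (simp add: right_diff_distrib)
  qed
  finally show ?thesis .
qed

text \<open>The Stein identity for the identity function.\<close>

lemma expectation_T: "(\<integral>z. T z \<partial>N) = v"
proof -
  define g :: "real \<Rightarrow> complex" where "g w = of_real w" for w
  have gm: "g \<in> borel_measurable borel" unfolding g_def[abs_def] by measurable
  have int: "integrable N (\<lambda>z. H I (swap {} z) * (W z - f (swap I z)))" if "I \<in> subsets" for I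
  proof (rule integrable_bdd)
    show "(\<lambda>z. H I (swap {} z) * (W z - f (swap I z))) \<in> borel_measurable N"
      using measurable_H_subsets[OF that] by measurable
    have "\<bar>H I (swap {} z)\<bar> * \<bar>W z - f (swap I z)\<bar> \<le> 1 * real M" for z
      using f_bounds[of "swap I z"] W_bounds[of z] H_bounds by (intro mult_mono) auto
    then show "norm (H I (swap {} z) * (W z - f (swap I z))) \<le> 1 * real M" for z
      by (simp add: abs_mult)
  qed
  have "complex_of_real (\<integral>z. (W z - m) * W z \<partial>N) = (\<integral>z. of_real (W z - m) * g (W z) \<partial>N)"
    by (simp add: g_def flip: integral_complex_of_real of_real_mult of_real_diff)
  also have "\<dots> = (\<Sum>I\<in>subsets. \<integral>z. of_real (H I (swap {} z)) * (g (W z) - g (f (swap I z))) \<partial>N)"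
    by (rule stein_identity[OF gm, of M]) (auto simp: g_def f_bounds)
  also have "\<dots> = (\<Sum>I\<in>subsets. of_real (\<integral>z. H I (swap {} z) * (W z - f (swap I z)) \<partial>N))"
    by (simp add: g_def flip: integral_complex_of_real of_real_mult of_real_diff)
  also have "\<dots> = of_real (\<Sum>I\<in>subsets. \<integral>z. H I (swap {} z) * (W z - f (swap I z)) \<partial>N)" by simp
  also have "(\<Sum>I\<in>subsets. \<integral>z. H I (swap {} z) * (W z - f (swap I z)) \<partial>N) = (\<integral>z. T z \<partial>N)"
    unfolding T_eq using int unfolding W_def by (intro Bochner_Integration.integral_sum[symmetric]) auto
  finally have *: "(\<integral>z. (W z - m) * W z \<partial>N) = (\<integral>z. T z \<partial>N)"
    unfolding of_real_eq_iff .
  have W2: "integrable N (\<lambda>z. (W z - m) * W z)"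
  proof (rule integrable_bdd)
    have "\<bar>W z - m\<bar> * \<bar>W z\<bar> \<le> (M + \<bar>m\<bar>) * M" for z
      using W_bounds[of z] by (intro mult_mono) auto
    then show "norm ((W z - m) * W z) \<le> (M + \<bar>m\<bar>) * M" for z by (simp add: abs_mult)
  qed measurable
  have "v = (\<integral>z. (W z - m) * W z - m * (W z - m) \<partial>N)"
    unfolding v_def by (simp add: power2_eq_square algebra_simps)
  also have "\<dots> = (\<integral>z. (W z - m) * W z \<partial>N) - m * (\<integral>z. W z - m \<partial>N)"
    using W2 integrable_W by simp
  also have "(\<integral>z. W z - m \<partial>N) = 0" using integrable_W by (simp add: m_def N.prob_space)
  finally show ?thesis using * by simp
qed

lemma integral_abs_le_sqrt:
  assumes "integrable N X" "integrable N (\<lambda>z. (X z)\<^sup>2)"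
  shows "(\<integral>z. \<bar>X z :: real\<bar> \<partial>N) \<le> sqrt (\<integral>z. (X z)\<^sup>2 \<partial>N)"
proof (rule real_le_rsqrt)
  have "0 \<le> N.variance (\<lambda>z. \<bar>X z\<bar>)" by (rule N.variance_positive)
  also have "\<dots> = (\<integral>z. \<bar>X z\<bar>\<^sup>2 \<partial>N) - (\<integral>z. \<bar>X z\<bar> \<partial>N)\<^sup>2"
    using assms by (intro N.variance_eq) auto
  finally show "(\<integral>z. \<bar>X z\<bar> \<partial>N)\<^sup>2 \<le> (\<integral>z. (X z)\<^sup>2 \<partial>N)" by simp
qed

lemma expectation_W_eq_sum:
  fixes g :: "real \<Rightarrow> 'b::{banach, second_countable_topology}"
  shows "(\<integral>z. g (W z) \<partial>N) = (\<Sum>k\<le>M. N.prob {z \<in> space N. nat \<lfloor>W z\<rfloor> = k} *\<^sub>R g (real k))"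
proof -
  have W_nat: "W z = real (nat \<lfloor>W z\<rfloor>)" "nat \<lfloor>W z\<rfloor> \<le> M" for z
    using f_nat[of "swap {} z"] by (auto simp: W_def)
  have "(\<integral>z. g (W z) \<partial>N) = (\<integral>z. g (real (nat \<lfloor>W z\<rfloor>)) \<partial>N)"
    by (rule Bochner_Integration.integral_cong[OF refl], rule arg_cong[where f=g], rule W_nat)
  also have "\<dots> = (\<Sum>k\<le>M. N.prob {z \<in> space N. nat \<lfloor>W z\<rfloor> = k} *\<^sub>R g (real k))"
    by (rule N.expectation_bounded_nat[where g="\<lambda>k. g (real k)"]) (measurable, rule W_nat)
  finally show ?thesis .
qed

lemma \<phi>_derivative:
  "(\<phi> has_vector_derivative (\<integral>z. \<i> * of_real (W z - m) * cis (\<theta> * (W z - m)) \<partial>N)) (at \<theta> within S)"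
proof -
  have "\<phi> = (\<lambda>\<theta>. \<Sum>k\<le>M. N.prob {z \<in> space N. nat \<lfloor>W z\<rfloor> = k} *\<^sub>R cis (\<theta> * (real k - m)))"
    unfolding \<phi>_def[abs_def] by (intro ext expectation_W_eq_sum[where g="\<lambda>w. cis (_ * (w - m))"])
  moreover have "(\<integral>z. \<i> * of_real (W z - m) * cis (\<theta> * (W z - m)) \<partial>N) =
    (\<Sum>k\<le>M. N.prob {z \<in> space N. nat \<lfloor>W z\<rfloor> = k} *\<^sub>R (\<i> * of_real (real k - m) * cis (\<theta> * (real k - m))))"
    by (rule expectation_W_eq_sum[where g="\<lambda>w. \<i> * of_real (w - m) * cis (_ * (w - m))"])
  ultimately show ?thesis
    by (simp only:) (intro has_vector_derivative_sum
        bounded_linear.has_vector_derivative[OF bounded_linear_scaleR_right] cis_has_vector_derivative)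
qed

lemma Q_nonneg: "0 \<le> Q"
  unfolding Q_def using p_nonneg by (intro sum_nonneg) auto

lemma norm_cis_remainder: "norm (1 - \<i> * of_real x - cis (- x)) \<le> x\<^sup>2 / 2"
proof -
  have "norm (iexp (- x) - (\<Sum>k\<le>1. (\<i> * of_real (- x)) ^ k / fact k)) \<le> \<bar>- x\<bar> ^ Suc 1 / fact (Suc 1)"
    by (rule iexp_approx1)
  also have "iexp (- x) - (\<Sum>k\<le>1. (\<i> * of_real (- x)) ^ k / fact k) = - (1 - \<i> * of_real x - cis (- x))"
    by (simp add: cis_conv_exp)
  finally show ?thesis by (simp only: norm_minus_cancel) (simp add: power2_eq_square)
qed

text \<open>
  The Stein identity for \<open>g = cis (\<theta> (\<cdot> - m))\<close>, with \<open>g(W\<^sup>I) = g(W) cis (- \<theta> (W - W\<^sup>I))\<close> expanded to first order.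
\<close>

lemma stein_expansion:
  "norm ((\<integral>z. of_real (W z - m) * cis (\<theta> * (W z - m)) \<partial>N)
      - \<i> * of_real \<theta> * (\<integral>z. of_real (T z) * cis (\<theta> * (W z - m)) \<partial>N)) \<le> 2 * \<theta>\<^sup>2 * Q"
proof -
  define g where "g w = cis (\<theta> * (w - m))" for w
  define D where "D I z = W z - f (swap I z)" for I z
  have gm [measurable]: "g \<in> borel_measurable borel" 
    unfolding g_def[abs_def] cis_conv_exp by measurable
  have [measurable]: "D I \<in> borel_measurable N" for I unfolding D_def[abs_def] by measurable
  have D_bd: "\<bar>D I z\<bar> \<le> M" for I z
    using f_bounds[of "swap I z"] W_bounds[of z] unfolding D_def by auto
  have ng: "norm (g w) = 1" for w by (simp add: g_def)
  have HD: "\<bar>H I (swap {} z) * D I z\<bar> \<le> M" for I z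
    using D_bd[of I z] by (auto simp: H_def)
  have int1: "integrable N (\<lambda>z. of_real (H I (swap {} z)) * (g (W z) - g (f (swap I z))))" if I: "I \<in> subsets" for I
  proof (rule integrable_bdd)
    show "norm (complex_of_real (H I (swap {} z)) * (g (W z) - g (f (swap I z)))) \<le> 1 * (1 + 1)" for z
      unfolding norm_mult using H_bounds norm_triangle_ineq4[of "g (W z)" "g (f (swap I z))"]
      by (intro mult_mono) (auto simp: ng)
  qed (use measurable_H_subsets[OF I] in measurable)
  have int2: "integrable N (\<lambda>z. of_real (H I (swap {} z) * D I z) * g (W z))" if I: "I \<in> subsets" for I
  proof (rule integrable_bdd)
    show "norm (complex_of_real (H I (swap {} z) * D I z) * g (W z)) \<le> M" for z
      using HD[of I z] by (simp add: norm_mult ng)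
  qed (use measurable_H_subsets[OF I] in measurable)
  have int3: "integrable N (\<lambda>z. H I (swap {} z) * (D I z)\<^sup>2)" if I: "I \<in> subsets" for I
  proof (rule integrable_bdd)
    show "norm (H I (swap {} z) * (D I z)\<^sup>2) \<le> (real M)\<^sup>2" for z
      using power_mono[OF D_bd[of I z], of 2] by (auto simp: H_def)
  qed (use measurable_H_subsets[OF I] in measurable)
  have TD: "T z = (\<Sum>I\<in>subsets. H I (swap {} z) * D I z)" for z
    by (simp add: T_eq D_def W_def)
  have "(\<integral>z. of_real (T z) * g (W z) \<partial>N) = (\<Sum>I\<in>subsets. \<integral>z. of_real (H I (swap {} z) * D I z) * g (W z) \<partial>N)"
    unfolding TD of_real_sum sum_distrib_right
    by (intro Bochner_Integration.integral_sum int2)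
  moreover have "(\<integral>z. of_real (W z - m) * g (W z) \<partial>N)
    = (\<Sum>I\<in>subsets. \<integral>z. of_real (H I (swap {} z)) * (g (W z) - g (f (swap I z))) \<partial>N)"
    by (rule stein_identity[OF gm, of 1]) (simp add: ng)
  ultimately have "(\<integral>z. of_real (W z - m) * g (W z) \<partial>N) - \<i> * of_real \<theta> * (\<integral>z. of_real (T z) * g (W z) \<partial>N)
    = (\<Sum>I\<in>subsets. (\<integral>z. of_real (H I (swap {} z)) * (g (W z) - g (f (swap I z))) \<partial>N)
       - \<i> * of_real \<theta> * (\<integral>z. of_real (H I (swap {} z) * D I z) * g (W z) \<partial>N))"
    by (simp add: sum_subtractf sum_distrib_left)
  also have "norm \<dots> \<le> (\<Sum>I\<in>subsets. \<theta>\<^sup>2 / 2 * (\<integral>z. H I (swap {} z) * (D I z)\<^sup>2 \<partial>N))"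
  proof (rule sum_norm_le)
    fix I assume I: "I \<in> subsets"
    define R where "R z = of_real (H I (swap {} z)) * (g (W z) - g (f (swap I z)))
      - \<i> * of_real \<theta> * (of_real (H I (swap {} z) * D I z) * g (W z))" for z
    have R_int: "integrable N R"
      unfolding R_def[abs_def] using int1[OF I] int2[OF I] by simp
    have R_eq: "R z = of_real (H I (swap {} z)) * g (W z) * (1 - \<i> * of_real (\<theta> * D I z) - cis (- (\<theta> * D I z)))" for z
    proof -
      have "g (f (swap I z)) = g (W z) * cis (- (\<theta> * D I z))"
        by (simp add: g_def D_def cis_mult algebra_simps)
      then show ?thesis by (simp add: R_def algebra_simps)
    qed
    have R_bd: "norm (R z) \<le> \<theta>\<^sup>2 / 2 * (H I (swap {} z) * (D I z)\<^sup>2)" for z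
    proof -
      have "norm (R z) = H I (swap {} z) * norm (1 - \<i> * of_real (\<theta> * D I z) - cis (- (\<theta> * D I z)))"
        unfolding R_eq norm_mult ng using H_bounds(1) by simp
      also have "\<dots> \<le> H I (swap {} z) * ((\<theta> * D I z)\<^sup>2 / 2)"
        by (intro mult_left_mono norm_cis_remainder H_bounds)
      finally show ?thesis by (simp add: power_mult_distrib mult_ac)
    qed
    have "(\<integral>z. of_real (H I (swap {} z)) * (g (W z) - g (f (swap I z))) \<partial>N)
       - \<i> * of_real \<theta> * (\<integral>z. of_real (H I (swap {} z) * D I z) * g (W z) \<partial>N) = (\<integral>z. R z \<partial>N)"
      unfolding R_def using int1[OF I] int2[OF I] by simp
    then have "norm ((\<integral>z. of_real (H I (swap {} z)) * (g (W z) - g (f (swap I z))) \<partial>N)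
       - \<i> * of_real \<theta> * (\<integral>z. of_real (H I (swap {} z) * D I z) * g (W z) \<partial>N)) = norm (\<integral>z. R z \<partial>N)"
      by (rule arg_cong)
    also have "\<dots> \<le> (\<integral>z. norm (R z) \<partial>N)"
      by (rule integral_norm_bound)
    also have "\<dots> \<le> (\<integral>z. \<theta>\<^sup>2 / 2 * (H I (swap {} z) * (D I z)\<^sup>2) \<partial>N)"
      using R_int int3[OF I] R_bd by (intro integral_mono) auto
    finally show "norm ((\<integral>z. of_real (H I (swap {} z)) * (g (W z) - g (f (swap I z))) \<partial>N)
       - \<i> * of_real \<theta> * (\<integral>z. of_real (H I (swap {} z) * D I z) * g (W z) \<partial>N))
      \<le> \<theta>\<^sup>2 / 2 * (\<integral>z. H I (swap {} z) * (D I z)\<^sup>2 \<partial>N)" by simp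
  qed
  also have "\<dots> = \<theta>\<^sup>2 / 2 * (\<Sum>I\<in>subsets. \<integral>z. H I (swap {} z) * (D I z)\<^sup>2 \<partial>N)"
    by (rule sum_distrib_left[symmetric])
  also have "\<dots> \<le> \<theta>\<^sup>2 / 2 * (4 * Q)"
    using second_order_le by (intro mult_left_mono) (auto simp: D_def W_def)
  finally show ?thesis by (simp add: g_def mult_ac)
qed

lemma norm_T_correlation:
  "norm ((\<integral>z. of_real (T z) * cis (\<theta> * (W z - m)) \<partial>N) - of_real v * \<phi> \<theta>) \<le> sqrt (8 * Q)"
proof -
  have cm [measurable]: "(\<lambda>z. cis (\<theta> * (W z - m))) \<in> borel_measurable N"
    unfolding cis_conv_exp by measurable
  have ci: "integrable N (\<lambda>z. cis (\<theta> * (W z - m)))"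
    by (rule integrable_bdd[where B=1]) auto
  have Ti: "integrable N T" by (rule integrable_bdd[where B="card pairs"]) (auto simp: abs_T_le)
  have Tc: "integrable N (\<lambda>z. of_real (T z) * cis (\<theta> * (W z - m)))"
    by (rule integrable_bdd[where B="card pairs"]) (auto simp: abs_T_le norm_mult)
  have T_bd: "\<bar>T z - v\<bar> \<le> card pairs + \<bar>v\<bar>" for z using abs_T_le[of z] by linarith
  have T2: "integrable N (\<lambda>z. (T z - v)\<^sup>2)"
  proof (rule integrable_bdd)
    show "norm ((T z - v)\<^sup>2) \<le> (card pairs + \<bar>v\<bar>)\<^sup>2" for z
      using power_mono[OF T_bd[of z], of 2] by simp
  qed simp
  have "(\<integral>z. of_real (T z) * cis (\<theta> * (W z - m)) \<partial>N) - of_real v * \<phi> \<theta>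
     = (\<integral>z. of_real (T z) * cis (\<theta> * (W z - m)) - of_real v * cis (\<theta> * (W z - m)) \<partial>N)"
    using Tc ci by (simp add: \<phi>_def)
  also have "\<dots> = (\<integral>z. of_real (T z - v) * cis (\<theta> * (W z - m)) \<partial>N)"
    by (simp add: left_diff_distrib)
  also have "norm \<dots> \<le> (\<integral>z. norm (complex_of_real (T z - v) * cis (\<theta> * (W z - m))) \<partial>N)"
    by (rule integral_norm_bound)
  also have "\<dots> = (\<integral>z. \<bar>T z - v\<bar> \<partial>N)" by (simp add: norm_mult del: of_real_diff)
  also have "\<dots> \<le> sqrt (\<integral>z. (T z - v)\<^sup>2 \<partial>N)"
    using T2 Ti by (intro integral_abs_le_sqrt) auto
  also have "\<dots> \<le> sqrt (8 * Q)" using variance_T_le by (simp add: expectation_T)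
  finally show ?thesis .
qed

lemma norm_\<phi>_ode:
  "norm ((\<integral>z. \<i> * of_real (W z - m) * cis (\<theta> * (W z - m)) \<partial>N) + of_real (\<theta> * v) * \<phi> \<theta>)
    \<le> \<bar>\<theta>\<bar> * sqrt (8 * Q) + 2 * \<theta>\<^sup>2 * Q"
proof -
  let ?A = "\<integral>z. of_real (W z - m) * cis (\<theta> * (W z - m)) \<partial>N"
  let ?B = "\<integral>z. of_real (T z) * cis (\<theta> * (W z - m)) \<partial>N"
  have "(\<integral>z. \<i> * of_real (W z - m) * cis (\<theta> * (W z - m)) \<partial>N) = \<i> * ?A"
    by (simp add: mult.assoc)
  moreover have "\<i> * A + x * v * P = \<i> * ((A - \<i> * x * B) + \<i> * x * (B - v * P))" for A B P x v :: complex
    using i_squared by algebra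
  ultimately have "(\<integral>z. \<i> * of_real (W z - m) * cis (\<theta> * (W z - m)) \<partial>N) + of_real (\<theta> * v) * \<phi> \<theta>
    = \<i> * ((?A - \<i> * of_real \<theta> * ?B) + \<i> * of_real \<theta> * (?B - of_real v * \<phi> \<theta>))"
    by (simp only: of_real_mult)
  then have "norm ((\<integral>z. \<i> * of_real (W z - m) * cis (\<theta> * (W z - m)) \<partial>N) + of_real (\<theta> * v) * \<phi> \<theta>)
    = norm (\<i> * ((?A - \<i> * of_real \<theta> * ?B) + \<i> * of_real \<theta> * (?B - of_real v * \<phi> \<theta>)))"
    by (rule arg_cong)
  also have "\<dots> = norm ((?A - \<i> * of_real \<theta> * ?B) + \<i> * of_real \<theta> * (?B - of_real v * \<phi> \<theta>))"
    unfolding norm_mult by simp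
  also have "\<dots> \<le> norm (?A - \<i> * of_real \<theta> * ?B) + norm (\<i> * of_real \<theta> * (?B - of_real v * \<phi> \<theta>))"
    by (rule norm_triangle_ineq)
  also have "\<dots> \<le> 2 * \<theta>\<^sup>2 * Q + \<bar>\<theta>\<bar> * sqrt (8 * Q)"
    using mult_left_mono[OF norm_T_correlation[of \<theta>] abs_ge_zero[of \<theta>]]
    by (intro add_mono stein_expansion) (simp add: norm_mult)
  finally show ?thesis by simp
qed

text \<open>
  Multiplying \<open>\<phi>\<close> by \<open>exp (v t\<^sup>2 / 2)\<close> turns the approximate equation \<open>\<phi>' = - t v \<phi>\<close> into a bound for
  a derivative, to which the mean value inequality applies between \<open>0\<close> and \<open>\<theta>\<close>. The bound involves the
  kernel through \<open>Q\<close> only.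
\<close>

theorem char_gaussian_bound:
  "norm (\<phi> \<theta> - exp (- v * \<theta>\<^sup>2 / 2)) \<le> \<theta>\<^sup>2 * sqrt (8 * Q) + 2 * \<bar>\<theta>\<bar> ^ 3 * Q"
proof -
  define E where "E t = exp (v * t\<^sup>2 / 2)" for t :: real
  define \<phi>' where "\<phi>' t = (\<integral>z. \<i> * of_real (W z - m) * cis (t * (W z - m)) \<partial>N)" for t
  define B where "B = \<bar>\<theta>\<bar> * sqrt (8 * Q) + 2 * \<theta>\<^sup>2 * Q"
  have v0: "0 \<le> v" unfolding v_def by simp
  have Ed: "(E has_vector_derivative (v * t * E t)) (at t within S)" for t S
    unfolding E_def[abs_def] has_real_derivative_iff_has_vector_derivative[symmetric]
    by (auto intro!: derivative_eq_intros simp: algebra_simps)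
  have "norm (E \<theta> *\<^sub>R \<phi> \<theta> - E 0 *\<^sub>R \<phi> 0) \<le> (B * E \<theta>) * norm (\<theta> - 0)"
  proof (rule differentiable_bound[where S="closed_segment 0 \<theta>"])
    fix t assume t: "t \<in> closed_segment 0 \<theta>"
    then have t\<theta>: "\<bar>t\<bar> \<le> \<bar>\<theta>\<bar>" by (auto simp: closed_segment_eq_real_ivl split: if_splits)
    have "((\<lambda>t. E t *\<^sub>R \<phi> t) has_vector_derivative (E t *\<^sub>R \<phi>' t + (v * t * E t) *\<^sub>R \<phi> t)) (at t within closed_segment 0 \<theta>)"
      by (rule has_vector_derivative_scaleR[OF _ \<phi>_derivative[folded \<phi>'_def]])
        (use Ed in \<open>simp add: has_real_derivative_iff_has_vector_derivative\<close>)
    then show "((\<lambda>t. E t *\<^sub>R \<phi> t) has_derivative (\<lambda>x. x *\<^sub>R (E t *\<^sub>R \<phi>' t + (v * t * E t) *\<^sub>R \<phi> t)))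
        (at t within closed_segment 0 \<theta>)"
      by (simp add: has_vector_derivative_def)
    have "norm (E t *\<^sub>R \<phi>' t + (v * t * E t) *\<^sub>R \<phi> t) = E t * norm (\<phi>' t + of_real (t * v) * \<phi> t)"
    proof -
      have "E t *\<^sub>R \<phi>' t + (v * t * E t) *\<^sub>R \<phi> t = E t *\<^sub>R (\<phi>' t + of_real (t * v) * \<phi> t)"
        by (simp add: scaleR_conv_of_real algebra_simps)
      then show ?thesis by (simp add: E_def)
    qed
    also have "\<dots> \<le> E \<theta> * (\<bar>t\<bar> * sqrt (8 * Q) + 2 * t\<^sup>2 * Q)"
    proof (rule mult_mono)
      show "E t \<le> E \<theta>"
        using power_mono[OF t\<theta>, of 2] v0 by (auto simp: E_def intro!: mult_left_mono)
      show "norm (\<phi>' t + of_real (t * v) * \<phi> t) \<le> \<bar>t\<bar> * sqrt (8 * Q) + 2 * t\<^sup>2 * Q"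
        unfolding \<phi>'_def by (rule norm_\<phi>_ode)
    qed (auto simp: E_def)
    also have "\<dots> \<le> E \<theta> * B"
      using power_mono[OF t\<theta>, of 2] t\<theta> Q_nonneg
      by (auto simp: E_def B_def intro!: add_mono mult_right_mono)
    finally show "onorm (\<lambda>x. x *\<^sub>R (E t *\<^sub>R \<phi>' t + (v * t * E t) *\<^sub>R \<phi> t)) \<le> B * E \<theta>"
      by (simp add: onorm_scaleR_left onorm_id mult.commute)
  qed auto
  moreover have "\<phi> 0 = 1" by (simp add: \<phi>_def N.prob_space)
  ultimately have *: "norm (E \<theta> *\<^sub>R \<phi> \<theta> - 1) \<le> B * E \<theta> * \<bar>\<theta>\<bar>" by (simp add: E_def)
  have inv: "exp (- v * \<theta>\<^sup>2 / 2) * E \<theta> = 1"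
    by (simp add: E_def flip: exp_add)
  have "\<phi> \<theta> - of_real (exp (- v * \<theta>\<^sup>2 / 2)) = exp (- v * \<theta>\<^sup>2 / 2) *\<^sub>R (E \<theta> *\<^sub>R \<phi> \<theta> - 1)"
    using inv by (simp add: scaleR_diff_right of_real_def)
  then have "norm (\<phi> \<theta> - of_real (exp (- v * \<theta>\<^sup>2 / 2))) \<le> exp (- v * \<theta>\<^sup>2 / 2) * (B * E \<theta> * \<bar>\<theta>\<bar>)"
    using * by (simp add: mult_left_mono)
  also have "\<dots> = (exp (- v * \<theta>\<^sup>2 / 2) * E \<theta>) * (B * \<bar>\<theta>\<bar>)" by (simp add: mult_ac)
  also have "\<dots> = (\<bar>\<theta>\<bar> * \<bar>\<theta>\<bar>) * sqrt (8 * Q) + 2 * (\<theta>\<^sup>2 * \<bar>\<theta>\<bar>) * Q"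
    unfolding inv B_def by algebra
  also have "\<theta>\<^sup>2 * \<bar>\<theta>\<bar> = \<bar>\<theta>\<bar> ^ 3"
    by (simp add: power3_eq_cube power2_eq_square)
  also have "\<bar>\<theta>\<bar> * \<bar>\<theta>\<bar> = \<theta>\<^sup>2" by (simp add: power2_eq_square)
  finally show ?thesis by simp
qed

section \<open>The number of linked quadruples\<close>

text \<open>
  A linked quadruple is determined by its union \<open>A\<close>, of size between \<open>\<kappa>\<close> and \<open>4 \<kappa>\<close>, and four subsets of
  \<open>A\<close>.
\<close>

lemma Q_le: "Q \<le> (\<Sum>k=\<kappa>..4 * \<kappa>. real (n choose k) * (16 ^ k * p ^ (k - 1)))"
proof -
  let ?X = "{A. A \<subseteq> {1..n} \<and> \<kappa> \<le> card A \<and> card A \<le> 4 * \<kappa>}"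
  let ?J = "\<lambda>x. join (fst x) (snd x)"
  have J: "?J ` linked \<subseteq> ?X"
  proof safe
    fix a b assume "(a, b) \<in> linked"
    then have s: "fst a \<in> subsets" "snd a \<in> subsets" "fst b \<in> subsets" "snd b \<in> subsets"
      by (auto simp: linked_def pairs_def)
    show "k \<in> {1..n}" if "k \<in> join (fst (a, b)) (snd (a, b))" for k
      using that s[THEN subsetsD(1)] by (auto simp: join_def)
    have "card (fst a) \<le> card (join a b)"
      unfolding join_def using s[THEN subsetsD(4)] by (intro card_mono) auto
    then show "\<kappa> \<le> card (join (fst (a, b)) (snd (a, b)))" using subsetsD(2)[OF s(1)] by simp
    have "card (join a b) \<le> card (fst a) + card (snd a) + card (fst b) + card (snd b)"
      unfolding join_def by (intro order_trans[OF card_Un_le] add_mono order_refl)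
    then show "card (join (fst (a, b)) (snd (a, b))) \<le> 4 * \<kappa>" using s[THEN subsetsD(2)] by simp
  qed
  have "Q = (\<Sum>x\<in>linked. p ^ (card (?J x) - 1))"
    unfolding Q_def case_prod_unfold ..
  also have "\<dots> = (\<Sum>A\<in>?X. \<Sum>x\<in>{x \<in> linked. ?J x = A}. p ^ (card (?J x) - 1))"
    by (rule sum.group[OF finite_linked _ J, symmetric]) simp
  also have "\<dots> \<le> (\<Sum>A\<in>?X. 16 ^ card A * p ^ (card A - 1))"
  proof (rule sum_mono)
    fix A assume A: "A \<in> ?X"
    then have fin: "finite A" by (auto intro: finite_subset)
    have "card {x \<in> linked. ?J x = A} \<le> card ((Pow A \<times> Pow A) \<times> (Pow A \<times> Pow A))"
      using fin by (intro card_mono) (auto simp: join_def)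
    also have "\<dots> = 16 ^ card A"
    proof -
      have "(2 ^ c * 2 ^ c) * (2 ^ c * 2 ^ c) = (16 :: nat) ^ c" for c
        by (simp only: power_mult_distrib[symmetric]) simp
      then show ?thesis using fin by (simp add: card_Pow card_cartesian_product)
    qed
    finally have "real (card {x \<in> linked. ?J x = A}) \<le> real (16 ^ card A)"
      by (rule of_nat_mono)
    then have "real (card {x \<in> linked. ?J x = A}) \<le> 16 ^ card A" by simp
    then show "(\<Sum>x\<in>{x \<in> linked. ?J x = A}. p ^ (card (?J x) - 1)) \<le> 16 ^ card A * p ^ (card A - 1)"
      using p_nonneg by (simp add: mult_right_mono)
  qed
  also have "\<dots> = (\<Sum>k=\<kappa>..4 * \<kappa>. \<Sum>A\<in>{A \<in> ?X. card A = k}. 16 ^ card A * p ^ (card A - 1))"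
    by (rule sum.group[symmetric]) auto
  also have "\<dots> = (\<Sum>k=\<kappa>..4 * \<kappa>. real (n choose k) * (16 ^ k * p ^ (k - 1)))"
  proof (rule sum.cong[OF refl])
    fix k assume k: "k \<in> {\<kappa>..4 * \<kappa>}"
    then have "{A \<in> ?X. card A = k} = {A. A \<subseteq> {1..n} \<and> card A = k}" by auto
    then show "(\<Sum>A\<in>{A \<in> ?X. card A = k}. 16 ^ card A * p ^ (card A - 1)) = real (n choose k) * (16 ^ k * p ^ (k - 1))"
      using n_subsets[of "{1..n}" k] by simp
  qed
  finally show ?thesis .
qed

lemma Q_le_power:
  assumes "real n * p \<le> B"
  shows "Q \<le> (\<Sum>k=\<kappa>..4 * \<kappa>. 16 ^ k * B ^ (k - \<kappa>)) * (real n * (real n * p) ^ (\<kappa> - 1))"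
proof -
  have "real (n choose k) * (16 ^ k * p ^ (k - 1)) \<le> 16 ^ k * B ^ (k - \<kappa>) * (real n * (real n * p) ^ (\<kappa> - 1))"
    if k: "\<kappa> \<le> k" for k
  proof -
    have e: "k - 1 = (\<kappa> - 1) + (k - \<kappa>)" using k \<kappa>_pos by auto
    have "real (n choose k) \<le> real n ^ k"
      using binomial_le_pow[of k n] by (cases "k \<le> n") (simp_all add: binomial_eq_0 flip: of_nat_power)
    then have le: "real (n choose k) * (16 ^ k * p ^ (k - 1)) \<le> real n ^ k * (16 ^ k * p ^ (k - 1))"
      using p_nonneg by (intro mult_right_mono) auto
    have "real n ^ k * p ^ (k - 1) = real n * (real n * p) ^ (k - 1)"
      using power_Suc[of "real n" "k - 1"] k \<kappa>_pos by (simp add: power_mult_distrib)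
    moreover have "(real n * p) ^ (k - 1) = (real n * p) ^ (\<kappa> - 1) * (real n * p) ^ (k - \<kappa>)"
      unfolding e by (rule power_add)
    ultimately have eq: "real n ^ k * (16 ^ k * p ^ (k - 1))
        = 16 ^ k * (real n * p) ^ (k - \<kappa>) * (real n * (real n * p) ^ (\<kappa> - 1))"
      by (simp add: mult_ac)
    have "16 ^ k * (real n * p) ^ (k - \<kappa>) * (real n * (real n * p) ^ (\<kappa> - 1))
       \<le> 16 ^ k * B ^ (k - \<kappa>) * (real n * (real n * p) ^ (\<kappa> - 1))"
      using assms p_nonneg by (intro mult_right_mono mult_left_mono power_mono) auto
    with le eq show ?thesis by linarith
  qed
  then have "(\<Sum>k=\<kappa>..4 * \<kappa>. real (n choose k) * (16 ^ k * p ^ (k - 1)))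
     \<le> (\<Sum>k=\<kappa>..4 * \<kappa>. 16 ^ k * B ^ (k - \<kappa>) * (real n * (real n * p) ^ (\<kappa> - 1)))"
    by (intro sum_mono) auto
  then show ?thesis using Q_le by (simp add: sum_distrib_right)
qed

end

section \<open>Points forming a prescribed graph\<close>

text \<open>
  The kernel is stated for indexed points. This keeps it meaningful, and measurable, when points
  coincide, and the finiteness of the function space over which \<open>g\<close> ranges makes measurability immediate.
\<close>

definition forms :: "'v pair_pre_digraph \<Rightarrow> real \<Rightarrow> nat set \<Rightarrow> (nat \<Rightarrow> 'a::real_normed_vector) \<Rightarrow> bool" where
  "forms \<Gamma> r I x \<longleftrightarrow> (\<exists>g\<in>I \<rightarrow>\<^sub>E pverts \<Gamma>. bij_betw g I (pverts \<Gamma>) \<and>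
     (\<forall>i\<in>I. \<forall>j\<in>I. i \<noteq> j \<longrightarrow> (norm (x j - x i) \<le> r \<longleftrightarrow> (g i, g j) \<in> parcs \<Gamma>)))"

lemma formsI:
  assumes "bij_betw g I (pverts \<Gamma>)"
    "\<And>i j. i \<in> I \<Longrightarrow> j \<in> I \<Longrightarrow> i \<noteq> j \<Longrightarrow> norm (x j - x i) \<le> r \<longleftrightarrow> (g i, g j) \<in> parcs \<Gamma>"
  shows "forms \<Gamma> r I x"
  unfolding forms_def
proof (rule bexI[of _ "restrict g I"])
  show "bij_betw (restrict g I) I (pverts \<Gamma>) \<and> (\<forall>i\<in>I. \<forall>j\<in>I. i \<noteq> j \<longrightarrow>
      (norm (x j - x i) \<le> r \<longleftrightarrow> (restrict g I i, restrict g I j) \<in> parcs \<Gamma>))"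
    using assms by (auto cong: bij_betw_cong)
  show "restrict g I \<in> I \<rightarrow>\<^sub>E pverts \<Gamma>" using bij_betwE[OF assms(1)] by auto
qed

lemma depends_on_forms: "depends_on (forms \<Gamma> r I) I"
  unfolding forms_def[abs_def] depends_on_def by simp

lemma forms_scale:
  fixes c :: "'a::real_normed_vector"
  assumes "l > 0"
  shows "forms \<Gamma> r I (\<lambda>i. c + l *\<^sub>R x i) \<longleftrightarrow> forms \<Gamma> (r / l) I x"
proof -
  have "norm ((c + l *\<^sub>R x j) - (c + l *\<^sub>R x i)) \<le> r \<longleftrightarrow> norm (x j - x i) \<le> r / l" for i j
    using assms by (simp add: pos_le_divide_eq mult.commute flip: scaleR_diff_right)
  then show ?thesis unfolding forms_def by simp
qed

lemma forms_relabel_imp: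
  assumes f: "bij_betw f I J" and "forms \<Gamma> r J x"
  shows "forms \<Gamma> r I (\<lambda>i. x (f i))"
proof -
  obtain g where g: "bij_betw g J (pverts \<Gamma>)"
    "\<And>i j. i \<in> J \<Longrightarrow> j \<in> J \<Longrightarrow> i \<noteq> j \<Longrightarrow> norm (x j - x i) \<le> r \<longleftrightarrow> (g i, g j) \<in> parcs \<Gamma>"
    using assms(2) unfolding forms_def by blast
  have inj: "f i \<noteq> f j" if "i \<in> I" "j \<in> I" "i \<noteq> j" for i j
    using f that by (auto simp: bij_betw_def inj_on_def)
  show ?thesis
  proof (rule formsI[where g="g \<circ> f"])
    show "bij_betw (g \<circ> f) I (pverts \<Gamma>)" by (rule bij_betw_trans[OF f g(1)])
    fix i j assume ij: "i \<in> I" "j \<in> I" "i \<noteq> j"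
    then have "f i \<in> J" "f j \<in> J" using bij_betwE[OF f] by auto
    from g(2)[OF this inj[OF ij]]
    show "norm (x (f j) - x (f i)) \<le> r \<longleftrightarrow> ((g \<circ> f) i, (g \<circ> f) j) \<in> parcs \<Gamma>" by simp
  qed
qed

lemma forms_relabel:
  assumes f: "bij_betw f I J"
  shows "forms \<Gamma> r I (\<lambda>i. x (f i)) \<longleftrightarrow> forms \<Gamma> r J x"
proof
  assume "forms \<Gamma> r I (\<lambda>i. x (f i))"
  from forms_relabel_imp[OF bij_betw_inv_into[OF f] this]
  have "forms \<Gamma> r J (\<lambda>j. x (f (inv_into I f j)))" .
  moreover have eq: "x (f (inv_into I f j)) = x j" if "j \<in> J" for j
    using f that by (simp add: bij_betw_inv_into_right)
  moreover have "forms \<Gamma> r J (\<lambda>j. x (f (inv_into I f j))) = forms \<Gamma> r J x"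
    by (rule depends_onD[OF depends_on_forms]) (rule eq)
  ultimately show "forms \<Gamma> r J x" by simp
qed (rule forms_relabel_imp[OF f])

lemma pred_forms:
  assumes "finite (pverts \<Gamma>)" "finite J" "I \<subseteq> J" and M: "sets M = sets borel"
  shows "Measurable.pred (PiM J (\<lambda>_. M :: 'a::{real_normed_vector, second_countable_topology} measure)) (forms \<Gamma> r I)"
proof -
  have fin: "finite I" using assms finite_subset by auto
  have [measurable]: "(\<lambda>x. x i) \<in> borel_measurable (PiM J (\<lambda>_. M))" if "i \<in> I" for i
    using measurable_component_singleton[of i J "\<lambda>_. M"] that assms
    by (auto cong: measurable_cong_sets)
  show ?thesis
    unfolding forms_def[abs_def]
  proof (intro pred_intros_finite pred_intros_logic)
    show "finite (I \<rightarrow>\<^sub>E pverts \<Gamma>)" using fin assms(1) by (intro finite_PiE) auto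
  qed (use fin in measurable)
qed

text \<open>
  Every set of sample points has exactly one index set consisting of first visits. This makes the count
  of point sets a sum over index sets for all samples, not only for those without coincidences, and so
  shows that the count is a measurable function.
\<close>

definition first_visits :: "(nat \<Rightarrow> 'a) \<Rightarrow> nat set \<Rightarrow> bool" where
  "first_visits x I \<longleftrightarrow> (\<forall>i\<in>I. \<forall>j\<in>{1..<i}. x j \<noteq> x i)"

context
  fixes \<Gamma> :: "'v pair_pre_digraph"
  assumes \<Gamma>: "pair_graph \<Gamma>" "Digraph_Component.connected (with_proj \<Gamma>)"
begin

interpretation pair_graph \<Gamma> by (rule \<Gamma>)

lemma connected_rtrancl:
  assumes "u \<in> pverts \<Gamma>" "v \<in> pverts \<Gamma>"
  shows "(u, v) \<in> (parcs \<Gamma>)\<^sup>*"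
proof -
  have "symmetric (with_proj \<Gamma>)" by (rule pair_sym_arcs)
  then have "parcs (mk_symmetric (with_proj \<Gamma>)) = parcs \<Gamma>"
    by (rule adj_mk_symmetric_eq)
  moreover have "(u, v) \<in> rtrancl_on (pverts \<Gamma>) (parcs (mk_symmetric (with_proj \<Gamma>)))"
    using \<Gamma>(2) assms unfolding connected_def strongly_connected_def reachable_def by auto
  ultimately show ?thesis by (simp add: rtrancl_on_rtranclI)
qed

text \<open>Points of a connected graph are joined by a path with at most as many edges as the graph has arcs.\<close>

lemma forms_norm_le:
  fixes x :: "nat \<Rightarrow> 'a::real_normed_vector" and r :: real
  assumes "forms \<Gamma> r I x" "i \<in> I" "j \<in> I" "0 \<le> r"
  shows "norm (x j - x i) \<le> real (card (parcs \<Gamma>)) * r"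
proof -
  obtain g where g: "bij_betw g I (pverts \<Gamma>)"
    and e: "\<And>i j. i \<in> I \<Longrightarrow> j \<in> I \<Longrightarrow> i \<noteq> j \<Longrightarrow> norm (x j - x i) \<le> r \<longleftrightarrow> (g i, g j) \<in> parcs \<Gamma>"
    using assms(1) unfolding forms_def by blast
  have path: "norm (x j - x i) \<le> k * r" if "(g i, g j) \<in> parcs \<Gamma> ^^ k" "i \<in> I" "j \<in> I" for k i j
    using that
  proof (induction k arbitrary: j)
    case 0
    then have "i = j" using g by (auto simp: bij_betw_def inj_on_def)
    then show ?case by simp
  next
    case (Suc k)
    then obtain w where w: "(g i, w) \<in> parcs \<Gamma> ^^ k" "(w, g j) \<in> parcs \<Gamma>" by auto
    then have "w \<in> pverts \<Gamma>" by (auto dest: in_arcsD1)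
    then obtain l where l: "l \<in> I" "w = g l" using g by (auto simp: bij_betw_def)
    have "l \<noteq> j" using w(2) l pair_no_loops by fastforce
    then have "norm (x j - x l) \<le> r" using e[OF l(1) Suc.prems(3)] w(2) l by auto
    moreover have "norm (x l - x i) \<le> k * r" using Suc.IH w(1) l Suc.prems by auto
    ultimately show ?case
      using norm_triangle_ineq[of "x j - x l" "x l - x i"] by (simp add: algebra_simps)
  qed
  have "(g i, g j) \<in> (parcs \<Gamma>)\<^sup>*"
    using g assms by (intro connected_rtrancl) (auto dest: bij_betwE)
  then obtain k where k: "k \<le> card (parcs \<Gamma>)" "(g i, g j) \<in> parcs \<Gamma> ^^ k"
    using pair_finite_arcs by (auto simp: rtrancl_finite_eq_relpow)
  have "norm (x j - x i) \<le> k * r" by (rule path[OF k(2) assms(2,3)])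
  also have "\<dots> \<le> real (card (parcs \<Gamma>)) * r" using k assms by (intro mult_right_mono) auto
  finally show ?thesis .
qed

lemma graph_iso_geometric:
  fixes x :: "nat \<Rightarrow> 'a::real_normed_vector"
  assumes inj: "inj_on x I"
  shows "graph_iso (geometric_graph (x ` I) r) \<Gamma> \<longleftrightarrow> forms \<Gamma> r I x"
proof -
  let ?G = "geometric_graph (x ` I) r"
  have wf: "pair_wf_digraph ?G" by unfold_locales (auto simp: geometric_graph_def)
  have arc: "(x i, x j) \<in> parcs ?G \<longleftrightarrow> i \<noteq> j \<and> norm (x j - x i) \<le> r" if "i \<in> I" "j \<in> I" for i j
    using that inj by (auto simp: geometric_graph_def inj_on_def)
  show ?thesis
    unfolding graph_iso_iff[OF wf]
  proof
    assume "\<exists>f. bij_betw f (pverts ?G) (pverts \<Gamma>) \<and> parcs \<Gamma> = map_prod f f ` parcs ?G"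
    then obtain f where f: "bij_betw f (x ` I) (pverts \<Gamma>)" "parcs \<Gamma> = map_prod f f ` parcs ?G"
      by (auto simp: geometric_graph_def)
    show "forms \<Gamma> r I x"
    proof (rule formsI[where g="f \<circ> x"])
      show "bij_betw (f \<circ> x) I (pverts \<Gamma>)"
        using bij_betw_trans[OF inj_on_imp_bij_betw[OF inj] f(1)] .
      fix i j assume ij: "i \<in> I" "j \<in> I" "i \<noteq> j"
      have "(f (x i), f (x j)) \<in> map_prod f f ` parcs ?G \<longleftrightarrow> (x i, x j) \<in> parcs ?G"
      proof
        assume "(f (x i), f (x j)) \<in> map_prod f f ` parcs ?G"
        then obtain a b where ab: "(a, b) \<in> parcs ?G" "f a = f (x i)" "f b = f (x j)" by auto
        moreover have "a \<in> x ` I" "b \<in> x ` I" using ab(1) by (auto simp: geometric_graph_def)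
        ultimately have "a = x i" "b = x j" using f(1) ij by (auto simp: bij_betw_def inj_on_def)
        then show "(x i, x j) \<in> parcs ?G" using ab by simp
      next
        assume "(x i, x j) \<in> parcs ?G"
        from imageI[OF this, of "map_prod f f"] show "(f (x i), f (x j)) \<in> map_prod f f ` parcs ?G" by simp
      qed
      then show "norm (x j - x i) \<le> r \<longleftrightarrow> ((f \<circ> x) i, (f \<circ> x) j) \<in> parcs \<Gamma>"
        using f(2) arc[OF ij(1,2)] ij by simp
    qed
  next
    assume "forms \<Gamma> r I x"
    then obtain g where g: "bij_betw g I (pverts \<Gamma>)"
      and e: "\<And>i j. i \<in> I \<Longrightarrow> j \<in> I \<Longrightarrow> i \<noteq> j \<Longrightarrow> norm (x j - x i) \<le> r \<longleftrightarrow> (g i, g j) \<in> parcs \<Gamma>"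
      unfolding forms_def by blast
    let ?f = "g \<circ> inv_into I x"
    have f: "?f (x i) = g i" if "i \<in> I" for i using inj that by simp
    have "bij_betw ?f (x ` I) (pverts \<Gamma>)"
      using bij_betw_trans[OF bij_betw_inv_into[OF inj_on_imp_bij_betw[OF inj]] g] .
    moreover have "parcs \<Gamma> = map_prod ?f ?f ` parcs ?G"
    proof (intro set_eqI iffI)
      fix a assume a: "a \<in> parcs \<Gamma>"
      obtain u w where uw: "a = (u, w)" by (cases a)
      have "u \<in> g ` I" "w \<in> g ` I" "u \<noteq> w"
        using a uw g pair_no_loops[OF a] by (auto simp: bij_betw_def dest: in_arcsD1 in_arcsD2)
      then obtain i j where ij: "i \<in> I" "j \<in> I" "u = g i" "w = g j" "i \<noteq> j" by auto
      then have "(x i, x j) \<in> parcs ?G" using a uw e[OF ij(1,2,5)] arc[OF ij(1,2)] by auto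
      then show "a \<in> map_prod ?f ?f ` parcs ?G"
        using f ij uw by (intro image_eqI[of _ _ "(x i, x j)"]) auto
    next
      fix a assume "a \<in> map_prod ?f ?f ` parcs ?G"
      then obtain y z where yz: "(y, z) \<in> parcs ?G" "a = (?f y, ?f z)" by auto
      then obtain i j where ij: "i \<in> I" "j \<in> I" "y = x i" "z = x j" by (auto simp: geometric_graph_def)
      then have "i \<noteq> j" "norm (x j - x i) \<le> r" using yz arc by auto
      then show "a \<in> parcs \<Gamma>" using e ij yz f by auto
    qed
    ultimately show "\<exists>f. bij_betw f (pverts ?G) (pverts \<Gamma>) \<and> parcs \<Gamma> = map_prod f f ` parcs ?G"
      by (auto simp: geometric_graph_def)
  qed
qed

lemma induced_count_eq_card:
  fixes x :: "nat \<Rightarrow> 'a::real_normed_vector"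
  shows "induced_count \<Gamma> (x ` {1..n}) r
    = card {I. I \<subseteq> {1..n} \<and> card I = card (pverts \<Gamma>) \<and> first_visits x I \<and> forms \<Gamma> r I x}"
  unfolding induced_count_def
proof (rule bij_betw_same_card[symmetric])
  let ?\<I> = "{I. I \<subseteq> {1..n} \<and> card I = card (pverts \<Gamma>) \<and> first_visits x I \<and> forms \<Gamma> r I x}"
  have first_inj: "i = j" if "first_visits x I" "first_visits x J" "i \<in> I" "j \<in> J" "x i = x j"
    "I \<subseteq> {1..n}" "J \<subseteq> {1..n}" for I J i j
  proof (rule ccontr)
    assume "i \<noteq> j"
    then consider "i < j" | "j < i" by linarith
    then show False
    proof cases
      case 1
      then have "i \<in> {1..<j}" using that(3,6) by auto
      then show False using that(2,4,5) unfolding first_visits_def by blast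
    next
      case 2
      then have "j \<in> {1..<i}" using that(4,7) by auto
      then show False using that(1,3,5) unfolding first_visits_def by fastforce
    qed
  qed
  have inj: "inj_on x I" if "first_visits x I" "I \<subseteq> {1..n}" for I
    using first_inj[OF that(1,1)] that(2) by (auto simp: inj_on_def)
  show "bij_betw (\<lambda>I. x ` I) ?\<I>
    {Y. Y \<subseteq> x ` {1..n} \<and> card Y = card (pverts \<Gamma>) \<and> graph_iso (geometric_graph Y r) \<Gamma>}"
    unfolding bij_betw_def
  proof
    show "inj_on (\<lambda>I. x ` I) ?\<I>"
    proof (rule inj_onI)
      have sub: "I \<subseteq> J" if "I \<in> ?\<I>" "J \<in> ?\<I>" "x ` I = x ` J" for I J
      proof
        fix i assume i: "i \<in> I"
        have "x i \<in> x ` J" using i unfolding that(3)[symmetric] by (rule imageI)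
        then obtain j where j: "x i = x j" "j \<in> J" by (rule imageE)
        have "i = j"
          by (rule first_inj[OF _ _ i j(2,1)]) (use that(1,2) in blast)+
        then show "i \<in> J" using j by simp
      qed
      fix I J assume "I \<in> ?\<I>" "J \<in> ?\<I>" "x ` I = x ` J"
      then show "I = J" using sub[of I J] sub[of J I] by (intro equalityI) simp_all
    qed
    show "(\<lambda>I. x ` I) ` ?\<I> = {Y. Y \<subseteq> x ` {1..n} \<and> card Y = card (pverts \<Gamma>) \<and> graph_iso (geometric_graph Y r) \<Gamma>}"
    proof (intro set_eqI iffI)
      fix Y assume "Y \<in> (\<lambda>I. x ` I) ` ?\<I>"
      then obtain I where I: "I \<in> ?\<I>" and Y: "Y = x ` I" by blast
      then have "inj_on x I" by (intro inj) auto
      from graph_iso_geometric[OF this, of r] card_image[OF this]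
      show "Y \<in> {Y. Y \<subseteq> x ` {1..n} \<and> card Y = card (pverts \<Gamma>) \<and> graph_iso (geometric_graph Y r) \<Gamma>}"
        using I unfolding Y by (simp add: image_mono)
    next
      fix Y assume Y: "Y \<in> {Y. Y \<subseteq> x ` {1..n} \<and> card Y = card (pverts \<Gamma>) \<and> graph_iso (geometric_graph Y r) \<Gamma>}"
      define I where "I = {i \<in> {1..n}. x i \<in> Y \<and> (\<forall>j\<in>{1..<i}. x j \<noteq> x i)}"
      have I: "I \<subseteq> {1..n}" "first_visits x I" by (auto simp: I_def first_visits_def)
      have "Y = x ` I"
      proof (intro set_eqI iffI)
        fix y assume "y \<in> Y"
        then obtain i where i: "i \<in> {1..n}" "x i = y" using Y by auto
        define k where "k = (LEAST k. k \<in> {1..n} \<and> x k = y)"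
        have k: "k \<in> {1..n} \<and> x k = y" unfolding k_def by (rule LeastI[of _ i]) (use i in auto)
        have "x j \<noteq> x k" if j: "j \<in> {1..<k}" for j
        proof
          assume "x j = x k"
          then have "k \<le> j" using j k unfolding k_def[symmetric]
            by (subst k_def) (intro Least_le, auto)
          then show False using j by auto
        qed
        then show "y \<in> x ` I" using k \<open>y \<in> Y\<close> by (auto simp: I_def image_iff)
      qed (auto simp: I_def)
      moreover have "I \<in> ?\<I>"
        using Y I card_image[OF inj[OF I(2,1)]] graph_iso_geometric[OF inj[OF I(2,1)], of r]
        unfolding \<open>Y = x ` I\<close> by simp
      ultimately show "Y \<in> (\<lambda>I. x ` I) ` ?\<I>" by blast
    qed
  qed
qed

lemma graph_iso_geometric_card:
  fixes x :: "nat \<Rightarrow> 'a::real_normed_vector"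
  assumes "finite I" "card I = card (pverts \<Gamma>)"
  shows "graph_iso (geometric_graph (x ` I) r) \<Gamma> \<longleftrightarrow> inj_on x I \<and> forms \<Gamma> r I x"
proof
  assume G: "graph_iso (geometric_graph (x ` I) r) \<Gamma>"
  have wf: "pair_wf_digraph (geometric_graph (x ` I) r)" by unfold_locales (auto simp: geometric_graph_def)
  obtain f where "bij_betw f (x ` I) (pverts \<Gamma>)"
    using G unfolding graph_iso_iff[OF wf] by (auto simp: geometric_graph_def)
  then have "card (x ` I) = card I" using assms by (simp add: bij_betw_same_card)
  then have "inj_on x I" using assms by (intro eq_card_imp_inj_on)
  then show "inj_on x I \<and> forms \<Gamma> r I x" using G graph_iso_geometric by auto
qed (use graph_iso_geometric in auto)

end

section \<open>The uniform distribution on the unit cube\<close>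

definition cube :: "(real ^ 'd) measure" where
  "cube = uniform_measure lborel (cbox 0 1)"

lemma inner_one_Basis: "b \<in> Basis \<Longrightarrow> (1 :: real ^ 'd) \<bullet> b = 1"
  by (auto simp: Basis_vec_def inner_axis)

lemma emeasure_lborel_cube:
  assumes "0 \<le> l"
  shows "emeasure lborel (cbox c (c + l *\<^sub>R (1 :: real ^ 'd))) = ennreal (l ^ CARD('d))"
    "emeasure lborel (box c (c + l *\<^sub>R (1 :: real ^ 'd))) = ennreal (l ^ CARD('d))"
  using assms
  by (subst emeasure_lborel_cbox emeasure_lborel_box; simp add: inner_simps inner_one_Basis)+

lemma emeasure_lborel_unit_cube: "emeasure lborel (cbox 0 (1 :: real ^ 'd)) = 1"
  using emeasure_lborel_cube(1)[of 1 "0 :: real ^ 'd"] by simp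

lemma prob_space_cube: "prob_space (cube :: (real ^ 'd) measure)"
  unfolding cube_def by (rule prob_space_uniform_measure) (simp_all add: emeasure_lborel_unit_cube)

lemma emeasure_cube_UNIV: "emeasure (cube :: (real ^ 'd) measure) UNIV = 1"
  using prob_space.emeasure_space_1[OF prob_space_cube] by (simp add: cube_def)

lemma sets_cube [simp, measurable_cong]: "sets cube = sets borel"
  and space_cube [simp]: "space cube = UNIV"
  by (simp_all add: cube_def)

lemma emeasure_cube: "A \<in> sets borel \<Longrightarrow> emeasure cube A = emeasure lborel (cbox 0 1 \<inter> A)"
  by (simp add: cube_def emeasure_lborel_unit_cube divide_ennreal_def)

lemma emeasure_cube_le: "A \<in> sets borel \<Longrightarrow> emeasure cube A \<le> emeasure lborel A"
  by (simp add: emeasure_cube emeasure_mono)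

lemma measurable_cube_pair:
  "f \<in> borel \<Otimes>\<^sub>M borel \<rightarrow>\<^sub>M N \<Longrightarrow> f \<in> cube \<Otimes>\<^sub>M cube \<rightarrow>\<^sub>M N"
  using measurable_cong_sets[OF sets_pair_measure_cong[OF sets_cube sets_cube] refl, of N] by blast

lemma emeasure_cube_ball:
  fixes x :: "real ^ 'd"
  assumes "0 \<le> R"
  shows "emeasure cube {y. norm (y - x) \<le> R} \<le> ennreal ((2 * R) ^ CARD('d))"
proof -
  have "{y. norm (y - x) \<le> R} = cball x R" by (auto simp: dist_norm norm_minus_commute)
  then have "emeasure cube {y. norm (y - x) \<le> R} \<le> emeasure lborel {y. norm (y - x) \<le> R}"
    by (intro emeasure_cube_le) simp
  also have "\<dots> \<le> emeasure lborel (cbox (x - R *\<^sub>R 1) ((x - R *\<^sub>R 1) + (2 * R) *\<^sub>R 1))"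
  proof (rule emeasure_mono)
    show "{y. norm (y - x) \<le> R} \<subseteq> cbox (x - R *\<^sub>R 1) ((x - R *\<^sub>R 1) + (2 * R) *\<^sub>R 1)"
    proof
      fix y assume "y \<in> {y. norm (y - x) \<le> R}"
      then have "\<bar>y $ i - x $ i\<bar> \<le> R" for i
        using component_le_norm_cart[of "y - x" i] by simp
      then have "x $ i - R \<le> y $ i \<and> y $ i \<le> R + x $ i" for i by (smt (verit))
      then show "y \<in> cbox (x - R *\<^sub>R 1) ((x - R *\<^sub>R 1) + (2 * R) *\<^sub>R 1)"
        by (auto simp: mem_box_cart)
    qed
  qed simp
  also have "\<dots> = ennreal ((2 * R) ^ CARD('d))"
    using assms by (intro emeasure_lborel_cube) auto
  finally show ?thesis .
qed

lemma affine_mem_cbox: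
  fixes v c :: "real ^ 'd"
  assumes "0 < l"
  shows "c + l *\<^sub>R v \<in> cbox c (c + l *\<^sub>R 1) \<longleftrightarrow> v \<in> cbox 0 1"
  using assms by (simp add: mem_box_cart zero_le_mult_iff)

lemma emeasure_cube_subcube:
  fixes c :: "real ^ 'd"
  assumes l: "0 < l" and sub: "cbox c (c + l *\<^sub>R 1) \<subseteq> cbox 0 1" and A: "A \<in> sets borel"
  shows "emeasure cube (A \<inter> cbox c (c + l *\<^sub>R 1)) = ennreal (l ^ CARD('d)) * emeasure cube {v. c + l *\<^sub>R v \<in> A}"
proof -
  let ?C = "cbox c (c + l *\<^sub>R 1)" and ?g = "\<lambda>v. c + l *\<^sub>R v"
  have AC: "A \<inter> ?C \<in> sets borel" using A by auto
  have "emeasure cube (A \<inter> ?C) = emeasure lborel (A \<inter> ?C)"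
    using sub AC by (subst emeasure_cube) (auto intro!: arg_cong[where f="emeasure lborel"])
  also have "\<dots> = emeasure (density (distr lborel borel ?g) (\<lambda>_. ennreal (\<bar>l\<bar> ^ DIM(real ^ 'd)))) (A \<inter> ?C)"
    using lborel_affine[of l c] l by simp
  also have "\<dots> = ennreal (l ^ CARD('d)) * emeasure (distr lborel borel ?g) (A \<inter> ?C)"
    using AC l by (subst emeasure_density_const) auto
  also have "emeasure (distr lborel borel ?g) (A \<inter> ?C) = emeasure lborel (?g -` (A \<inter> ?C))"
    using AC by (subst emeasure_distr) auto
  also have "?g -` (A \<inter> ?C) = cbox 0 1 \<inter> {v. ?g v \<in> A}"
    using affine_mem_cbox[OF l, of c] by auto
  also have "emeasure lborel \<dots> = emeasure cube {v. ?g v \<in> A}"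
  proof -
    have "?g -` A \<inter> space borel \<in> sets borel" by (rule measurable_sets[OF _ A]) measurable
    then show ?thesis by (subst emeasure_cube) (auto simp: vimage_def)
  qed
  finally show ?thesis .
qed

section \<open>Refreshing the positions inside disjoint subcubes\<close>

text \<open>
  A point of one of the subcubes is replaced by the point at relative position \<open>v\<close> in the same subcube. For
  uniform \<open>v\<close> this is a resampling of the position given the subcube, so it preserves the uniform
  distribution.
\<close>

definition refresh :: "'b set \<Rightarrow> ('b \<Rightarrow> real ^ 'd) \<Rightarrow> real \<Rightarrow> real ^ 'd \<Rightarrow> real ^ 'd \<Rightarrow> real ^ 'd" where
  "refresh B c l x v = (if \<exists>b\<in>B. x \<in> cbox (c b) (c b + l *\<^sub>R 1)
     then c (THE b. b \<in> B \<and> x \<in> cbox (c b) (c b + l *\<^sub>R 1)) + l *\<^sub>R v else x)"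

locale subcubes =
  fixes B :: "'b set" and c :: "'b \<Rightarrow> real ^ 'd" and l :: real
  assumes finite_B: "finite B" and l_pos: "0 < l"
    and sub_cube: "b \<in> B \<Longrightarrow> cbox (c b) (c b + l *\<^sub>R 1) \<subseteq> cbox 0 1"
    and disj: "disjoint_family_on (\<lambda>b. cbox (c b) (c b + l *\<^sub>R 1)) B"
begin

abbreviation "subcube b \<equiv> cbox (c b) (c b + l *\<^sub>R 1)"
abbreviation "R \<equiv> refresh B c l"

lemma refresh_in: "b \<in> B \<Longrightarrow> x \<in> subcube b \<Longrightarrow> R x v = c b + l *\<^sub>R v"
proof -
  assume b: "b \<in> B" "x \<in> subcube b"
  have "(THE b. b \<in> B \<and> x \<in> subcube b) = b"
    using b disj by (intro the_equality) (auto simp: disjoint_family_on_def)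
  then show ?thesis using b unfolding refresh_def by auto
qed

lemma refresh_out: "(\<And>b. b \<in> B \<Longrightarrow> x \<notin> subcube b) \<Longrightarrow> R x v = x"
  unfolding refresh_def by auto

text \<open>A form from which measurability can be read off.\<close>

lemma refresh_eq_sum:
  "R x v = (1 - (\<Sum>b\<in>B. indicator (subcube b) x)) *\<^sub>R x + (\<Sum>b\<in>B. indicator (subcube b) x *\<^sub>R (c b + l *\<^sub>R v))"
proof (cases "\<exists>b\<in>B. x \<in> subcube b")
  case True
  then obtain b where b: "b \<in> B" "x \<in> subcube b" by blast
  have ind: "indicator (subcube b') x = (if b' = b then 1 else (0 :: real))" if "b' \<in> B" for b'
    using that b disj by (auto simp: disjoint_family_on_def indicator_def)
  have "(\<Sum>b'\<in>B. indicator (subcube b') x) = (\<Sum>b'\<in>B. if b' = b then 1 else (0::real))"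
    by (intro sum.cong refl ind)
  moreover have "(\<Sum>b'\<in>B. indicator (subcube b') x *\<^sub>R (c b' + l *\<^sub>R v)) = (\<Sum>b'\<in>B. if b' = b then c b + l *\<^sub>R v else 0)"
    by (intro sum.cong refl) (simp add: ind)
  ultimately show ?thesis using b finite_B by (simp add: refresh_in)
next
  case False
  then show ?thesis by (subst refresh_out) (auto simp: indicator_def)
qed

lemma measurable_refresh [measurable]: "(\<lambda>(x, v). R x v) \<in> borel \<Otimes>\<^sub>M borel \<rightarrow>\<^sub>M borel"
  unfolding refresh_eq_sum case_prod_unfold by measurable

lemma emeasure_subcube: "b \<in> B \<Longrightarrow> emeasure cube (subcube b) = ennreal (l ^ CARD('d))"
  using emeasure_cube_subcube[OF l_pos sub_cube, of b UNIV] by (simp add: emeasure_cube_UNIV)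

lemma emeasure_refresh_section:
  assumes A: "A \<in> sets borel"
  shows "emeasure cube {v. R x v \<in> A} = indicator (A - (\<Union>b\<in>B. subcube b)) x
    + (\<Sum>b\<in>B. indicator (subcube b) x * emeasure cube {v. c b + l *\<^sub>R v \<in> A})"
proof (cases "\<exists>b\<in>B. x \<in> subcube b")
  case True
  then obtain b where b: "b \<in> B" "x \<in> subcube b" by blast
  have "(\<Sum>b'\<in>B. indicator (subcube b') x * emeasure cube {v. c b' + l *\<^sub>R v \<in> A})
    = (\<Sum>b'\<in>B. if b' = b then emeasure cube {v. c b + l *\<^sub>R v \<in> A} else 0)"
    using b disj by (intro sum.cong refl) (auto simp: disjoint_family_on_def indicator_def)
  moreover have "indicator (A - (\<Union>b\<in>B. subcube b)) x = (0 :: ennreal)" using b by (auto simp: indicator_def)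
  ultimately show ?thesis using b finite_B by (simp add: refresh_in)
next
  case False
  then have "R x v = x" for v by (intro refresh_out) auto
  moreover have "(\<Sum>b\<in>B. indicator (subcube b) x * emeasure cube {v. c b + l *\<^sub>R v \<in> A}) = 0"
    using False by (intro sum.neutral) (auto simp: indicator_def)
  ultimately show ?thesis
    using False by (cases "x \<in> A") (auto simp: emeasure_cube_UNIV)
qed

lemma distr_refresh: "distr (cube \<Otimes>\<^sub>M cube) borel (\<lambda>(x, v). R x v) = cube"
proof (rule measure_eqI)
  interpret P: prob_space "cube :: (real ^ 'd) measure" by (rule prob_space_cube)
  fix A assume "A \<in> sets (distr (cube \<Otimes>\<^sub>M cube) borel (\<lambda>(x, v). R x v))"
  then have A: "A \<in> sets borel" by simp
  have subcube_sets: "subcube b \<in> sets borel" for b by simp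
  note m = measurable_cube_pair[OF measurable_refresh]
  let ?w = "\<lambda>b. emeasure cube {v. c b + l *\<^sub>R v \<in> A}" and ?D = "A - (\<Union>b\<in>B. subcube b)"
  have "(\<Union>b\<in>B. subcube b) \<in> sets borel" using finite_B by (intro sets.finite_UN) auto
  then have D: "?D \<in> sets cube" using A by (simp add: sets.Diff)
  have m1: "indicator ?D \<in> borel_measurable (cube :: (real ^ 'd) measure)" using D by (rule borel_measurable_indicator)
  have m2: "(\<lambda>x. \<Sum>b\<in>B. indicator (subcube b) x * ?w b) \<in> borel_measurable (cube :: (real ^ 'd) measure)"
    by (intro borel_measurable_sum borel_measurable_times_ennreal borel_measurable_indicator) auto
  have single: "(\<integral>\<^sup>+x. indicator (subcube b) x * ?w b \<partial>cube) = emeasure cube (A \<inter> subcube b)" if b: "b \<in> B" for b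
  proof -
    have "(\<integral>\<^sup>+x. indicator (subcube b) x * ?w b \<partial>cube) = emeasure cube (subcube b) * ?w b"
      by (subst nn_integral_multc) auto
    then show ?thesis
      using emeasure_cube_subcube[OF l_pos sub_cube[OF b] A] emeasure_subcube[OF b] by simp
  qed
  have "(\<integral>\<^sup>+x. (\<Sum>b\<in>B. indicator (subcube b) x * ?w b) \<partial>cube) = (\<Sum>b\<in>B. \<integral>\<^sup>+x. indicator (subcube b) x * ?w b \<partial>cube)"
    by (intro nn_integral_sum) auto
  also have "\<dots> = (\<Sum>b\<in>B. emeasure cube (A \<inter> subcube b))"
    by (intro sum.cong refl single)
  also have "\<dots> = emeasure cube (\<Union>b\<in>B. A \<inter> subcube b)"
    using disj A finite_B by (intro sum_emeasure) (auto simp: disjoint_family_on_def)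
  finally have union_eq: "(\<integral>\<^sup>+x. (\<Sum>b\<in>B. indicator (subcube b) x * ?w b) \<partial>cube) = emeasure cube (\<Union>b\<in>B. A \<inter> subcube b)" .
  have "emeasure (distr (cube \<Otimes>\<^sub>M cube) borel (\<lambda>(x, v). R x v)) A
    = emeasure (cube \<Otimes>\<^sub>M cube) ((\<lambda>(x, v). R x v) -` A \<inter> space (cube \<Otimes>\<^sub>M cube))"
    using m A by (rule emeasure_distr)
  also have "\<dots> = (\<integral>\<^sup>+x. emeasure cube (Pair x -` ((\<lambda>(x, v). R x v) -` A \<inter> space (cube \<Otimes>\<^sub>M cube))) \<partial>cube)"
    using m A by (intro P.emeasure_pair_measure_alt measurable_sets)
  also have "\<dots> = (\<integral>\<^sup>+x. emeasure cube {v. R x v \<in> A} \<partial>cube)"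
    by (simp add: space_pair_measure vimage_def)
  also have "\<dots> = (\<integral>\<^sup>+x. indicator ?D x + (\<Sum>b\<in>B. indicator (subcube b) x * ?w b) \<partial>cube)"
    by (rule nn_integral_cong) (rule emeasure_refresh_section[OF A])
  also have "\<dots> = (\<integral>\<^sup>+x. indicator ?D x \<partial>cube) + (\<integral>\<^sup>+x. (\<Sum>b\<in>B. indicator (subcube b) x * ?w b) \<partial>cube)"
    by (rule nn_integral_add[OF m1 m2])
  also have "\<dots> = emeasure cube ?D + emeasure cube (\<Union>b\<in>B. A \<inter> subcube b)"
    unfolding union_eq using D by (intro arg_cong2[where f="(+)"] nn_integral_indicator) auto
  also have "\<dots> = emeasure cube (?D \<union> (\<Union>b\<in>B. A \<inter> subcube b))"
    using A D finite_B by (intro plus_emeasure sets.finite_UN) auto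
  also have "?D \<union> (\<Union>b\<in>B. A \<inter> subcube b) = A" by auto
  finally show "emeasure (distr (cube \<Otimes>\<^sub>M cube) borel (\<lambda>(x, v). R x v)) A = emeasure cube A" .
qed simp

lemma refresh_cube:
  "(\<lambda>(x, v). R x v) \<in> cube \<Otimes>\<^sub>M cube \<rightarrow>\<^sub>M cube" "distr (cube \<Otimes>\<^sub>M cube) cube (\<lambda>(x, v). R x v) = cube"
  using measurable_cube_pair[OF measurable_refresh] measurable_cong_sets[OF refl sets_cube]
  by (blast, intro trans[OF distr_cong[OF refl sets_cube refl] distr_refresh])

end

section \<open>Integrating over refreshed samples\<close>

context
  fixes \<mu> :: "'a measure"
  assumes prob_\<mu>: "prob_space \<mu>"
begin

interpretation prob_space \<mu> by (rule prob_\<mu>)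

lemma distr_two_blocks:
  fixes M1 M2 :: "'c measure"
  assumes AB: "A \<inter> B = {}" "A \<subseteq> V" "B \<subseteq> V"
    and g: "g1 \<in> PiM A (\<lambda>_. \<mu>) \<rightarrow>\<^sub>M M1" "g2 \<in> PiM B (\<lambda>_. \<mu>) \<rightarrow>\<^sub>M M2"
  shows "distr (PiM V (\<lambda>_. \<mu>)) (M1 \<Otimes>\<^sub>M M2) (\<lambda>z. (g1 (restrict z A), g2 (restrict z B)))
    = distr (PiM V (\<lambda>_. \<mu>)) M1 (\<lambda>z. g1 (restrict z A)) \<Otimes>\<^sub>M distr (PiM V (\<lambda>_. \<mu>)) M2 (\<lambda>z. g2 (restrict z B))"
proof -
  interpret N: prob_space "PiM V (\<lambda>_. \<mu>)" by (rule prob_space_PiM_iid[OF prob_\<mu>])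
  have "N.indep_var (PiM A (\<lambda>_. \<mu>)) (\<lambda>z. restrict z A) (PiM B (\<lambda>_. \<mu>)) (\<lambda>z. restrict z B)"
    by (rule N.indep_var_restrict[OF indep_vars_coordinates[OF prob_\<mu>] AB])
  then have "N.indep_var M1 (g1 \<circ> (\<lambda>z. restrict z A)) M2 (g2 \<circ> (\<lambda>z. restrict z B))"
    by (rule N.indep_var_compose) (rule g)+
  then show ?thesis
    unfolding N.indep_var_distribution_eq by (simp add: o_def)
qed

lemma distr_coordinate_pair:
  assumes "a \<in> V" "b \<in> V" "a \<noteq> b"
  shows "distr (PiM V (\<lambda>_. \<mu>)) (\<mu> \<Otimes>\<^sub>M \<mu>) (\<lambda>z. (z a, z b)) = \<mu> \<Otimes>\<^sub>M \<mu>"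
proof -
  have "distr (PiM V (\<lambda>_. \<mu>)) (\<mu> \<Otimes>\<^sub>M \<mu>) (\<lambda>z. ((\<lambda>y. y a) (restrict z {a}), (\<lambda>y. y b) (restrict z {b})))
    = distr (PiM V (\<lambda>_. \<mu>)) \<mu> (\<lambda>z. (\<lambda>y. y a) (restrict z {a})) \<Otimes>\<^sub>M distr (PiM V (\<lambda>_. \<mu>)) \<mu> (\<lambda>z. (\<lambda>y. y b) (restrict z {b}))"
    by (rule distr_two_blocks) (use assms in auto)
  then show ?thesis
    using distr_PiM_component[where I=V and i=a and M="\<lambda>_. \<mu>", OF prob_\<mu>]
      distr_PiM_component[where I=V and i=b and M="\<lambda>_. \<mu>", OF prob_\<mu>] assms by simp
qed

lemma distr_two_copies:
  "distr (PiM (I \<times> (UNIV :: bool set)) (\<lambda>_. \<mu>)) (PiM I (\<lambda>_. \<mu>) \<Otimes>\<^sub>M PiM I (\<lambda>_. \<mu>))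
     (\<lambda>z. (\<lambda>i\<in>I. z (i, False), \<lambda>i\<in>I. z (i, True))) = PiM I (\<lambda>_. \<mu>) \<Otimes>\<^sub>M PiM I (\<lambda>_. \<mu>)"
proof -
  let ?N = "PiM (I \<times> (UNIV :: bool set)) (\<lambda>_. \<mu>)"
  let ?g = "\<lambda>t y. \<lambda>i\<in>I. y (i, t)"
  have g: "?g t \<in> PiM (I \<times> {t}) (\<lambda>_. \<mu>) \<rightarrow>\<^sub>M PiM I (\<lambda>_. \<mu>)" for t :: bool
    by (rule measurable_restrict) auto
  have r: "?g t (restrict z (I \<times> {t})) = ?g t z" for t :: bool and z :: "'b \<times> bool \<Rightarrow> 'a" by auto
  have d: "distr ?N (PiM I (\<lambda>_. \<mu>)) (?g t) = PiM I (\<lambda>_. \<mu>)" for t :: bool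
    using distr_PiM_reindex[of "I \<times> UNIV" "\<lambda>_. \<mu>" "\<lambda>i. (i, t)" I] prob_\<mu> by (auto simp: inj_on_def)
  have "distr ?N (PiM I (\<lambda>_. \<mu>) \<Otimes>\<^sub>M PiM I (\<lambda>_. \<mu>)) (\<lambda>z. (?g False (restrict z (I \<times> {False})), ?g True (restrict z (I \<times> {True}))))
    = distr ?N (PiM I (\<lambda>_. \<mu>)) (\<lambda>z. ?g False (restrict z (I \<times> {False}))) \<Otimes>\<^sub>M distr ?N (PiM I (\<lambda>_. \<mu>)) (\<lambda>z. ?g True (restrict z (I \<times> {True})))"
    by (rule distr_two_blocks[OF _ _ _ g g]) auto
  then show ?thesis unfolding r d .
qed

text \<open>
  If \<open>\<rho>\<close> preserves \<open>\<mu>\<close>, applying it to every point of a sample preserves the law of the sample. Fubini's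
  theorem then allows to average over the fresh randomness \<open>v\<close> first, with the sample \<open>x\<close> fixed.
\<close>

lemma integral_refresh:
  fixes F :: "('i \<Rightarrow> 'a) \<Rightarrow> 'b::{banach, second_countable_topology}"
  assumes \<rho>: "(\<lambda>(x, v). \<rho> x v) \<in> \<mu> \<Otimes>\<^sub>M \<mu> \<rightarrow>\<^sub>M \<mu>" "distr (\<mu> \<Otimes>\<^sub>M \<mu>) \<mu> (\<lambda>(x, v). \<rho> x v) = \<mu>"
    and F: "F \<in> borel_measurable (PiM I (\<lambda>_. \<mu>))" "depends_on F I" "\<And>x. norm (F x) \<le> C"
    and I: "I \<noteq> {}"
  shows "(\<integral>x. (\<integral>v. F (\<lambda>i. \<rho> (x i) (v i)) \<partial>PiM I (\<lambda>_. \<mu>)) \<partial>PiM I (\<lambda>_. \<mu>)) = (\<integral>x. F x \<partial>PiM I (\<lambda>_. \<mu>))"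
    and "integrable (PiM I (\<lambda>_. \<mu>)) (\<lambda>x. \<integral>v. F (\<lambda>i. \<rho> (x i) (v i)) \<partial>PiM I (\<lambda>_. \<mu>))"
proof -
  let ?N = "PiM (I \<times> (UNIV :: bool set)) (\<lambda>_. \<mu>)" and ?P = "PiM I (\<lambda>_. \<mu>)"
  interpret N: prob_space ?N by (rule prob_space_PiM_iid[OF prob_\<mu>])
  interpret P: prob_space ?P by (rule prob_space_PiM_iid[OF prob_\<mu>])
  interpret PP: pair_prob_space ?P ?P ..
  let ?Y = "\<lambda>i z. \<rho> (z (i, False)) (z (i, True))"
  have Ym: "?Y i \<in> ?N \<rightarrow>\<^sub>M \<mu>" if "i \<in> I" for i
    using measurable_compose[OF measurable_Pair \<rho>(1), of "\<lambda>z. z (i, False)" ?N "\<lambda>z. z (i, True)"] that by auto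
  have Yd: "distr ?N \<mu> (?Y i) = \<mu>" if "i \<in> I" for i
  proof -
    have "distr ?N \<mu> (?Y i) = distr (distr ?N (\<mu> \<Otimes>\<^sub>M \<mu>) (\<lambda>z. (z (i, False), z (i, True)))) \<mu> (\<lambda>(x, v). \<rho> x v)"
      using that \<rho>(1) by (subst distr_distr) (auto simp: o_def)
    also have "\<dots> = \<mu>"
      using that by (subst distr_coordinate_pair) (auto simp: \<rho>(2))
    finally show ?thesis .
  qed
  have blocks: "N.indep_vars (\<lambda>i. PiM ({i} \<times> UNIV) (\<lambda>_. \<mu>)) (\<lambda>i z. restrict (\<lambda>v. z v) ({i} \<times> UNIV)) I"
    by (rule N.indep_vars_restrict[OF indep_vars_coordinates[OF prob_\<mu>]]) (auto simp: disjoint_family_on_def)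
  have "N.indep_vars (\<lambda>_. \<mu>) (\<lambda>i z. (\<lambda>y. \<rho> (y (i, False)) (y (i, True))) (restrict (\<lambda>v. z v) ({i} \<times> UNIV))) I"
  proof (rule N.indep_vars_compose2[OF blocks])
    fix i assume "i \<in> I"
    show "(\<lambda>y. \<rho> (y (i, False)) (y (i, True))) \<in> PiM ({i} \<times> UNIV) (\<lambda>_. \<mu>) \<rightarrow>\<^sub>M \<mu>"
      using measurable_compose[OF measurable_Pair \<rho>(1), of "\<lambda>z. z (i, False)" "PiM ({i} \<times> UNIV) (\<lambda>_. \<mu>)" "\<lambda>z. z (i, True)"]
      by auto
  qed
  then have "N.indep_vars (\<lambda>_. \<mu>) ?Y I" by simp
  then have "distr ?N ?P (\<lambda>z. \<lambda>i\<in>I. ?Y i z) = PiM I (\<lambda>i. distr ?N \<mu> (?Y i))"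
    using N.indep_vars_iff_distr_eq_PiM'[OF I Ym] by simp
  also have "\<dots> = ?P" by (rule PiM_cong) (simp_all add: Yd)
  finally have Y: "distr ?N ?P (\<lambda>z. \<lambda>i\<in>I. ?Y i z) = ?P" .
  have Ypm: "(\<lambda>z. \<lambda>i\<in>I. ?Y i z) \<in> ?N \<rightarrow>\<^sub>M ?P" by (rule measurable_restrict) (rule Ym)
  let ?\<Phi> = "\<lambda>(x, v). F (\<lambda>i\<in>I. \<rho> (x i) (v i))"
  have "(\<lambda>p. \<lambda>i\<in>I. \<rho> (fst p i) (snd p i)) \<in> ?P \<Otimes>\<^sub>M ?P \<rightarrow>\<^sub>M ?P"
  proof (rule measurable_restrict)
    fix i assume "i \<in> I"
    then have "(\<lambda>p. (fst p i, snd p i)) \<in> ?P \<Otimes>\<^sub>M ?P \<rightarrow>\<^sub>M \<mu> \<Otimes>\<^sub>M \<mu>" by measurable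
    from measurable_compose[OF this \<rho>(1)]
    show "(\<lambda>p. \<rho> (fst p i) (snd p i)) \<in> ?P \<Otimes>\<^sub>M ?P \<rightarrow>\<^sub>M \<mu>" by simp
  qed
  from measurable_compose[OF this F(1)] have \<Phi>m: "?\<Phi> \<in> borel_measurable (?P \<Otimes>\<^sub>M ?P)"
    by (simp add: case_prod_unfold)
  have \<Phi>i: "integrable (?P \<Otimes>\<^sub>M ?P) ?\<Phi>"
    using F(3) by (intro PP.P.integrable_const_bound[where B=C, OF _ \<Phi>m]) auto
  have inner: "(\<integral>v. F (\<lambda>i. \<rho> (x i) (v i)) \<partial>?P) = (\<integral>v. F (\<lambda>i\<in>I. \<rho> (x i) (v i)) \<partial>?P)" for x
    by (intro Bochner_Integration.integral_cong refl depends_onD[OF F(2)]) auto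
  show "integrable ?P (\<lambda>x. \<integral>v. F (\<lambda>i. \<rho> (x i) (v i)) \<partial>?P)"
    unfolding inner using PP.integrable_fst'[OF \<Phi>i] by simp
  have "(\<integral>x. (\<integral>v. F (\<lambda>i. \<rho> (x i) (v i)) \<partial>?P) \<partial>?P) = (\<integral>x. (\<integral>v. F (\<lambda>i\<in>I. \<rho> (x i) (v i)) \<partial>?P) \<partial>?P)"
    unfolding inner ..
  also have "\<dots> = integral\<^sup>L (?P \<Otimes>\<^sub>M ?P) ?\<Phi>"
    using PP.integral_fst'[OF \<Phi>i] by simp
  also have "\<dots> = integral\<^sup>L (distr ?N (?P \<Otimes>\<^sub>M ?P) (\<lambda>z. (\<lambda>i\<in>I. z (i, False), \<lambda>i\<in>I. z (i, True)))) ?\<Phi>"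
    by (simp add: distr_two_copies)
  also have "\<dots> = (\<integral>z. ?\<Phi> (\<lambda>i\<in>I. z (i, False), \<lambda>i\<in>I. z (i, True)) \<partial>?N)"
    by (rule integral_distr[OF _ \<Phi>m]) (auto intro!: measurable_Pair measurable_restrict)
  also have "\<dots> = (\<integral>z. F (\<lambda>i\<in>I. ?Y i z) \<partial>?N)"
    by (intro Bochner_Integration.integral_cong refl) (auto intro!: depends_onD[OF F(2)])
  also have "\<dots> = integral\<^sup>L (distr ?N ?P (\<lambda>z. \<lambda>i\<in>I. ?Y i z)) F"
    by (rule integral_distr[OF Ypm F(1), symmetric])
  finally show "(\<integral>x. (\<integral>v. F (\<lambda>i. \<rho> (x i) (v i)) \<partial>?P) \<partial>?P) = (\<integral>x. F x \<partial>?P)" unfolding Y .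
qed

end

section \<open>Counting cells occupied by a prescribed number of points\<close>

lemma prod_of_bool:
  "finite A \<Longrightarrow> (\<Prod>i\<in>A. of_bool (p i) :: 'a::comm_semiring_1) = of_bool (\<forall>i\<in>A. p i)"
  by (induction rule: finite_induct) auto

text \<open>
  Second-moment method for the number of cells that contain exactly \<open>\<kappa>\<close> of \<open>n\<close> independent points, all
  of them in the core.
\<close>

locale cell_family = prob_space \<mu> for \<mu> :: "'a measure" +
  fixes n \<kappa> :: nat and B :: "'b set" and core cell :: "'b \<Rightarrow> 'a set" and q Q :: real
  assumes finite_B: "finite B" and n_ge: "2 * \<kappa> \<le> n"
    and core_cell: "b \<in> B \<Longrightarrow> core b \<subseteq> cell b" and disjoint_cells: "disjoint_family_on cell B"
    and sets_core: "b \<in> B \<Longrightarrow> core b \<in> sets \<mu>" and sets_cell: "b \<in> B \<Longrightarrow> cell b \<in> sets \<mu>"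
    and prob_core: "b \<in> B \<Longrightarrow> prob (core b) = q" and prob_cell: "b \<in> B \<Longrightarrow> prob (cell b) = Q"
    and Q_less_1: "Q < 1"
begin

abbreviation "P \<equiv> PiM {1..n} (\<lambda>_. \<mu>)"

definition good :: "'b \<Rightarrow> (nat \<Rightarrow> 'a) \<Rightarrow> bool" where
  "good b x \<longleftrightarrow> card {i \<in> {1..n}. x i \<in> core b} = \<kappa> \<and> (\<forall>i\<in>{1..n}. x i \<in> cell b \<longrightarrow> x i \<in> core b)"

text \<open>
  Summed over the possible sets \<open>S\<close> of occupants, the event that a cell is good becomes a sum of
  products over the individual points, and all moments factorise.
\<close>

definition occ :: "'b \<Rightarrow> nat set \<Rightarrow> nat \<Rightarrow> 'a \<Rightarrow> real" where
  "occ b S i y = (if i \<in> S then indicator (core b) y else 1 - indicator (cell b) y)"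

definition "subs = {S. S \<subseteq> {1..n} \<and> card S = \<kappa>}"

lemma finite_subs: "finite subs" by (simp add: subs_def)

lemma card_subs: "card subs = n choose \<kappa>" using n_subsets[of "{1..n}" \<kappa>] by (simp add: subs_def)

sublocale P: prob_space P by (rule prob_space_PiM) unfold_locales

lemma prod_occ:
  assumes S: "S \<subseteq> {1..n}" and b: "b \<in> B"
  shows "(\<Prod>i\<in>{1..n}. occ b S i (x i))
    = of_bool (S = {i \<in> {1..n}. x i \<in> core b} \<and> (\<forall>i\<in>{1..n}. x i \<in> cell b \<longrightarrow> x i \<in> core b))"
proof -
  have "occ b S i y = of_bool (if i \<in> S then y \<in> core b else y \<notin> cell b)" for i y
    by (simp add: occ_def indicator_def)
  then have "(\<Prod>i\<in>{1..n}. occ b S i (x i)) = of_bool (\<forall>i\<in>{1..n}. if i \<in> S then x i \<in> core b else x i \<notin> cell b)"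
    by (simp add: prod_of_bool)
  moreover have "(\<forall>i\<in>{1..n}. if i \<in> S then x i \<in> core b else x i \<notin> cell b)
    \<longleftrightarrow> S = {i \<in> {1..n}. x i \<in> core b} \<and> (\<forall>i\<in>{1..n}. x i \<in> cell b \<longrightarrow> x i \<in> core b)"
    using S core_cell[OF b] by (auto split: if_splits)
  ultimately show ?thesis by simp
qed

lemma of_bool_good:
  assumes b: "b \<in> B"
  shows "of_bool (good b x) = (\<Sum>S\<in>subs. \<Prod>i\<in>{1..n}. occ b S i (x i))"
proof -
  let ?S = "{i \<in> {1..n}. x i \<in> core b}" and ?c = "\<forall>i\<in>{1..n}. x i \<in> cell b \<longrightarrow> x i \<in> core b"
  have "(\<Sum>S\<in>subs. \<Prod>i\<in>{1..n}. occ b S i (x i)) = (\<Sum>S\<in>subs. if S = ?S then of_bool ?c else 0)"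
    using b by (intro sum.cong refl) (subst prod_occ, auto simp: subs_def)
  also have "\<dots> = (if ?S \<in> subs then of_bool ?c else 0)"
    using finite_subs by (rule sum.delta)
  also have "\<dots> = of_bool (good b x)"
    by (auto simp: good_def subs_def simp del: One_nat_def)
  finally show ?thesis ..
qed

lemma occ_measurable [measurable]: "b \<in> B \<Longrightarrow> occ b S i \<in> borel_measurable \<mu>"
  unfolding occ_def[abs_def] using sets_core sets_cell by (cases "i \<in> S") auto

lemma occ_bounds: "0 \<le> occ b S i y" "occ b S i y \<le> 1"
  by (auto simp: occ_def indicator_def)

lemma integrable_occ: "b \<in> B \<Longrightarrow> integrable \<mu> (occ b S i)"
  using occ_bounds by (intro integrable_const_bound[where B=1]) auto

lemma integrable_occ_occ: "b \<in> B \<Longrightarrow> b' \<in> B \<Longrightarrow> integrable \<mu> (\<lambda>y. occ b S i y * occ b' S' i y)"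
  using occ_bounds by (intro integrable_const_bound[where B=1]) (auto intro!: mult_le_one)

lemma integral_occ: "b \<in> B \<Longrightarrow> (\<integral>y. occ b S i y \<partial>\<mu>) = (if i \<in> S then q else 1 - Q)"
  using sets_core[of b] sets_cell[of b]
  by (simp add: occ_def prob_core prob_cell prob_space integrable_event)

lemma integral_occ_occ:
  assumes b: "b \<in> B" "b' \<in> B" "b \<noteq> b'"
  shows "(\<integral>y. occ b S i y * occ b' S' i y \<partial>\<mu>)
    = (if i \<in> S then if i \<in> S' then 0 else q else if i \<in> S' then q else 1 - 2 * Q)"
proof -
  have d: "cell b \<inter> cell b' = {}" using disjoint_cells b by (auto simp: disjoint_family_on_def)
  have "occ b S i y * occ b' S' i y = (if i \<in> S then if i \<in> S' then 0 else indicator (core b) y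
      else if i \<in> S' then indicator (core b') y else 1 - indicator (cell b) y - indicator (cell b') y)" for y
    using d core_cell b by (auto simp: occ_def indicator_def)
  then show ?thesis
    using sets_core b sets_cell by (simp add: prob_core prob_cell prob_space integrable_event)
qed

lemma integral_prod_P:
  assumes "\<And>i. i \<in> {1..n} \<Longrightarrow> integrable \<mu> (g i)"
  shows "(\<integral>x. (\<Prod>i\<in>{1..n}. g i (x i) :: real) \<partial>P) = (\<Prod>i\<in>{1..n}. \<integral>y. g i y \<partial>\<mu>)"
proof -
  interpret product_sigma_finite "\<lambda>_. \<mu>" by standard
  show ?thesis using assms by (intro product_integral_prod) auto
qed

lemma integrable_bdd_P: "F \<in> borel_measurable P \<Longrightarrow> (\<And>x. \<bar>F x :: real\<bar> \<le> c) \<Longrightarrow> integrable P F"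
  by (rule P.integrable_const_bound[where B=c]) auto

lemma prod_occ_measurable: "b \<in> B \<Longrightarrow> (\<lambda>x. \<Prod>i\<in>{1..n}. occ b S i (x i)) \<in> borel_measurable P"
  by (intro borel_measurable_prod) measurable

lemma good_measurable: "b \<in> B \<Longrightarrow> (\<lambda>x. of_bool (good b x) :: real) \<in> borel_measurable P"
  by (simp add: of_bool_good borel_measurable_sum prod_occ_measurable)

definition "cell_prob = real (n choose \<kappa>) * q ^ \<kappa> * (1 - Q) ^ (n - \<kappa>)"

lemma expectation_good:
  assumes b: "b \<in> B"
  shows "(\<integral>x. of_bool (good b x) \<partial>P) = cell_prob"
proof -
  have int: "integrable P (\<lambda>x. \<Prod>i\<in>{1..n}. occ b S i (x i))" for S
  proof (rule integrable_bdd_P[OF prod_occ_measurable[OF b]])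
    show "\<bar>\<Prod>i\<in>{1..n}. occ b S i (x i)\<bar> \<le> 1" for x
      using prod_le_1[of "{1..n}" "\<lambda>i. occ b S i (x i)"] prod_nonneg[of "{1..n}" "\<lambda>i. occ b S i (x i)"] occ_bounds by auto
  qed
  have "(\<integral>x. of_bool (good b x) \<partial>P) = (\<Sum>S\<in>subs. \<integral>x. (\<Prod>i\<in>{1..n}. occ b S i (x i)) \<partial>P)"
    unfolding of_bool_good[OF b] by (intro Bochner_Integration.integral_sum int)
  also have "\<dots> = (\<Sum>S\<in>subs. q ^ \<kappa> * (1 - Q) ^ (n - \<kappa>))"
  proof (intro sum.cong refl)
    fix S assume S: "S \<in> subs"
    then have fS: "{1..n} \<inter> S = S" "{1..n} \<inter> - S = {1..n} - S" "finite S" by (auto simp: subs_def intro: finite_subset)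
    have "(\<integral>x. (\<Prod>i\<in>{1..n}. occ b S i (x i)) \<partial>P) = (\<Prod>i\<in>{1..n}. if i \<in> S then q else 1 - Q)"
      using b by (subst integral_prod_P) (simp_all add: integral_occ integrable_occ)
    also have "\<dots> = q ^ card S * (1 - Q) ^ card ({1..n} - S)"
      using fS by (subst prod.If_cases) auto
    also have "card ({1..n} - S) = n - \<kappa>" using S by (subst card_Diff_subset) (auto simp: subs_def intro: finite_subset)
    finally show "(\<integral>x. (\<Prod>i\<in>{1..n}. occ b S i (x i)) \<partial>P) = q ^ \<kappa> * (1 - Q) ^ (n - \<kappa>)" using S by (simp add: subs_def)
  qed
  finally show ?thesis by (simp add: card_subs cell_prob_def)
qed

lemma two_cells:
  assumes b: "b \<in> B" "b' \<in> B" "b \<noteq> b'"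
  shows "0 \<le> q" "0 \<le> Q" "2 * Q \<le> 1"
proof -
  have d: "cell b \<inter> cell b' = {}" using disjoint_cells b by (auto simp: disjoint_family_on_def)
  have "prob (cell b \<union> cell b') = 2 * Q"
    using d b sets_cell by (subst finite_measure_Union) (auto simp: prob_cell)
  then show "2 * Q \<le> 1" using prob_le_1[of "cell b \<union> cell b'"] by simp
  show "0 \<le> q" "0 \<le> Q" using prob_core[OF b(1)] prob_cell[OF b(1)] measure_nonneg by metis+
qed

text \<open>
  Two different cells are almost uncorrelated, because \<open>1 - 2 Q \<le> (1 - Q)\<^sup>2\<close>; the only loss is the factor
  \<open>(1 - Q) ^ (- 2 \<kappa>)\<close> from the points that already occupy the other cell.
\<close>

lemma expectation_good_good:
  assumes b: "b \<in> B" "b' \<in> B" "b \<noteq> b'"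
  shows "(\<integral>x. of_bool (good b x) * of_bool (good b' x) \<partial>P) \<le> cell_prob\<^sup>2 / (1 - Q) ^ (2 * \<kappa>)"
proof -
  let ?g = "\<lambda>S S' i y. occ b S i y * occ b' S' i y"
  have m: "(\<lambda>x. \<Prod>i\<in>{1..n}. ?g S S' i (x i)) \<in> borel_measurable P" for S S'
    using prod_occ_measurable[OF b(1)] prod_occ_measurable[OF b(2)] by (simp add: prod.distrib borel_measurable_times)
  have gb: "0 \<le> ?g S S' i y" "?g S S' i y \<le> 1" for S S' i y
    using occ_bounds by (auto intro!: mult_le_one)
  have int: "integrable P (\<lambda>x. \<Prod>i\<in>{1..n}. ?g S S' i (x i))" for S S'
  proof (rule integrable_bdd_P[OF m])
    show "\<bar>\<Prod>i\<in>{1..n}. ?g S S' i (x i)\<bar> \<le> 1" for x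
      using prod_le_1[of "{1..n}" "\<lambda>i. ?g S S' i (x i)"] prod_nonneg[of "{1..n}" "\<lambda>i. ?g S S' i (x i)"] gb
      by (metis abs_of_nonneg)
  qed
  have pos: "0 \<le> q" "0 \<le> Q" "2 * Q \<le> 1" by (rule two_cells[OF b])+
  let ?e = "(q ^ \<kappa>)\<^sup>2 * (1 - 2 * Q) ^ (n - 2 * \<kappa>)"
  have e0: "0 \<le> ?e" using pos by simp
  have "(\<integral>x. of_bool (good b x) * of_bool (good b' x) \<partial>P)
      = (\<integral>x. (\<Sum>S\<in>subs. \<Sum>S'\<in>subs. \<Prod>i\<in>{1..n}. ?g S S' i (x i)) \<partial>P)"
    unfolding of_bool_good[OF b(1)] of_bool_good[OF b(2)] by (simp add: sum_product prod.distrib)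
  also have "\<dots> = (\<Sum>S\<in>subs. \<Sum>S'\<in>subs. \<integral>x. (\<Prod>i\<in>{1..n}. ?g S S' i (x i)) \<partial>P)"
    using int by (simp add: Bochner_Integration.integral_sum Bochner_Integration.integrable_sum)
  also have "\<dots> \<le> (\<Sum>S\<in>subs. \<Sum>S'\<in>subs. ?e)"
  proof (intro sum_mono)
    fix S S' assume S: "S \<in> subs" "S' \<in> subs"
    let ?h = "\<lambda>i. if i \<in> S then if i \<in> S' then 0 else q else if i \<in> S' then q else 1 - 2 * Q"
    have "(\<integral>x. (\<Prod>i\<in>{1..n}. ?g S S' i (x i)) \<partial>P) = (\<Prod>i\<in>{1..n}. ?h i)"
      using b by (subst integral_prod_P) (simp_all add: integral_occ_occ integrable_occ_occ)
    also have "\<dots> \<le> ?e"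
    proof (cases "S \<inter> S' = {}")
      case False
      then obtain i where "i \<in> S" "i \<in> S'" by auto
      then have "(\<Prod>i\<in>{1..n}. ?h i) = 0"
        using S by (intro prod_zero bexI[of _ i]) (auto simp: subs_def)
      then show ?thesis by (rule ord_eq_le_trans[OF _ e0])
    next
      case True
      have fin: "finite S" "finite S'" using S by (auto simp: subs_def intro: finite_subset)
      have un: "{1..n} = (S \<union> S') \<union> ({1..n} - (S \<union> S'))" using S by (auto simp: subs_def)
      have "(\<Prod>i\<in>{1..n}. ?h i) = (\<Prod>i\<in>S \<union> S'. ?h i) * (\<Prod>i\<in>{1..n} - (S \<union> S'). ?h i)"
        by (subst un, subst prod.union_disjoint) (use fin in auto)
      also have "(\<Prod>i\<in>S \<union> S'. ?h i) = (\<Prod>i\<in>S. ?h i) * (\<Prod>i\<in>S'. ?h i)"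
        using fin True by (rule prod.union_disjoint)
      also have "(\<Prod>i\<in>S. ?h i) = (\<Prod>i\<in>S. q)" using True by (intro prod.cong) auto
      also have "(\<Prod>i\<in>S'. ?h i) = (\<Prod>i\<in>S'. q)" using True by (intro prod.cong) auto
      also have "(\<Prod>i\<in>{1..n} - (S \<union> S'). ?h i) = (\<Prod>i\<in>{1..n} - (S \<union> S'). 1 - 2 * Q)" by (intro prod.cong) auto
      finally have "(\<Prod>i\<in>{1..n}. ?h i) = q ^ card S * q ^ card S' * (1 - 2 * Q) ^ card ({1..n} - (S \<union> S'))"
        by simp
      moreover have "card ({1..n} - (S \<union> S')) = n - 2 * \<kappa>"
        using S fin True by (subst card_Diff_subset) (auto simp: subs_def card_Un_disjoint)
      ultimately show ?thesis using S by (simp add: subs_def power2_eq_square)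
    qed
    finally show "(\<integral>x. (\<Prod>i\<in>{1..n}. ?g S S' i (x i)) \<partial>P) \<le> ?e" .
  qed
  also have "\<dots> = (real (n choose \<kappa>) * q ^ \<kappa>)\<^sup>2 * (1 - 2 * Q) ^ (n - 2 * \<kappa>)"
    by (simp add: card_subs power2_eq_square)
  also have "\<dots> \<le> (real (n choose \<kappa>) * q ^ \<kappa>)\<^sup>2 * ((1 - Q)\<^sup>2) ^ (n - 2 * \<kappa>)"
    using pos by (intro mult_left_mono power_mono) (auto simp: power2_eq_square algebra_simps)
  also have "\<dots> = cell_prob\<^sup>2 / (1 - Q) ^ (2 * \<kappa>)"
  proof -
    have "((1 - Q) ^ (n - \<kappa>))\<^sup>2 = ((1 - Q)\<^sup>2) ^ (n - 2 * \<kappa>) * (1 - Q) ^ (2 * \<kappa>)"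
    proof -
      have "(n - \<kappa>) * 2 = 2 * (n - 2 * \<kappa>) + 2 * \<kappa>" using n_ge by simp
      then show ?thesis unfolding power_mult[symmetric] power_add[symmetric] by simp
    qed
    then have "cell_prob\<^sup>2 = (real (n choose \<kappa>) * q ^ \<kappa>)\<^sup>2 * ((1 - Q)\<^sup>2) ^ (n - 2 * \<kappa>) * (1 - Q) ^ (2 * \<kappa>)"
      by (simp add: cell_prob_def power_mult_distrib)
    then show ?thesis using Q_less_1 by simp
  qed
  finally show ?thesis .
qed

definition "N x = (\<Sum>b\<in>B. of_bool (good b x) :: real)"
definition "mean = real (card B) * cell_prob"

lemma N_measurable: "N \<in> borel_measurable P"
  unfolding N_def[abs_def] by (intro borel_measurable_sum good_measurable)

lemma expectation_N: "(\<integral>x. N x \<partial>P) = mean"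
proof -
  have "integrable P (\<lambda>x. of_bool (good b x) :: real)" if "b \<in> B" for b
    using that by (intro integrable_bdd_P[where c=1] good_measurable) auto
  then have "(\<integral>x. N x \<partial>P) = (\<Sum>b\<in>B. \<integral>x. of_bool (good b x) \<partial>P)"
    unfolding N_def by (intro Bochner_Integration.integral_sum)
  then show ?thesis by (simp add: expectation_good mean_def del: One_nat_def)
qed

lemma second_moment_N: "(\<integral>x. (N x)\<^sup>2 \<partial>P) \<le> mean + mean\<^sup>2 / (1 - Q) ^ (2 * \<kappa>)"
proof -
  let ?g = "\<lambda>b x. of_bool (good b x) :: real"
  have int: "integrable P (\<lambda>x. ?g b x * ?g b' x)" if "b \<in> B" "b' \<in> B" for b b'
    using that by (intro integrable_bdd_P[where c=1] borel_measurable_times good_measurable) auto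
  have "(\<integral>x. (N x)\<^sup>2 \<partial>P) = (\<integral>x. (\<Sum>b\<in>B. \<Sum>b'\<in>B. ?g b x * ?g b' x) \<partial>P)"
    by (simp add: N_def power2_eq_square sum_product del: of_bool_conj)
  also have "\<dots> = (\<Sum>b\<in>B. \<Sum>b'\<in>B. \<integral>x. ?g b x * ?g b' x \<partial>P)"
    using int by (simp add: Bochner_Integration.integral_sum Bochner_Integration.integrable_sum)
  also have "\<dots> \<le> (\<Sum>b\<in>B. \<Sum>b'\<in>B. (if b' = b then cell_prob else 0) + cell_prob\<^sup>2 / (1 - Q) ^ (2 * \<kappa>))"
  proof (intro sum_mono)
    fix b b' assume b: "b \<in> B" "b' \<in> B"
    have "0 \<le> cell_prob\<^sup>2 / (1 - Q) ^ (2 * \<kappa>)" using Q_less_1 by simp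
    then show "(\<integral>x. ?g b x * ?g b' x \<partial>P) \<le> (if b' = b then cell_prob else 0) + cell_prob\<^sup>2 / (1 - Q) ^ (2 * \<kappa>)"
      using expectation_good_good[OF b] expectation_good[OF b(1)]
      by (cases "b = b'") (simp_all flip: of_bool_conj)
  qed
  also have "\<dots> = mean + mean\<^sup>2 / (1 - Q) ^ (2 * \<kappa>)"
    using finite_B by (simp add: sum.distrib mean_def power2_eq_square algebra_simps)
  finally show ?thesis .
qed

theorem prob_few_good_cells:
  assumes "0 < mean"
  shows "P.prob {x \<in> space P. N x < mean / 2} \<le> 4 * (1 / mean + (1 / (1 - Q) ^ (2 * \<kappa>) - 1))"
proof -
  have N_bd: "\<bar>N x\<bar> \<le> card B" for x
    unfolding N_def using sum_norm_le[of B "\<lambda>b. of_bool (good b x) :: real" "\<lambda>_. 1"] by simp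
  have N_int: "integrable P N" by (rule integrable_bdd_P[OF N_measurable N_bd])
  have N2_int: "integrable P (\<lambda>x. (N x)\<^sup>2)"
  proof (rule integrable_bdd_P)
    show "\<bar>(N x)\<^sup>2\<bar> \<le> (real (card B))\<^sup>2" for x using power_mono[OF N_bd[of x], of 2] by simp
  qed (use N_measurable in simp)
  have "P.prob {x \<in> space P. N x < mean / 2} \<le> P.prob {x \<in> space P. mean / 2 \<le> \<bar>N x - (\<integral>x. N x \<partial>P)\<bar>}"
    using N_measurable by (intro P.finite_measure_mono) (auto simp: expectation_N abs_real_def simp del: One_nat_def)
  also have "\<dots> \<le> P.variance N / (mean / 2)\<^sup>2"
    using assms N_measurable N2_int by (intro P.Chebyshev_inequality) auto
  also have "P.variance N = (\<integral>x. (N x)\<^sup>2 \<partial>P) - mean\<^sup>2"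
    using N_int N2_int by (subst P.variance_eq) (simp_all add: expectation_N del: One_nat_def)
  also have "((\<integral>x. (N x)\<^sup>2 \<partial>P) - mean\<^sup>2) / (mean / 2)\<^sup>2
     \<le> (mean + mean\<^sup>2 / (1 - Q) ^ (2 * \<kappa>) - mean\<^sup>2) / (mean / 2)\<^sup>2"
    using second_moment_N by (intro divide_right_mono) auto
  also have "\<dots> = 4 * (1 / mean + (1 / (1 - Q) ^ (2 * \<kappa>) - 1))"
    using assms by (simp add: field_simps power2_eq_square)
  finally show ?thesis .
qed

end

section \<open>Good cells smooth the characteristic function\<close>

lemma (in prob_space) expectation_cis_event:
  assumes "Measurable.pred M p"
  shows "expectation (\<lambda>x. cis (\<theta> * of_bool (p x)))
    = of_real (1 - prob {x \<in> space M. p x}) + of_real (prob {x \<in> space M. p x}) * cis \<theta>"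
proof -
  let ?A = "{x \<in> space M. p x}"
  have "?A \<in> events" using assms by (simp add: pred_def)
  note A = integrable_event[OF this] and iA = expectation_event[OF this]
  have i1: "integrable M (\<lambda>v. complex_of_real (1 - indicator ?A v))"
    using A by (intro integrable_of_real Bochner_Integration.integrable_diff) auto
  have i2: "integrable M (\<lambda>v. complex_of_real (indicator ?A v) * cis \<theta>)"
    using A by (intro integrable_mult_left integrable_of_real) auto
  have "expectation (\<lambda>x. cis (\<theta> * of_bool (p x)))
    = expectation (\<lambda>v. of_real (1 - indicator ?A v) + of_real (indicator ?A v) * cis \<theta>)"
    by (intro Bochner_Integration.integral_cong refl) (auto simp: indicator_def)
  moreover have "expectation (\<lambda>v. complex_of_real (1 - indicator ?A v)) = of_real (1 - prob ?A)"
    unfolding integral_complex_of_real using A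
    by (subst Bochner_Integration.integral_diff) (simp_all add: iA prob_space del: Bochner_Integration.integral_indicator)
  moreover have "expectation (\<lambda>v. complex_of_real (indicator ?A v) * cis \<theta>) = of_real (prob ?A) * cis \<theta>"
    unfolding integral_mult_left_zero integral_complex_of_real iA ..
  ultimately show ?thesis
    unfolding Bochner_Integration.integral_add[OF i1 i2] by simp
qed


text \<open>
  The probability that \<open>\<kappa>\<close> uniform points of the unit cube form the graph at radius \<open>\<epsilon>\<close>. The type
  argument \<open>D\<close> carries the dimension, which no other argument determines.
\<close>

definition pattern_prob :: "'v pair_pre_digraph \<Rightarrow> nat \<Rightarrow> 'd::finite itself \<Rightarrow> real \<Rightarrow> real" where
  "pattern_prob \<Gamma> \<kappa> D \<epsilon> = measure (PiM {1..\<kappa>} (\<lambda>_. cube :: (real ^ 'd) measure))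
    {x \<in> space (PiM {1..\<kappa>} (\<lambda>_. cube)). forms \<Gamma> \<epsilon> {1..\<kappa>} x}"

text \<open>
  A cell has width \<open>r / \<epsilon> + 2 margin\<close>: its core is a cube of side \<open>r / \<epsilon>\<close>, so that after rescaling to the
  unit cube the radius is \<open>\<epsilon>\<close>, surrounded by a margin wider than any copy of the graph.
\<close>

locale grid_cells =
  fixes \<Gamma> :: "'v pair_pre_digraph" and n \<kappa> :: nat and r \<epsilon> :: real and dim :: "'d::finite itself"
  assumes \<Gamma>: "pair_graph \<Gamma>" "Digraph_Component.connected (with_proj \<Gamma>)" "card (pverts \<Gamma>) = \<kappa>"
    and \<kappa>_pos: "1 \<le> \<kappa>" and n_large: "2 * \<kappa> \<le> n"
    and r_pos: "0 < r" and \<epsilon>_pos: "0 < \<epsilon>"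
    and r_small: "r * (1 / \<epsilon> + 2 * (card (parcs \<Gamma>) + 1)) \<le> 1 / 2"
begin

definition "diam = real (card (parcs \<Gamma>)) * r"
definition "side = r / \<epsilon>"
definition "margin = (card (parcs \<Gamma>) + 1) * r"
definition "width = side + 2 * margin"
definition "K = nat \<lfloor>1 / width\<rfloor>"
definition B :: "('d \<Rightarrow> nat) set" where "B = {b. \<forall>i. b i < K}"
definition corner :: "('d \<Rightarrow> nat) \<Rightarrow> real ^ 'd" where "corner b = (\<chi> i. real (b i) * width + margin)"
definition cell :: "('d \<Rightarrow> nat) \<Rightarrow> (real ^ 'd) set" where
  "cell b = {x. \<forall>i. real (b i) * width \<le> x $ i \<and> x $ i < real (b i) * width + width}"
definition core :: "('d \<Rightarrow> nat) \<Rightarrow> (real ^ 'd) set" where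
  "core b = cbox (corner b) (corner b + side *\<^sub>R 1)"

lemma side_pos: "0 < side" and margin_pos: "0 < margin" and width_pos: "0 < width"
  using r_pos \<epsilon>_pos by (auto simp: side_def margin_def width_def add_pos_pos)

lemma width_eq: "width = r * (1 / \<epsilon> + 2 * (card (parcs \<Gamma>) + 1))"
  by (simp add: width_def side_def margin_def algebra_simps)

lemma width_le: "width \<le> 1 / 2" unfolding width_eq by (rule r_small)

lemma K_bounds: "real K * width \<le> 1" "1 / (2 * width) \<le> real K"
proof -
  have K: "real K = of_int \<lfloor>1 / width\<rfloor>" using width_pos by (simp add: K_def)
  have "real K \<le> 1 / width" unfolding K by simp
  then show "real K * width \<le> 1" using width_pos by (simp add: pos_le_divide_eq)
  have "1 / width - 1 \<le> real K" unfolding K by linarith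
  moreover have "1 \<le> 1 / (2 * width)" using width_le width_pos by simp
  moreover have "1 / width = 2 * (1 / (2 * width))" by simp
  ultimately show "1 / (2 * width) \<le> real K" by linarith
qed

lemma B_eq_PiE: "B = (UNIV :: 'd set) \<rightarrow>\<^sub>E {..<K}"
  by (auto simp: B_def PiE_def extensional_def)

lemma finite_B: "finite B" and card_B: "card B = K ^ CARD('d)"
  unfolding B_eq_PiE by (auto intro: finite_PiE simp: card_PiE)

lemma core_subset_cell: "core b \<subseteq> cell b"
proof
  fix x assume "x \<in> core b"
  then have x: "real (b i) * width + margin \<le> x $ i \<and> x $ i \<le> real (b i) * width + margin + side" for i
    by (simp add: core_def corner_def mem_box_cart)
  have "real (b i) * width \<le> x $ i \<and> x $ i < real (b i) * width + width" for i
    using x[of i] side_pos margin_pos width_def by linarith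
  then show "x \<in> cell b" by (simp add: cell_def)
qed

lemma cell_disjoint: "b \<noteq> b' \<Longrightarrow> cell b \<inter> cell b' = {}"
proof (rule ccontr)
  assume "b \<noteq> b'" and "cell b \<inter> cell b' \<noteq> {}"
  then obtain x where x: "x \<in> cell b" "x \<in> cell b'" by auto
  have le: "b1 i \<le> b2 i" if "x \<in> cell b1" "x \<in> cell b2" for b1 b2 i
  proof -
    have "real (b1 i) * width < (real (b2 i) + 1) * width"
      using that unfolding cell_def by (auto simp: distrib_right intro: le_less_trans)
    then show ?thesis using width_pos by simp
  qed
  have "b = b'" by (rule ext) (intro antisym le x)
  with \<open>b \<noteq> b'\<close> show False by simp
qed

lemma cell_sandwich:
  "box (\<chi> i. real (b i) * width) ((\<chi> i. real (b i) * width) + width *\<^sub>R 1) \<subseteq> cell b"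
  "cell b \<subseteq> cbox (\<chi> i. real (b i) * width) ((\<chi> i. real (b i) * width) + width *\<^sub>R 1)"
  by (auto simp: cell_def mem_box_cart less_imp_le)

lemma cell_subset_unit: "b \<in> B \<Longrightarrow> cell b \<subseteq> cbox 0 1"
proof
  fix x assume b: "b \<in> B" and x: "x \<in> cell b"
  have "0 \<le> x $ i \<and> x $ i \<le> 1" for i
  proof -
    have "Suc (b i) \<le> K" using b by (simp add: B_def Suc_le_eq)
    then have "real (b i) + 1 \<le> real K" using of_nat_mono[of "Suc (b i)" K, where 'a=real] by simp
    then have "(real (b i) + 1) * width \<le> real K * width" using width_pos by (intro mult_right_mono) auto
    then have "real (b i) * width + width \<le> 1" using K_bounds(1) by (simp add: distrib_right)
    moreover have "0 \<le> real (b i) * width" using width_pos by simp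
    moreover have "real (b i) * width \<le> x $ i \<and> x $ i < real (b i) * width + width"
      using x by (simp add: cell_def)
    ultimately show ?thesis by linarith
  qed
  then show "x \<in> cbox 0 1" by (simp add: mem_box_cart)
qed

lemma sets_cell: "cell b \<in> sets borel"
  unfolding cell_def by measurable

lemma sets_core: "core b \<in> sets borel"
  by (simp add: core_def)

lemma emeasure_cell: "b \<in> B \<Longrightarrow> emeasure cube (cell b) = ennreal (width ^ CARD('d))"
proof -
  assume b: "b \<in> B"
  have "emeasure cube (cell b) = emeasure lborel (cell b)"
    using cell_subset_unit[OF b] sets_cell[of b]
    by (subst emeasure_cube) (auto simp: Int_absorb1)
  also have "\<dots> = ennreal (width ^ CARD('d))"
  proof (rule antisym)
    show "emeasure lborel (cell b) \<le> ennreal (width ^ CARD('d))"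
      using emeasure_mono[OF cell_sandwich(2)[of b], of lborel] emeasure_lborel_cube(1)[of width "\<chi> i. real (b i) * width"] width_pos
      by simp
    show "ennreal (width ^ CARD('d)) \<le> emeasure lborel (cell b)"
      using emeasure_mono[OF cell_sandwich(1)[of b], of lborel] emeasure_lborel_cube(2)[of width "\<chi> i. real (b i) * width"] width_pos
      sets_cell[of b] by simp
  qed
  finally show ?thesis .
qed

lemma core_cell_separated:
  assumes "x \<in> core b" "y \<notin> cell b"
  shows "diam < norm (y - x)"
proof -
  obtain i where i: "\<not> (real (b i) * width \<le> y $ i \<and> y $ i < real (b i) * width + width)"
    using assms(2) by (auto simp: cell_def)
  have "real (b i) * width + margin \<le> x $ i" "x $ i \<le> real (b i) * width + margin + side"
    using assms(1) by (auto simp: core_def corner_def mem_box_cart)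
  then have "margin \<le> \<bar>y $ i - x $ i\<bar>"
    using i unfolding width_def by linarith
  also have "\<dots> \<le> norm (y - x)" using component_le_norm_cart[of "y - x" i] by simp
  finally show ?thesis using r_pos by (simp add: diam_def margin_def distrib_right)
qed

sublocale sub: subcubes B corner side
proof
  show "b \<in> B \<Longrightarrow> cbox (corner b) (corner b + side *\<^sub>R 1) \<subseteq> cbox 0 1" for b
    using core_subset_cell[of b] cell_subset_unit[of b] by (auto simp: core_def)
  show "disjoint_family_on (\<lambda>b. cbox (corner b) (corner b + side *\<^sub>R 1)) B"
    using core_subset_cell cell_disjoint unfolding disjoint_family_on_def core_def by blast
qed (use finite_B side_pos in auto)

sublocale cell_family "cube :: (real ^ 'd) measure" n \<kappa> B core cell "side ^ CARD('d)" "width ^ CARD('d)"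
proof -
  interpret C: prob_space "cube :: (real ^ 'd) measure" by (rule prob_space_cube)
  show "cell_family (cube :: (real ^ 'd) measure) n \<kappa> B core cell (side ^ CARD('d)) (width ^ CARD('d))"
  proof
    show "disjoint_family_on cell B" using cell_disjoint by (auto simp: disjoint_family_on_def)
    show "C.prob (core b) = side ^ CARD('d)" if "b \<in> B" for b
      using sub.emeasure_subcube[OF that] side_pos by (simp add: measure_def core_def)
    show "C.prob (cell b) = width ^ CARD('d)" if "b \<in> B" for b
      using emeasure_cell[OF that] width_pos by (simp add: measure_def)
    show "width ^ CARD('d) < 1"
      using width_le width_pos by (intro power_less_one_iff[THEN iffD2]) auto
  qed (use finite_B n_large core_subset_cell sets_core sets_cell in auto)
qed

definition "copies x = (\<Sum>I\<in>subs. of_bool (forms \<Gamma> r I x) :: real)"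
definition "single_prob = pattern_prob \<Gamma> \<kappa> TYPE('d) \<epsilon>"
definition "single_char \<theta> = complex_of_real (1 - single_prob) + of_real single_prob * cis \<theta>"

lemma finite_pverts: "finite (pverts \<Gamma>)"
  using \<Gamma>(3) \<kappa>_pos card.infinite by force

lemma forms_measurable: "I \<subseteq> J \<Longrightarrow> finite J \<Longrightarrow> Measurable.pred (PiM J (\<lambda>_. cube :: (real ^ 'd) measure)) (forms \<Gamma> a I)"
  by (rule pred_forms[OF finite_pverts]) auto

lemma single_block:
  assumes S: "S \<in> subs"
  shows "(\<integral>v. cis (\<theta> * of_bool (forms \<Gamma> \<epsilon> S v)) \<partial>P) = single_char \<theta>"
proof -
  let ?M = "PiM {1..\<kappa>} (\<lambda>_. cube :: (real ^ 'd) measure)"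
  interpret M: prob_space ?M by (rule prob_space_PiM) (rule prob_space_cube)
  have fS: "finite S" "card S = \<kappa>" "S \<subseteq> {1..n}" using S by (auto simp: subs_def intro: finite_subset)
  obtain g where g: "bij_betw g {1..\<kappa>} S"
    using finite_same_card_bij[of "{1..\<kappa>}" S] fS by auto
  let ?F = "\<lambda>v. cis (\<theta> * of_bool (forms \<Gamma> \<epsilon> {1..\<kappa>} v))"
  have pm: "Measurable.pred ?M (forms \<Gamma> \<epsilon> {1..\<kappa>})" by (rule forms_measurable) auto
  have Fm: "?F \<in> borel_measurable ?M" unfolding cis_conv_exp using pm by measurable
  have "(\<integral>v. cis (\<theta> * of_bool (forms \<Gamma> \<epsilon> S v)) \<partial>P) = (\<integral>v. ?F (\<lambda>i. v (g i)) \<partial>P)"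
    by (simp only: forms_relabel[OF g])
  also have "\<dots> = (\<integral>v. ?F v \<partial>?M)"
    by (rule integral_reindex[OF prob_space_cube depends_on_comp[OF depends_on_forms] Fm])
      (use bij_betwE[OF g] bij_betw_imp_inj_on[OF g] fS(3) in blast)+
  also have "\<dots> = single_char \<theta>"
    unfolding single_char_def single_prob_def pattern_prob_def by (rule prob_space.expectation_cis_event[OF M.prob_space_axioms pm])
  finally show ?thesis .
qed

definition "occupants b x = {i \<in> {1..n}. x i \<in> core b}"
definition "goods x = {b \<in> B. good b x}"
definition "rest x y = (\<Sum>I\<in>{I \<in> subs. \<forall>b\<in>goods x. I \<inter> occupants b x = {}}. of_bool (forms \<Gamma> r I y) :: real)"

lemma occupants_subs: "b \<in> goods x \<Longrightarrow> occupants b x \<in> subs"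
  by (auto simp: occupants_def goods_def good_def subs_def simp del: One_nat_def)

lemma occupants_disjoint: "b \<noteq> b' \<Longrightarrow> occupants b x \<inter> occupants b' x = {}"
  using cell_disjoint[of b b'] core_subset_cell[of b] core_subset_cell[of b'] by (auto simp: occupants_def)

text \<open>
  A set of indices with one member inside and one outside the core of a good cell never forms the graph, since
  refreshing moves no point out of its core and copies of the graph are narrower than the margin.
\<close>

lemma mixed_not_forms:
  assumes v: "\<And>i. i \<in> {1..n} \<Longrightarrow> v i \<in> cbox 0 1" and I: "I \<in> subs" and b: "b \<in> goods x"
    and i: "i \<in> I" "i \<in> occupants b x" and j: "j \<in> I" "j \<notin> occupants b x"
  shows "\<not> forms \<Gamma> r I (\<lambda>i. sub.R (x i) (v i))"
proof
  assume f: "forms \<Gamma> r I (\<lambda>i. sub.R (x i) (v i))"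
  have In: "i \<in> {1..n}" "j \<in> {1..n}" using I i j by (auto simp: subs_def)
  have bB: "b \<in> B" using b by (simp add: goods_def)
  have in_core: "sub.R (x k) (v k) \<in> core b'" if "b' \<in> B" "x k \<in> core b'" "k \<in> {1..n}" for k b'
    using sub.refresh_in[OF that(1), of "x k" "v k"] that(2) affine_mem_cbox[OF side_pos, of "corner b'" "v k"] v[OF that(3)]
    unfolding core_def by simp
  have 1: "sub.R (x i) (v i) \<in> core b" using in_core[OF bB _ In(1)] i by (simp add: occupants_def)
  have xj: "x j \<notin> cell b" using b j In by (auto simp: goods_def good_def occupants_def)
  have 2: "sub.R (x j) (v j) \<notin> cell b"
  proof (cases "\<exists>b'\<in>B. x j \<in> core b'")
    case True
    then obtain b' where b': "b' \<in> B" "x j \<in> core b'" by auto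
    then have "b' \<noteq> b" using xj core_subset_cell by auto
    moreover have "sub.R (x j) (v j) \<in> cell b'" using in_core[OF b' In(2)] core_subset_cell by auto
    ultimately show ?thesis using cell_disjoint by blast
  next
    case False
    then have "sub.R (x j) (v j) = x j" by (intro sub.refresh_out) (auto simp: core_def)
    then show ?thesis using xj by simp
  qed
  have "norm (sub.R (x j) (v j) - sub.R (x i) (v i)) \<le> diam"
    unfolding diam_def using r_pos by (intro forms_norm_le[OF \<Gamma>(1,2) f i(1) j(1)]) auto
  with core_cell_separated[OF 1 2] show False by simp
qed

lemma count_decomposition:
  assumes v: "\<And>i. i \<in> {1..n} \<Longrightarrow> v i \<in> cbox 0 1"
  shows "copies (\<lambda>i. sub.R (x i) (v i))
    = (\<Sum>b\<in>goods x. of_bool (forms \<Gamma> \<epsilon> (occupants b x) v)) + rest x (\<lambda>i. sub.R (x i) (v i))"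
proof -
  let ?y = "\<lambda>i. sub.R (x i) (v i)" and ?O = "\<lambda>b. occupants b x"
  let ?free = "{I \<in> subs. \<forall>b\<in>goods x. I \<inter> ?O b = {}}"
  have ne: "?O b \<noteq> {}" if "b \<in> goods x" for b
    using occupants_subs[OF that] \<kappa>_pos by (auto simp: subs_def)
  have O: "?O ` goods x \<subseteq> subs - ?free"
    using occupants_subs ne by fastforce
  have zero: "of_bool (forms \<Gamma> r I ?y) = (0::real)" if I: "I \<in> subs - ?free - ?O ` goods x" for I
  proof -
    obtain b where b: "b \<in> goods x" "I \<inter> ?O b \<noteq> {}" using I by auto
    then obtain i where i: "i \<in> I" "i \<in> ?O b" by auto
    have "I \<noteq> ?O b" using I b by auto
    moreover have "finite I" "card I = card (?O b)" "finite (?O b)"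
      using I occupants_subs[OF b(1)] by (auto simp: subs_def intro: finite_subset)
    ultimately have "\<not> I \<subseteq> ?O b" using card_subset_eq by blast
    then obtain j where "j \<in> I" "j \<notin> ?O b" by auto
    then show ?thesis using mixed_not_forms[OF v _ b(1) i] I by simp
  qed
  have eq: "forms \<Gamma> r (?O b) ?y = forms \<Gamma> \<epsilon> (?O b) v" if b: "b \<in> goods x" for b
  proof -
    have "forms \<Gamma> r (?O b) ?y = forms \<Gamma> r (?O b) (\<lambda>i. corner b + side *\<^sub>R v i)"
    proof (rule depends_onD[OF depends_on_forms])
      fix i assume "i \<in> ?O b"
      then show "sub.R (x i) (v i) = corner b + side *\<^sub>R v i"
        using b by (intro sub.refresh_in) (auto simp: occupants_def goods_def core_def)
    qed
    also have "\<dots> = forms \<Gamma> (r / side) (?O b) v" by (rule forms_scale[OF side_pos])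
    also have "r / side = \<epsilon>" using r_pos by (simp add: side_def)
    finally show ?thesis .
  qed
  have "copies ?y = (\<Sum>I\<in>subs - ?free. of_bool (forms \<Gamma> r I ?y)) + rest x ?y"
    unfolding copies_def rest_def by (rule sum.subset_diff) (auto simp: finite_subs)
  also have "(\<Sum>I\<in>subs - ?free. of_bool (forms \<Gamma> r I ?y)) = (\<Sum>I\<in>?O ` goods x. of_bool (forms \<Gamma> r I ?y) :: real)"
    using finite_subs O zero by (intro sum.mono_neutral_right) auto
  also have "\<dots> = (\<Sum>b\<in>goods x. of_bool (forms \<Gamma> r (?O b) ?y))"
  proof (rule sum.reindex_cong[of ?O])
    show "inj_on ?O (goods x)"
      using ne occupants_disjoint by (intro inj_onI) (metis Int_absorb)
  qed auto
  also have "\<dots> = (\<Sum>b\<in>goods x. of_bool (forms \<Gamma> \<epsilon> (?O b) v))"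
    by (intro sum.cong refl) (simp add: eq)
  finally show ?thesis .
qed

lemma measurable_eval: "i \<in> I \<Longrightarrow> (\<lambda>v. v i) \<in> borel_measurable (PiM I (\<lambda>_. cube :: (real ^ 'd) measure))"
  using measurable_component_singleton[of i I "\<lambda>_. cube :: (real ^ 'd) measure"] by (simp cong: measurable_cong_sets)

lemma copies_measurable: "copies \<in> borel_measurable P"
  unfolding copies_def[abs_def]
proof (rule borel_measurable_sum)
  fix I assume "I \<in> subs"
  then have "Measurable.pred P (forms \<Gamma> r I)" by (intro forms_measurable) (auto simp: subs_def)
  then show "(\<lambda>x. of_bool (forms \<Gamma> r I x) :: real) \<in> borel_measurable P" by measurable
qed

lemma depends_on_copies: "depends_on copies {1..n}"
  unfolding copies_def
  by (intro depends_onI sum.cong refl arg_cong[where f=of_bool] depends_onD[OF depends_on_forms])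
    (auto simp: subs_def)

lemma depends_on_rest:
  "depends_on (\<lambda>v. rest x (\<lambda>i. sub.R (x i) (v i))) ({1..n} - (\<Union>b\<in>goods x. occupants b x))"
proof (rule depends_onI)
  fix z z' :: "nat \<Rightarrow> real ^ 'd"
  assume eq: "\<And>i. i \<in> {1..n} - (\<Union>b\<in>goods x. occupants b x) \<Longrightarrow> z i = z' i"
  show "rest x (\<lambda>i. sub.R (x i) (z i)) = rest x (\<lambda>i. sub.R (x i) (z' i))"
    unfolding rest_def
  proof (intro sum.cong refl arg_cong[where f=of_bool] depends_onD[OF depends_on_forms])
    fix I i assume I: "I \<in> {I \<in> subs. \<forall>b\<in>goods x. I \<inter> occupants b x = {}}" "i \<in> I"
    then have "i \<in> {1..n} - (\<Union>b\<in>goods x. occupants b x)" by (auto simp: subs_def simp del: One_nat_def)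
    then show "sub.R (x i) (z i) = sub.R (x i) (z' i)" by (simp add: eq)
  qed
qed

lemma refreshed_measurable:
  assumes I: "I \<subseteq> {1..n}" and F: "F \<in> borel_measurable (PiM I (\<lambda>_. cube))" "depends_on F I"
  shows "(\<lambda>v. F (\<lambda>i. sub.R (x i) (v i)) :: 'z::topological_space) \<in> borel_measurable P"
proof -
  have "(\<lambda>v. \<lambda>i\<in>I. sub.R (x i) (v i)) \<in> P \<rightarrow>\<^sub>M PiM I (\<lambda>_. cube)"
  proof (rule measurable_restrict)
    fix i assume "i \<in> I"
    then have "(\<lambda>v. v i) \<in> borel_measurable P" using I by (intro measurable_eval) auto
    from measurable_compose[OF measurable_Pair[OF measurable_const this] sub.measurable_refresh, of "x i"]
    show "(\<lambda>v. sub.R (x i) (v i)) \<in> P \<rightarrow>\<^sub>M cube" by (simp cong: measurable_cong_sets)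
  qed
  from measurable_compose[OF this F(1)]
  have "(\<lambda>v. F (\<lambda>i\<in>I. sub.R (x i) (v i))) \<in> borel_measurable P" .
  moreover have "F (\<lambda>i\<in>I. sub.R (x i) (v i)) = F (\<lambda>i. sub.R (x i) (v i))" for v
    by (rule depends_onD[OF F(2)]) simp
  ultimately show ?thesis by simp
qed

lemma rest_measurable: "(\<lambda>v. rest x (\<lambda>i. sub.R (x i) (v i))) \<in> borel_measurable P"
  unfolding rest_def
proof (rule borel_measurable_sum)
  fix I assume "I \<in> {I \<in> subs. \<forall>b\<in>goods x. I \<inter> occupants b x = {}}"
  then have I: "I \<subseteq> {1..n}" "finite I" by (auto simp: subs_def intro: finite_subset)
  show "(\<lambda>v. of_bool (forms \<Gamma> r I (\<lambda>i. sub.R (x i) (v i))) :: real) \<in> borel_measurable P"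
  proof (rule refreshed_measurable[OF I(1) _ depends_on_comp[OF depends_on_forms]])
    show "(\<lambda>y. of_bool (forms \<Gamma> r I y) :: real) \<in> borel_measurable (PiM I (\<lambda>_. cube :: (real ^ 'd) measure))"
      using measurable_compose[OF forms_measurable[OF order_refl I(2), of r], of "of_bool :: bool \<Rightarrow> real" borel] by simp
  qed
qed

lemma AE_in_cube: "AE v in P. \<forall>i\<in>{1..n}. v i \<in> cbox 0 1"
proof -
  have "AE y in (cube :: (real ^ 'd) measure). y \<in> cbox 0 1"
    unfolding cube_def by (rule AE_uniform_measureI) auto
  then have "AE v in P. v i \<in> cbox 0 1" if "i \<in> {1..n}" for i
    using that by (intro AE_PiM_component prob_space_cube) auto
  then show ?thesis by (simp add: AE_ball_countable)
qed

text \<open>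
  For a fixed sample \<open>x\<close>, the blocks of fresh positions that belong to the good cells and the remaining ones are
  independent, and the count is a sum of functions of these blocks.
\<close>

lemma conditional_char:
  "norm (\<integral>v. cis (\<theta> * copies (\<lambda>i. sub.R (x i) (v i))) \<partial>P) \<le> norm (single_char \<theta>) ^ card (goods x)"
proof -
  let ?F = "\<lambda>b v. cis (\<theta> * of_bool (forms \<Gamma> \<epsilon> (occupants b x) v))"
  let ?G = "\<lambda>v. cis (\<theta> * rest x (\<lambda>i. sub.R (x i) (v i)))"
  let ?O = "\<Union>b\<in>goods x. occupants b x"
  have fin: "finite (goods x)" using finite_B by (simp add: goods_def)
  have Fm: "?F b \<in> borel_measurable P" if b: "b \<in> goods x" for b
  proof -
    have "Measurable.pred P (forms \<Gamma> \<epsilon> (occupants b x))"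
      by (rule forms_measurable) (auto simp: occupants_def)
    then show ?thesis unfolding cis_conv_exp by measurable
  qed
  have Fi: "integrable P (?F b)" if "b \<in> goods x" for b
    using Fm[OF that] by (intro P.integrable_const_bound[where B=1]) auto
  have PFm: "(\<lambda>v. \<Prod>b\<in>goods x. ?F b v) \<in> borel_measurable P"
    by (intro borel_measurable_prod Fm)
  have PFi: "integrable P (\<lambda>v. \<Prod>b\<in>goods x. ?F b v)"
    using PFm by (intro P.integrable_const_bound[where B=1]) (auto simp: prod_norm[symmetric])
  have Gm: "?G \<in> borel_measurable P"
    unfolding cis_conv_exp using rest_measurable[of x] by measurable
  have Gi: "integrable P ?G"
    using Gm by (intro P.integrable_const_bound[where B=1]) auto
  have dF: "depends_on (?F b) (occupants b x)" for b
    by (rule depends_on_comp[OF depends_on_forms])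
  have dPF: "depends_on (\<lambda>v. \<Prod>b\<in>goods x. ?F b v) ?O"
    by (intro depends_onI prod.cong refl depends_onD[OF dF]) blast
  have dG: "depends_on ?G ({1..n} - ?O)"
    by (rule depends_on_comp[OF depends_on_rest])
  have "(\<integral>v. cis (\<theta> * copies (\<lambda>i. sub.R (x i) (v i))) \<partial>P) = (\<integral>v. (\<Prod>b\<in>goods x. ?F b v) * ?G v \<partial>P)"
  proof (rule integral_cong_AE)
    show "AE v in P. cis (\<theta> * copies (\<lambda>i. sub.R (x i) (v i))) = (\<Prod>b\<in>goods x. ?F b v) * ?G v"
      using AE_in_cube
    proof eventually_elim
      case (elim v)
      have cis_sum: "cis (\<Sum>b\<in>A. g b) = (\<Prod>b\<in>A. cis (g b))" if "finite A" for A and g :: "('d \<Rightarrow> nat) \<Rightarrow> real"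
        using that by (induction A) (simp_all add: cis_mult[symmetric])
      have "\<theta> * copies (\<lambda>i. sub.R (x i) (v i)) = (\<Sum>b\<in>goods x. \<theta> * of_bool (forms \<Gamma> \<epsilon> (occupants b x) v))
          + \<theta> * rest x (\<lambda>i. sub.R (x i) (v i))"
        using count_decomposition[of v x] elim by (simp only: distrib_left sum_distrib_left)
      then show ?case by (simp only: cis_mult[symmetric] cis_sum[OF fin])
    qed
    show "(\<lambda>v. cis (\<theta> * copies (\<lambda>i. sub.R (x i) (v i)))) \<in> borel_measurable P"
      unfolding cis_conv_exp using refreshed_measurable[OF order_refl copies_measurable depends_on_copies, of x] by measurable
  qed (use PFm Gm in \<open>rule borel_measurable_times\<close>)
  also have "\<dots> = (\<integral>v. (\<Prod>b\<in>goods x. ?F b v) \<partial>P) * (\<integral>v. ?G v \<partial>P)"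
    by (rule integral_mult_depends_on[OF prob_space_cube _ _ _ dPF dG PFi Gi]) (auto simp: occupants_def)
  also have "(\<integral>v. (\<Prod>b\<in>goods x. ?F b v) \<partial>P) = (\<Prod>b\<in>goods x. \<integral>v. ?F b v \<partial>P)"
    by (rule integral_prod_depends_on[OF prob_space_cube fin _ _ dF Fi])
      (use occupants_disjoint in \<open>auto simp: disjoint_family_on_def occupants_def\<close>)
  also have "\<dots> = (\<Prod>b\<in>goods x. single_char \<theta>)"
    by (intro prod.cong refl single_block occupants_subs)
  finally have eq: "(\<integral>v. cis (\<theta> * copies (\<lambda>i. sub.R (x i) (v i))) \<partial>P) = single_char \<theta> ^ card (goods x) * (\<integral>v. ?G v \<partial>P)"
    by simp
  have "norm (\<integral>v. ?G v \<partial>P) \<le> (\<integral>v. norm (?G v) \<partial>P)" by (rule integral_norm_bound)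
  also have "\<dots> = 1" by (simp add: P.prob_space del: One_nat_def)
  finally show ?thesis
    unfolding eq norm_mult norm_power by (intro mult_left_le) auto
qed

lemma single_prob_bounds: "0 \<le> single_prob" "single_prob \<le> 1"
proof -
  interpret M: prob_space "PiM {1..\<kappa>} (\<lambda>_. cube :: (real ^ 'd) measure)" by (rule prob_space_PiM) (rule prob_space_cube)
  show "0 \<le> single_prob" "single_prob \<le> 1"
    unfolding single_prob_def pattern_prob_def by (rule measure_nonneg, rule M.prob_le_1)
qed

text \<open>
  \<open>\<bar>1 - p + p cis \<theta>\<bar>\<^sup>2 = 1 - 2 p (1 - p) (1 - cos \<theta>)\<close>.
\<close>

lemma norm_single_char:
  "norm (single_char \<theta>) \<le> exp (- (single_prob * (1 - single_prob) * (1 - cos \<theta>)))"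
proof (rule power2_le_imp_le)
  let ?p = single_prob
  have "(norm (single_char \<theta>))\<^sup>2 = (1 - ?p + ?p * cos \<theta>)\<^sup>2 + (?p * sin \<theta>)\<^sup>2"
    by (simp add: single_char_def cmod_power2)
  also have "\<dots> = 1 - 2 * (?p * (1 - ?p) * (1 - cos \<theta>))"
    using sin_cos_squared_add[of \<theta>] by algebra
  also have "\<dots> \<le> exp (- (2 * (?p * (1 - ?p) * (1 - cos \<theta>))))"
    using exp_ge_add_one_self[of "- (2 * (?p * (1 - ?p) * (1 - cos \<theta>)))"] by simp
  also have "\<dots> = (exp (- (?p * (1 - ?p) * (1 - cos \<theta>))))\<^sup>2"
    by (simp flip: exp_double)
  finally show "(norm (single_char \<theta>))\<^sup>2 \<le> (exp (- (?p * (1 - ?p) * (1 - cos \<theta>))))\<^sup>2" .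
qed simp

text \<open>
  Each good cell contributes a factor \<open>\<bar>1 - p + p cis \<theta>\<bar>\<close>. On the event that fewer than half the expected number
  of cells are good, the characteristic function is bounded by 1.
\<close>

theorem norm_char_copies:
  assumes "0 < mean"
  shows "norm (\<integral>x. cis (\<theta> * copies x) \<partial>P) \<le> exp (- (single_prob * (1 - single_prob) * (1 - cos \<theta>) * mean / 2))
     + 4 * (1 / mean + (1 / (1 - width ^ CARD('d)) ^ (2 * \<kappa>) - 1))"
proof -
  define a where "a = single_prob * (1 - single_prob) * (1 - cos \<theta>)"
  have a0: "0 \<le> a" unfolding a_def using single_prob_bounds by (intro mult_nonneg_nonneg) auto
  let ?\<Phi> = "\<lambda>x. cis (\<theta> * copies x)"
  have \<Phi>m: "?\<Phi> \<in> borel_measurable P" unfolding cis_conv_exp using copies_measurable by measurable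
  have \<Phi>d: "depends_on ?\<Phi> {1..n}" by (rule depends_on_comp[OF depends_on_copies])
  have gm: "{x \<in> space P. N x < mean / 2} \<in> sets P" using N_measurable by measurable
  have ind_int: "integrable P (indicat_real {x \<in> space P. N x < mean / 2})"
    by (rule prob_space.integrable_event[OF P.prob_space_axioms gm])
  have card_goods: "real (card (goods x)) = N x" for x
  proof -
    have "N x = of_nat (card (B \<inter> {b. good b x}))"
      unfolding N_def by (subst sum_of_bool_eq) (simp_all add: finite_B)
    also have "B \<inter> {b. good b x} = goods x" by (auto simp: goods_def)
    finally show ?thesis by simp
  qed
  have "(\<integral>x. ?\<Phi> x \<partial>P) = (\<integral>x. (\<integral>v. ?\<Phi> (\<lambda>i. sub.R (x i) (v i)) \<partial>P) \<partial>P)" (is "_ = ?double")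
    by (rule integral_refresh(1)[where F="?\<Phi>" and C=1, OF prob_space_cube sub.refresh_cube \<Phi>m \<Phi>d, symmetric])
      (use n_large \<kappa>_pos in auto)
  then have "norm (\<integral>x. ?\<Phi> x \<partial>P) = norm ?double" by (rule arg_cong)
  also have "\<dots> \<le> (\<integral>x. norm (\<integral>v. ?\<Phi> (\<lambda>i. sub.R (x i) (v i)) \<partial>P) \<partial>P)"
    by (rule integral_norm_bound)
  also have "\<dots> \<le> (\<integral>x. exp (- (a * mean / 2)) + indicator {x \<in> space P. N x < mean / 2} x \<partial>P)"
  proof (rule integral_mono')
    show "integrable P (\<lambda>x. exp (- (a * mean / 2)) + indicator {x \<in> space P. N x < mean / 2} x)"
      by (intro Bochner_Integration.integrable_add ind_int P.integrable_const)
    fix x assume x: "x \<in> space P"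
    have "norm (\<integral>v. ?\<Phi> (\<lambda>i. sub.R (x i) (v i)) \<partial>P) \<le> norm (single_char \<theta>) ^ card (goods x)"
      by (rule conditional_char)
    also have "\<dots> \<le> exp (- a) ^ card (goods x)"
      unfolding a_def by (intro power_mono norm_single_char) auto
    also have "\<dots> = exp (- (a * N x))"
      by (simp add: card_goods[symmetric] mult.commute flip: exp_of_nat_mult)
    also have "\<dots> \<le> exp (- (a * mean / 2)) + indicator {x \<in> space P. N x < mean / 2} x"
    proof (cases "N x < mean / 2")
      case True
      have "0 \<le> N x" by (simp add: card_goods[symmetric])
      then have "exp (- (a * N x)) \<le> 1" using a0 by simp
      then show ?thesis using True x by (simp add: add_increasing)
    next
      case False
      then have "a * (mean / 2) \<le> a * N x" using a0 by (intro mult_left_mono) auto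
      then show ?thesis using False by simp
    qed
    finally show "norm (\<integral>v. ?\<Phi> (\<lambda>i. sub.R (x i) (v i)) \<partial>P)
      \<le> exp (- (a * mean / 2)) + indicator {x \<in> space P. N x < mean / 2} x" .
  qed simp
  also have "\<dots> = exp (- (a * mean / 2)) + P.prob {x \<in> space P. N x < mean / 2}"
    using prob_space.expectation_event[OF P.prob_space_axioms gm]
    by (subst Bochner_Integration.integral_add[OF P.integrable_const ind_int]) (simp only: lebesgue_integral_const P.prob_space scaleR_one)
  also have "\<dots> \<le> exp (- (a * mean / 2)) + 4 * (1 / mean + (1 / (1 - width ^ CARD('d)) ^ (2 * \<kappa>) - 1))"
    using prob_few_good_cells[OF assms] by simp
  finally show ?thesis by (simp add: a_def)
qed

end

section \<open>From characteristic functions to local limits\<close>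

lemma integral_cis_period:
  "(\<integral>s. indicator {- pi..pi} s *\<^sub>R cis (s * real_of_int k) \<partial>lborel) = (if k = 0 then 2 * pi else 0)"
proof (cases "k = 0")
  case True
  have "(\<integral>s. indicator {- pi..pi} s *\<^sub>R (1::complex) \<partial>lborel) = of_real (2 * pi)"
    by (simp add: scaleR_conv_of_real)
  then show ?thesis using True by simp
next
  case False
  let ?a = "real_of_int k"
  have "(\<integral>s. indicator {- pi..pi} s *\<^sub>R (\<i> * of_real ?a * cis (s * ?a)) \<partial>lborel) = cis (pi * ?a) - cis (- pi * ?a)"
  proof (rule integral_FTC_Icc)
    show "continuous_on {- pi..pi} (\<lambda>s. \<i> * of_real ?a * cis (s * ?a))"
      unfolding cis_conv_exp by (intro continuous_intros)
  qed (simp, rule cis_has_vector_derivative)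
  also have "cis (pi * ?a) = cis (- pi * ?a)"
    by (simp add: complex_eq_iff sin_int_times_real mult.commute)
  finally have "\<i> * of_real ?a * (\<integral>s. indicator {- pi..pi} s *\<^sub>R cis (s * ?a) \<partial>lborel) = 0"
    by (simp flip: integral_mult_right_zero add: scaleR_conv_of_real mult_ac)
  then show ?thesis using False by simp
qed

lemma integrable_cis_Icc: "integrable lborel (\<lambda>s. indicator {a..b} s *\<^sub>R cis (s * c))"
  by (rule borel_integrable_atLeastAtMost'[unfolded set_integrable_def])
    (auto intro!: continuous_intros simp: cis_conv_exp)

lemma (in prob_space) fourier_inversion_nat:
  fixes j :: int and u :: real
  assumes X: "X \<in> measurable M (count_space UNIV)" and K: "\<And>x. x \<in> space M \<Longrightarrow> X x \<le> K" and \<tau>: "0 < \<tau>"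
  shows "of_real (2 * pi * \<tau> * prob {x \<in> space M. int (X x) = j})
    = (\<integral>t. indicator {- pi * \<tau>..pi * \<tau>} t *\<^sub>R (cis (- t * ((j - u) / \<tau>)) * expectation (\<lambda>x. cis (t / \<tau> * (real (X x) - u)))) \<partial>lborel)"
proof -
  let ?p = "\<lambda>k. prob {x \<in> space M. X x = k}"
  let ?E = "\<lambda>t. expectation (\<lambda>x. cis (t / \<tau> * (real (X x) - u)))"
  have E: "?E t = (\<Sum>k\<le>K. ?p k *\<^sub>R cis (t / \<tau> * (real k - u)))" for t
    by (rule expectation_bounded_nat[OF X K, where g="\<lambda>k. cis (t / \<tau> * (real k - u))"])
  have "cis (- t * ((j - u) / \<tau>)) * ?E t = (\<Sum>k\<le>K. ?p k *\<^sub>R cis (t / \<tau> * of_int (int k - j)))" for t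
  proof -
    have "cis (- t * ((j - u) / \<tau>)) * cis (t / \<tau> * (real k - u)) = cis (t / \<tau> * of_int (int k - j))" for k
      unfolding cis_mult by (rule arg_cong[where f=cis]) (use \<tau> in \<open>simp add: field_simps\<close>)
    then show ?thesis unfolding E sum_distrib_left by (simp add: mult_scaleR_right)
  qed
  then have "(\<integral>t. indicator {- pi * \<tau>..pi * \<tau>} t *\<^sub>R (cis (- t * ((j - u) / \<tau>)) * ?E t) \<partial>lborel)
     = (\<integral>t. indicator {- pi * \<tau>..pi * \<tau>} t *\<^sub>R (\<Sum>k\<le>K. ?p k *\<^sub>R cis (t / \<tau> * of_int (int k - j))) \<partial>lborel)"
    by simp
  also have "\<dots> = \<bar>\<tau>\<bar> *\<^sub>R (\<integral>s. indicator {- pi * \<tau>..pi * \<tau>} (0 + \<tau> * s) *\<^sub>R (\<Sum>k\<le>K. ?p k *\<^sub>R cis ((0 + \<tau> * s) / \<tau> * of_int (int k - j))) \<partial>lborel)"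
    using \<tau> by (intro lborel_integral_real_affine) auto
  also have "\<dots> = \<tau> *\<^sub>R (\<integral>s. (\<Sum>k\<le>K. ?p k *\<^sub>R (indicator {- pi..pi} s *\<^sub>R cis (s * of_int (int k - j)))) \<partial>lborel)"
  proof -
    have "indicator {- pi * \<tau>..pi * \<tau>} (0 + \<tau> * s) *\<^sub>R (\<Sum>k\<le>K. ?p k *\<^sub>R cis ((0 + \<tau> * s) / \<tau> * of_int (int k - j)))
      = (\<Sum>k\<le>K. ?p k *\<^sub>R (indicator {- pi..pi} s *\<^sub>R cis (s * of_int (int k - j))))" for s
    proof -
      have "(- pi * \<tau> \<le> \<tau> * s) = (- pi \<le> s)" "(\<tau> * s \<le> pi * \<tau>) = (s \<le> pi)"
        using mult_le_cancel_left_pos[OF \<tau>, of "- pi" s] mult_le_cancel_left_pos[OF \<tau>, of s pi] by (simp_all add: mult.commute)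
      then have "indicator {- pi * \<tau>..pi * \<tau>} (0 + \<tau> * s) = (indicator {- pi..pi} s :: real)"
        by (simp add: indicator_def)
      then show ?thesis using \<tau> by (simp add: scaleR_sum_right mult.commute)
    qed
    then show ?thesis using \<tau> by simp
  qed
  also have "(\<integral>s. (\<Sum>k\<le>K. ?p k *\<^sub>R (indicator {- pi..pi} s *\<^sub>R cis (s * of_int (int k - j)))) \<partial>lborel)
      = (\<Sum>k\<le>K. \<integral>s. ?p k *\<^sub>R (indicator {- pi..pi} s *\<^sub>R cis (s * of_int (int k - j))) \<partial>lborel)"
    by (intro Bochner_Integration.integral_sum integrable_scaleR_right integrable_cis_Icc)
  also have "\<dots> = (\<Sum>k\<le>K. ?p k *\<^sub>R (\<integral>s. indicator {- pi..pi} s *\<^sub>R cis (s * of_int (int k - j)) \<partial>lborel))"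
    by (intro sum.cong refl integral_scaleR_right integrable_cis_Icc)
  also have "\<dots> = (\<Sum>k\<le>K. if int k = j then of_real (2 * pi * ?p k) else 0)"
    unfolding integral_cis_period by (intro sum.cong refl) (auto simp: scaleR_conv_of_real)
  also have "\<dots> = of_real (2 * pi * prob {x \<in> space M. int (X x) = j})"
  proof (cases "\<exists>k\<le>K. int k = j")
    case True
    then obtain k where k: "k \<le> K" "j = int k" by auto
    then show ?thesis by simp
  next
    case False
    then have "{x \<in> space M. int (X x) = j} = {}" using K by auto
    then have P0: "prob {x \<in> space M. int (X x) = j} = 0" by (simp only: measure_empty)
    have "(\<Sum>k\<le>K. if int k = j then complex_of_real (2 * pi * ?p k) else 0) = 0"
      using False by (intro sum.neutral) auto
    then show ?thesis unfolding P0 by simp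
  qed
  finally show ?thesis by (simp add: scaleR_conv_of_real mult_ac)
qed

lemma integrable_gauss: "0 < c \<Longrightarrow> integrable lborel (\<lambda>t::real. exp (- c * t\<^sup>2))"
proof -
  assume c: "0 < c"
  define s where "s = 1 / sqrt (2 * c)"
  have s: "0 < s" "s\<^sup>2 = 1 / (2 * c)" using c by (auto simp: s_def power_divide)
  have "integrable lborel (\<lambda>t. sqrt (2 * pi * s\<^sup>2) * normal_density 0 s t)"
    using s by (intro integrable_mult_right integrable_normal_density)
  moreover have "sqrt (2 * pi * s\<^sup>2) * normal_density 0 s t = exp (- c * t\<^sup>2)" for t
    using s c by (simp add: normal_density_def)
  ultimately show ?thesis by simp
qed

lemma gaussian_fourier:
  assumes \<sigma>: "0 < \<sigma>"
  shows "(\<integral>t. cis (- t * y) * of_real (exp (- \<sigma>\<^sup>2 * t\<^sup>2 / 2)) \<partial>lborel) = of_real (2 * pi * (1 / \<sigma> * std_normal_density (y / \<sigma>)))"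
proof -
  have "char std_normal_distribution (- y / \<sigma>) = complex_of_real (exp (- (- y / \<sigma>)\<^sup>2 / 2))"
    by (simp add: char_std_normal_distribution)
  moreover have "char std_normal_distribution (- y / \<sigma>) = (\<integral>x. std_normal_density x *\<^sub>R iexp (- y / \<sigma> * x) \<partial>lborel)"
    unfolding char_def by (subst integral_density) auto
  ultimately have "(\<integral>x. std_normal_density x *\<^sub>R iexp (- y / \<sigma> * x) \<partial>lborel) = of_real (exp (- (y / \<sigma>)\<^sup>2 / 2))"
    by (simp add: power_divide)
  moreover have "(\<integral>x. std_normal_density x *\<^sub>R iexp (- y / \<sigma> * x) \<partial>lborel)
      = \<bar>\<sigma>\<bar> *\<^sub>R (\<integral>t. std_normal_density (0 + \<sigma> * t) *\<^sub>R iexp (- y / \<sigma> * (0 + \<sigma> * t)) \<partial>lborel)"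
    using \<sigma> by (intro lborel_integral_real_affine) auto
  moreover have "std_normal_density (0 + \<sigma> * t) *\<^sub>R iexp (- y / \<sigma> * (0 + \<sigma> * t))
      = (1 / sqrt (2 * pi)) *\<^sub>R (cis (- t * y) * of_real (exp (- \<sigma>\<^sup>2 * t\<^sup>2 / 2)))" for t
  proof -
    have "iexp (- y / \<sigma> * (0 + \<sigma> * t)) = cis (- t * y)"
      using \<sigma> by (simp add: cis_conv_exp mult_ac)
    then show ?thesis
      by (simp add: std_normal_density_def scaleR_conv_of_real power_mult_distrib mult_ac)
  qed
  ultimately have "\<sigma> *\<^sub>R (1 / sqrt (2 * pi)) *\<^sub>R (\<integral>t. cis (- t * y) * of_real (exp (- \<sigma>\<^sup>2 * t\<^sup>2 / 2)) \<partial>lborel)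
      = of_real (exp (- (y / \<sigma>)\<^sup>2 / 2))"
    using \<sigma> by (simp only: integral_scaleR_right abs_of_pos)
  then have *: "of_real (\<sigma> / sqrt (2 * pi)) * (\<integral>t. cis (- t * y) * of_real (exp (- \<sigma>\<^sup>2 * t\<^sup>2 / 2)) \<partial>lborel)
      = complex_of_real (exp (- (y / \<sigma>)\<^sup>2 / 2))"
    by (simp add: scaleR_conv_of_real mult.assoc)
  have "(\<integral>t. cis (- t * y) * of_real (exp (- \<sigma>\<^sup>2 * t\<^sup>2 / 2)) \<partial>lborel)
     = of_real (sqrt (2 * pi) / \<sigma>) * (of_real (\<sigma> / sqrt (2 * pi)) * (\<integral>t. cis (- t * y) * of_real (exp (- \<sigma>\<^sup>2 * t\<^sup>2 / 2)) \<partial>lborel))"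
  proof -
    have "sqrt (2 * pi) / \<sigma> * (\<sigma> / sqrt (2 * pi)) = 1" using \<sigma> by simp
    then show ?thesis by (simp only: mult.assoc[symmetric] of_real_mult[symmetric] of_real_1 mult_1_left)
  qed
  also have "\<dots> = of_real (sqrt (2 * pi) / \<sigma> * exp (- (y / \<sigma>)\<^sup>2 / 2))"
    unfolding * by simp
  also have "sqrt (2 * pi) / \<sigma> * exp (- (y / \<sigma>)\<^sup>2 / 2) = 2 * pi * (1 / \<sigma> * std_normal_density (y / \<sigma>))"
    using \<sigma> by (simp add: std_normal_density_def field_simps flip: power2_eq_square) 
  finally show ?thesis .
qed

lemma integrable_cauchy: "integrable lborel (\<lambda>t::real. 1 / (1 + t\<^sup>2))"
  using integrable_inverse_1_plus_square by (simp add: set_integrable_def inverse_eq_divide)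

lemma (in prob_space) local_error_le:
  fixes j :: int and u :: real
  assumes X: "X \<in> measurable M (count_space UNIV)" and K: "\<And>x. x \<in> space M \<Longrightarrow> X x \<le> K"
    and \<tau>: "0 < \<tau>" and \<sigma>: "0 < \<sigma>"
  defines "D \<equiv> \<lambda>t. indicator {- pi * \<tau>..pi * \<tau>} t *\<^sub>R expectation (\<lambda>x. cis (t / \<tau> * (real (X x) - u)))
      - of_real (exp (- \<sigma>\<^sup>2 * t\<^sup>2 / 2))"
  shows "integrable lborel D"
    and "\<bar>\<tau> * prob {x \<in> space M. int (X x) = j} - 1 / \<sigma> * std_normal_density ((j - u) / (\<sigma> * \<tau>))\<bar>
      \<le> (\<integral>t. norm (D t) \<partial>lborel)"
proof -
  let ?E = "\<lambda>t. expectation (\<lambda>x. cis (t / \<tau> * (real (X x) - u)))"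
  let ?y = "(real_of_int j - u) / \<tau>"
  have E: "?E t = (\<Sum>k\<le>K. prob {x \<in> space M. X x = k} *\<^sub>R cis (t * ((real k - u) / \<tau>)))" for t
    using expectation_bounded_nat[OF X K, of "\<lambda>k. cis (t / \<tau> * (real k - u))"] by simp
  have Ei: "integrable lborel (\<lambda>t. indicator {- pi * \<tau>..pi * \<tau>} t *\<^sub>R ?E t)"
    unfolding E scaleR_sum_right scaleR_left_commute[of "indicator _ _"]
    by (intro Bochner_Integration.integrable_sum integrable_scaleR_right integrable_cis_Icc)
  have "integrable lborel (\<lambda>t. exp (- (\<sigma>\<^sup>2 / 2) * t\<^sup>2))" using \<sigma> by (intro integrable_gauss) simp
  then have Gi: "integrable lborel (\<lambda>t. complex_of_real (exp (- \<sigma>\<^sup>2 * t\<^sup>2 / 2)))"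
    by (intro integrable_of_real) simp
  show Di: "integrable lborel D" unfolding D_def using Ei Gi by (rule Bochner_Integration.integrable_diff)
  have rot: "integrable lborel (\<lambda>t. cis (- t * ?y) * g t)" if "integrable lborel g" for g :: "real \<Rightarrow> complex"
  proof (rule Bochner_Integration.integrable_bound[OF that])
    have "(\<lambda>t. cis (- t * ?y)) \<in> borel_measurable lborel" unfolding cis_conv_exp by measurable
    then show "(\<lambda>t. cis (- t * ?y) * g t) \<in> borel_measurable lborel" using that by measurable
  qed (simp add: norm_mult)
  have "of_real (2 * pi * \<tau> * prob {x \<in> space M. int (X x) = j})
    = (\<integral>t. cis (- t * ?y) * (indicator {- pi * \<tau>..pi * \<tau>} t *\<^sub>R ?E t) \<partial>lborel)"
    by (rule trans[OF fourier_inversion_nat[OF X K \<tau>, of j u]])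
      (assumption, rule Bochner_Integration.integral_cong[OF refl], rule mult_scaleR_right[symmetric])
  moreover have "of_real (2 * pi * (1 / \<sigma> * std_normal_density (?y / \<sigma>)))
    = (\<integral>t. cis (- t * ?y) * of_real (exp (- \<sigma>\<^sup>2 * t\<^sup>2 / 2)) \<partial>lborel)"
    by (rule gaussian_fourier[OF \<sigma>, symmetric])
  moreover have "(\<integral>t. cis (- t * ?y) * D t \<partial>lborel)
    = (\<integral>t. cis (- t * ?y) * (indicator {- pi * \<tau>..pi * \<tau>} t *\<^sub>R ?E t) \<partial>lborel)
      - (\<integral>t. cis (- t * ?y) * of_real (exp (- \<sigma>\<^sup>2 * t\<^sup>2 / 2)) \<partial>lborel)"
    by (rule trans[OF _ Bochner_Integration.integral_diff[OF rot[OF Ei] rot[OF Gi]]],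
        rule Bochner_Integration.integral_cong[OF refl]) (simp only: D_def right_diff_distrib[of "cis _"])
  ultimately have "complex_of_real (2 * pi * \<tau> * prob {x \<in> space M. int (X x) = j}) - of_real (2 * pi * (1 / \<sigma> * std_normal_density (?y / \<sigma>)))
    = (\<integral>t. cis (- t * ?y) * D t \<partial>lborel)"
    by (simp only:)
  then have "norm (complex_of_real (2 * pi * (\<tau> * prob {x \<in> space M. int (X x) = j} - 1 / \<sigma> * std_normal_density (?y / \<sigma>))))
     = norm (\<integral>t. cis (- t * ?y) * D t \<partial>lborel)"
    by (intro arg_cong[where f=norm]) (simp add: algebra_simps)
  also have "\<dots> \<le> (\<integral>t. norm (cis (- t * ?y) * D t) \<partial>lborel)" by (rule integral_norm_bound)
  also have "\<dots> = (\<integral>t. norm (D t) \<partial>lborel)" by (simp add: norm_mult)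
  finally have *: "2 * pi * \<bar>\<tau> * prob {x \<in> space M. int (X x) = j} - 1 / \<sigma> * std_normal_density (?y / \<sigma>)\<bar>
      \<le> (\<integral>t. norm (D t) \<partial>lborel)"
    unfolding norm_of_real abs_mult by simp
  have "1 * \<bar>\<tau> * prob {x \<in> space M. int (X x) = j} - 1 / \<sigma> * std_normal_density (?y / \<sigma>)\<bar>
     \<le> 2 * pi * \<bar>\<tau> * prob {x \<in> space M. int (X x) = j} - 1 / \<sigma> * std_normal_density (?y / \<sigma>)\<bar>"
    using pi_ge_two by (intro mult_right_mono) auto
  with * show "\<bar>\<tau> * prob {x \<in> space M. int (X x) = j} - 1 / \<sigma> * std_normal_density ((j - u) / (\<sigma> * \<tau>))\<bar>
      \<le> (\<integral>t. norm (D t) \<partial>lborel)"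
    by (simp add: mult.commute)
qed

text \<open>
  The hypothesis \<open>bound\<close> has the term \<open>C / \<tau>\<^sup>2\<close> since a smoothing argument may fail on an event of that
  probability. The range of \<open>t\<close> has length \<open>2 \<pi> \<tau>\<close>, so this is integrable uniformly in \<open>n\<close>.
\<close>

theorem (in prob_space) local_limit_from_char:
  fixes X :: "nat \<Rightarrow> 'a \<Rightarrow> nat" and u \<tau> :: "nat \<Rightarrow> real"
  defines "\<phi> \<equiv> \<lambda>n t. expectation (\<lambda>x. cis (t / \<tau> n * (real (X n x) - u n)))"
  assumes X: "\<And>n. X n \<in> measurable M (count_space UNIV)" and K: "\<And>n x. x \<in> space M \<Longrightarrow> X n x \<le> K n"
    and \<tau>: "filterlim \<tau> at_top sequentially" and \<sigma>: "0 < \<sigma>" and c: "0 < c" and C: "0 \<le> C"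
    and lim: "\<And>t. (\<lambda>n. \<phi> n t) \<longlonglongrightarrow> of_real (exp (- \<sigma>\<^sup>2 * t\<^sup>2 / 2))"
    and bound: "eventually (\<lambda>n. \<forall>t. \<bar>t\<bar> \<le> pi * \<tau> n \<longrightarrow> norm (\<phi> n t) \<le> exp (- c * t\<^sup>2) + C / (\<tau> n)\<^sup>2) sequentially"
  shows "(\<lambda>n. SUP j::int. \<bar>\<tau> n * prob {x \<in> space M. int (X n x) = j}
      - 1 / \<sigma> * std_normal_density ((j - u n) / (\<sigma> * \<tau> n))\<bar>) \<longlonglongrightarrow> 0"
proof -
  define D where "D n t = indicator {- pi * \<tau> n..pi * \<tau> n} t *\<^sub>R \<phi> n t - of_real (exp (- \<sigma>\<^sup>2 * t\<^sup>2 / 2))" for n t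
  define err where "err n j = \<bar>\<tau> n * prob {x \<in> space M. int (X n x) = j}
      - 1 / \<sigma> * std_normal_density ((j - u n) / (\<sigma> * \<tau> n))\<bar>" for n and j :: int
  have "eventually (\<lambda>n. 1 \<le> \<tau> n) sequentially" using \<tau> by (simp add: filterlim_at_top)
  with bound have "eventually (\<lambda>n. 1 \<le> \<tau> n \<and> (\<forall>t. \<bar>t\<bar> \<le> pi * \<tau> n \<longrightarrow> norm (\<phi> n t) \<le> exp (- c * t\<^sup>2) + C / (\<tau> n)\<^sup>2)) sequentially"
    by (rule eventually_conj[rotated])
  then obtain n0 where n0: "\<And>n. n \<ge> n0 \<Longrightarrow> 1 \<le> \<tau> n"
    "\<And>n t. n \<ge> n0 \<Longrightarrow> \<bar>t\<bar> \<le> pi * \<tau> n \<Longrightarrow> norm (\<phi> n t) \<le> exp (- c * t\<^sup>2) + C / (\<tau> n)\<^sup>2"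
    unfolding eventually_sequentially by blast
  \<comment> \<open>An integrable majorant that absorbs the term \<open>C / \<tau>\<^sup>2\<close>.\<close>
  define w where "w t = exp (- c * t\<^sup>2) + C * (1 + pi\<^sup>2) * (1 / (1 + t\<^sup>2)) + exp (- (\<sigma>\<^sup>2 / 2) * t\<^sup>2)" for t :: real
  have w: "integrable lborel w"
    unfolding w_def using c \<sigma>
    by (intro Bochner_Integration.integrable_add integrable_gauss integrable_mult_right integrable_cauchy) auto
  have D_int: "integrable lborel (D n)" if "n \<ge> n0" for n
    using local_error_le(1)[OF X K _ \<sigma>, of "\<tau> n" n "u n"] n0(1)[OF that] unfolding D_def \<phi>_def by simp
  have D_le: "norm (D n t) \<le> w t" if n: "n \<ge> n0" for n t
  proof -
    have nn: "0 \<le> C * (1 + pi\<^sup>2) * (1 / (1 + t\<^sup>2))" using C by simp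
    have "norm (indicator {- pi * \<tau> n..pi * \<tau> n} t *\<^sub>R \<phi> n t) \<le> exp (- c * t\<^sup>2) + C * (1 + pi\<^sup>2) * (1 / (1 + t\<^sup>2))"
    proof (cases "\<bar>t\<bar> \<le> pi * \<tau> n")
      case True
      have "t\<^sup>2 \<le> (pi * \<tau> n)\<^sup>2" using power_mono[OF True, of 2] by simp
      moreover have "1 \<le> (\<tau> n)\<^sup>2" using n0(1)[OF n] by (simp add: one_le_power)
      ultimately have "1 + t\<^sup>2 \<le> (1 + pi\<^sup>2) * (\<tau> n)\<^sup>2" by (simp add: distrib_right power_mult_distrib)
      then have "1 / (\<tau> n)\<^sup>2 \<le> (1 + pi\<^sup>2) * (1 / (1 + t\<^sup>2))"
        using n0(1)[OF n] by (simp add: divide_simps add_pos_nonneg)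
      then have "C * (1 / (\<tau> n)\<^sup>2) \<le> C * ((1 + pi\<^sup>2) * (1 / (1 + t\<^sup>2)))" using C by (rule mult_left_mono)
      then show ?thesis using n0(2)[OF n True] True nn by (auto simp: indicator_def)
    next
      case False
      then have "t \<notin> {- pi * \<tau> n..pi * \<tau> n}" by (auto simp: abs_le_iff)
      then show ?thesis using nn by (simp add: add_nonneg_nonneg)
    qed
    moreover have "norm (D n t) \<le> norm (indicator {- pi * \<tau> n..pi * \<tau> n} t *\<^sub>R \<phi> n t) + norm (complex_of_real (exp (- \<sigma>\<^sup>2 * t\<^sup>2 / 2)))"
      unfolding D_def by (rule norm_triangle_ineq4)
    ultimately show ?thesis by (simp add: w_def)
  qed
  have D_lim: "(\<lambda>n. D n t) \<longlonglongrightarrow> 0" for t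
  proof -
    have "eventually (\<lambda>n. \<bar>t\<bar> / pi \<le> \<tau> n) sequentially" using \<tau> by (simp add: filterlim_at_top)
    then have "eventually (\<lambda>n. \<phi> n t - of_real (exp (- \<sigma>\<^sup>2 * t\<^sup>2 / 2)) = D n t) sequentially"
    proof eventually_elim
      case (elim n)
      then have "\<bar>t\<bar> \<le> pi * \<tau> n" by (simp add: divide_le_eq mult.commute)
      then have "t \<in> {- pi * \<tau> n..pi * \<tau> n}" by (auto simp: abs_le_iff)
      then show ?case by (simp add: D_def)
    qed
    moreover have "(\<lambda>n. \<phi> n t - of_real (exp (- \<sigma>\<^sup>2 * t\<^sup>2 / 2))) \<longlonglongrightarrow> 0"
      by (rule LIM_zero[OF lim])
    ultimately show ?thesis by (rule Lim_transform_eventually[rotated])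
  qed
  have int_lim: "(\<lambda>n. \<integral>t. norm (D (n + n0) t) \<partial>lborel) \<longlonglongrightarrow> (\<integral>t. 0 \<partial>(lborel :: real measure))"
  proof (rule integral_dominated_convergence[where w=w])
    show "AE t in lborel. (\<lambda>n. norm (D (n + n0) t)) \<longlonglongrightarrow> 0"
      using LIMSEQ_ignore_initial_segment[OF D_lim] by (intro AE_I2 tendsto_norm_zero)
    show "(\<lambda>t. norm (D (n + n0) t)) \<in> borel_measurable lborel" for n
      using D_int[of "n + n0"] by auto
  qed (use w D_le in auto)
  have err_le: "err n j \<le> (\<integral>t. norm (D n t) \<partial>lborel)" if "n \<ge> n0" for n j
    using local_error_le(2)[OF X K _ \<sigma>, of "\<tau> n" n j "u n"] n0(1)[OF that] unfolding D_def \<phi>_def err_def by simp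
  have "(\<lambda>n. SUP j. err (n + n0) j) \<longlonglongrightarrow> 0"
  proof (rule tendsto_sandwich[OF _ _ tendsto_const])
    show "(\<lambda>n. \<integral>t. norm (D (n + n0) t) \<partial>lborel) \<longlonglongrightarrow> 0" using int_lim by simp
    show "eventually (\<lambda>n. (SUP j. err (n + n0) j) \<le> (\<integral>t. norm (D (n + n0) t) \<partial>lborel)) sequentially"
      by (intro always_eventually allI cSUP_least err_le) auto
    show "eventually (\<lambda>n. 0 \<le> (SUP j. err (n + n0) j)) sequentially"
    proof (intro always_eventually allI)
      fix n
      have "0 \<le> err (n + n0) 0" by (simp add: err_def)
      also have "\<dots> \<le> (SUP j. err (n + n0) j)"
        by (rule cSUP_upper[OF UNIV_I bdd_aboveI2[OF err_le]]) simp
      finally show "0 \<le> (SUP j. err (n + n0) j)" .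
    qed
  qed
  then have "(\<lambda>n. SUP j. err n j) \<longlonglongrightarrow> 0" by (rule LIMSEQ_offset)
  then show ?thesis unfolding err_def .
qed

section \<open>A radius at which the pattern is neither impossible nor certain\<close>

text \<open>
  With positive probability all points fall into the subcube \<open>[0, 1 / L]\<^sup>d\<close>; given that, they form the graph
  at radius \<open>\<epsilon>\<close> with the probability that uniform points in the unit cube do so at radius \<open>L \<epsilon>\<close>.
\<close>

lemma pattern_prob_shrink:
  assumes fin: "finite (pverts \<Gamma>)" and \<kappa>: "1 \<le> \<kappa>" and L: "1 \<le> L" and pos: "0 < pattern_prob \<Gamma> \<kappa> TYPE('d::finite) (L * \<epsilon>)"
  shows "0 < pattern_prob \<Gamma> \<kappa> TYPE('d) \<epsilon>"
proof -
  let ?\<mu> = "cube :: (real ^ 'd) measure" and ?l = "1 / L"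
  let ?P = "PiM {1..\<kappa>} (\<lambda>_. ?\<mu>)"
  interpret P: prob_space ?P by (rule prob_space_PiM) (rule prob_space_cube)
  interpret C: prob_space ?\<mu> by (rule prob_space_cube)
  have l1: "?l \<le> 1" using L by simp
  have "cbox 0 (0 + ?l *\<^sub>R 1) \<subseteq> cbox 0 (1 :: real ^ 'd)"
  proof
    fix x :: "real ^ 'd" assume "x \<in> cbox 0 (0 + ?l *\<^sub>R 1)"
    then have "0 \<le> x $ i \<and> x $ i \<le> ?l" for i by (simp add: mem_box_cart)
    then have "0 \<le> x $ i \<and> x $ i \<le> 1" for i using l1 order_trans by blast
    then show "x \<in> cbox 0 1" by (simp add: mem_box_cart)
  qed
  then interpret sub: subcubes "{()}" "\<lambda>_. 0 :: real ^ 'd" ?l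
    by unfold_locales (use L in \<open>auto simp: disjoint_family_on_def\<close>)
  have pm: "Measurable.pred ?P (forms \<Gamma> a {1..\<kappa>})" for a
    by (rule pred_forms[OF fin]) auto
  define F where "F x = (of_bool (forms \<Gamma> \<epsilon> {1..\<kappa>} x) :: real)" for x :: "nat \<Rightarrow> real ^ 'd"
  have Fm: "F \<in> borel_measurable ?P" unfolding F_def[abs_def] using pm by measurable
  have Fd: "depends_on F {1..\<kappa>}" unfolding F_def[abs_def] by (rule depends_on_comp[OF depends_on_forms])
  have Fb: "norm (F x) \<le> 1" for x by (simp add: F_def)
  have ne: "{1..\<kappa>} \<noteq> {}" using \<kappa> by auto
  note ref = integral_refresh[OF prob_space_cube sub.refresh_cube Fm Fd Fb ne]
  define g where "g x = (\<integral>v. F (\<lambda>i. sub.R (x i) (v i)) \<partial>?P)" for x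
  let ?q = "pattern_prob \<Gamma> \<kappa> TYPE('d) (L * \<epsilon>)"
  have scaled: "g x = ?q" if x: "\<And>i. i \<in> {1..\<kappa>} \<Longrightarrow> x i \<in> sub.subcube ()" for x
  proof -
    have "F (\<lambda>i. sub.R (x i) (v i)) = of_bool (forms \<Gamma> (L * \<epsilon>) {1..\<kappa>} v)" for v
    proof -
      have "F (\<lambda>i. sub.R (x i) (v i)) = F (\<lambda>i. 0 + ?l *\<^sub>R v i)"
        by (rule depends_onD[OF Fd], rule sub.refresh_in) (use x in auto)
      then show ?thesis using L forms_scale[of ?l \<Gamma> \<epsilon> "{1..\<kappa>}" 0 v] by (simp add: F_def mult.commute)
    qed
    then show ?thesis
      unfolding g_def pattern_prob_def by (simp only: integral_of_bool_eq_prob[OF P.prob_space_axioms pm])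
  qed
  have lower: "(\<Prod>i\<in>{1..\<kappa>}. indicat_real (sub.subcube ()) (x i)) * ?q \<le> g x" for x
  proof (cases "\<forall>i\<in>{1..\<kappa>}. x i \<in> sub.subcube ()")
    case True
    then have "(\<Prod>i\<in>{1..\<kappa>}. indicat_real (sub.subcube ()) (x i)) = 1" by (intro prod.neutral) auto
    with scaled[of x] True show ?thesis by (simp only: mult_1_left order_refl)
  next
    case False
    then obtain i where "i \<in> {1..\<kappa>}" "x i \<notin> sub.subcube ()" by blast
    then have "(\<Prod>i\<in>{1..\<kappa>}. indicat_real (sub.subcube ()) (x i)) = 0"
      by (intro prod_zero bexI[of _ i]) (simp_all del: One_nat_def)
    moreover have "0 \<le> g x" unfolding g_def F_def by (intro Bochner_Integration.integral_nonneg) simp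
    ultimately show ?thesis by (simp only: mult_zero_left)
  qed
  have ci: "integrable ?\<mu> (indicat_real (sub.subcube ()))" by (rule C.integrable_event) simp
  have "C.prob (sub.subcube ()) = ?l ^ CARD('d)"
    using sub.emeasure_subcube[of "()"] L by (simp add: measure_def)
  then have "(\<integral>y. indicat_real (sub.subcube ()) y \<partial>?\<mu>) = ?l ^ CARD('d)"
    by (subst C.expectation_event) simp_all
  then have prod: "(\<integral>x. (\<Prod>i\<in>{1..\<kappa>}. indicat_real (sub.subcube ()) (x i)) \<partial>?P) = (?l ^ CARD('d)) ^ \<kappa>"
  proof -
    interpret product_sigma_finite "\<lambda>_. ?\<mu>" by standard
    have "(\<integral>x. (\<Prod>i\<in>{1..\<kappa>}. indicat_real (sub.subcube ()) (x i)) \<partial>?P) = (\<Prod>i\<in>{1..\<kappa>}. \<integral>y. indicat_real (sub.subcube ()) y \<partial>?\<mu>)"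
      using ci by (intro product_integral_prod) auto
    also have "\<dots> = (\<Prod>i\<in>{1..\<kappa>}. ?l ^ CARD('d))"
      by (simp only: \<open>(\<integral>y. indicat_real (sub.subcube ()) y \<partial>?\<mu>) = ?l ^ CARD('d)\<close>)
    finally show ?thesis by simp
  qed
  have "0 < (?l ^ CARD('d)) ^ \<kappa> * ?q" using L pos by simp
  also have "\<dots> = (\<integral>x. (\<Prod>i\<in>{1..\<kappa>}. indicat_real (sub.subcube ()) (x i)) * ?q \<partial>?P)"
    unfolding prod[symmetric] by (rule integral_mult_left_zero[symmetric])
  also have "\<dots> \<le> (\<integral>x. g x \<partial>?P)"
  proof (rule integral_mono')
    show "integrable ?P g" unfolding g_def using ref(2) .
    show "0 \<le> g x" for x unfolding g_def F_def by (intro Bochner_Integration.integral_nonneg) simp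
  qed (rule lower)
  also have "\<dots> = (\<integral>x. F x \<partial>?P)" unfolding g_def by (rule ref(1))
  also have "\<dots> = pattern_prob \<Gamma> \<kappa> TYPE('d) \<epsilon>"
    unfolding F_def pattern_prob_def by (rule integral_of_bool_eq_prob[OF P.prob_space_axioms pm])
  finally show ?thesis .
qed

lemma pred_close: "Measurable.pred (cube \<Otimes>\<^sub>M cube) (\<lambda>(x, y). norm (y - x :: real ^ 'd) \<le> R)"
  unfolding case_prod_unfold by (rule measurable_cube_pair) measurable

lemma prob_close_le:
  fixes V :: "nat set"
  assumes "finite V" "i \<in> V" "j \<in> V" "i \<noteq> j" "0 \<le> R"
  shows "emeasure (PiM V (\<lambda>_. cube :: (real ^ 'd) measure)) {x \<in> space (PiM V (\<lambda>_. cube)). norm (x j - x i) \<le> R}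
    \<le> ennreal ((2 * R) ^ CARD('d))"
proof -
  let ?P = "PiM V (\<lambda>_. cube :: (real ^ 'd) measure)"
  interpret P: prob_space ?P by (rule prob_space_PiM) (rule prob_space_cube)
  let ?A = "{x \<in> space ?P. norm (x j - x i) \<le> R}"
  have "(\<lambda>x. (x i, x j)) \<in> ?P \<rightarrow>\<^sub>M cube \<Otimes>\<^sub>M cube" using assms by (intro measurable_Pair measurable_component_singleton)
  from measurable_compose[OF this pred_close[of R]] have "Measurable.pred ?P (\<lambda>x. norm (x j - x i) \<le> R)" by simp
  then have A: "?A \<in> sets ?P" by (simp add: pred_def)
  have "emeasure ?P ?A = (\<integral>\<^sup>+x. indicator ?A x \<partial>?P)" using A by simp
  also have "\<dots> = (\<integral>\<^sup>+x. 1 * of_bool (norm (x j - x i) \<le> R) \<partial>?P)"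
    by (intro nn_integral_cong) (auto simp: indicator_def)
  also have "\<dots> \<le> ennreal ((2 * R) ^ CARD('d)) * (\<integral>\<^sup>+x. 1 \<partial>?P)"
    by (rule nn_integral_peel[OF prob_space_cube _ _ _ _ _ _ pred_close])
      (use assms emeasure_cube_ball[of R] in \<open>auto simp: depends_on_def\<close>)
  finally show ?thesis by (simp add: P.emeasure_space_1)
qed

lemma pattern_prob_le:
  assumes \<Gamma>: "pair_graph \<Gamma>" "Digraph_Component.connected (with_proj \<Gamma>)" and \<kappa>: "2 \<le> \<kappa>" and \<epsilon>: "0 \<le> \<epsilon>"
  shows "pattern_prob \<Gamma> \<kappa> TYPE('d::finite) \<epsilon> \<le> (2 * (real (card (parcs \<Gamma>)) * \<epsilon>)) ^ CARD('d)"
proof -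
  let ?P = "PiM {1..\<kappa>} (\<lambda>_. cube :: (real ^ 'd) measure)" and ?R = "real (card (parcs \<Gamma>)) * \<epsilon>"
  interpret P: prob_space ?P by (rule prob_space_PiM) (rule prob_space_cube)
  have "(\<lambda>x. (x 1, x 2)) \<in> ?P \<rightarrow>\<^sub>M cube \<Otimes>\<^sub>M cube" using \<kappa> by (intro measurable_Pair measurable_component_singleton) auto
  from measurable_compose[OF this pred_close[of ?R]] have "Measurable.pred ?P (\<lambda>x. norm (x 2 - x 1) \<le> ?R)" by simp
  then have A: "{x \<in> space ?P. norm (x 2 - x 1) \<le> ?R} \<in> sets ?P" by (simp add: pred_def)
  have "pattern_prob \<Gamma> \<kappa> TYPE('d) \<epsilon> \<le> P.prob {x \<in> space ?P. norm (x 2 - x 1) \<le> ?R}"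
    unfolding pattern_prob_def
  proof (rule P.finite_measure_mono[OF _ A], safe)
    fix x :: "nat \<Rightarrow> real ^ 'd" assume "forms \<Gamma> \<epsilon> {1..\<kappa>} x"
    from forms_norm_le[OF \<Gamma> this _ _ \<epsilon>, of 1 2] \<kappa> show "norm (x 2 - x 1) \<le> ?R" by simp
  qed
  moreover have "ennreal (P.prob {x \<in> space ?P. norm (x 2 - x 1) \<le> ?R}) \<le> ennreal ((2 * ?R) ^ CARD('d))"
    unfolding P.emeasure_eq_measure[symmetric] using \<kappa> \<epsilon> by (intro prob_close_le) auto
  ultimately show ?thesis using \<epsilon> by simp
qed

section \<open>Elementary estimates\<close>

lemma one_minus_cos_ge:
  fixes x :: real
  assumes "\<bar>x\<bar> \<le> pi"
  shows "x\<^sup>2 / 16 \<le> 1 - cos x"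
proof -
  obtain t where "cos x = (\<Sum>k<4. cos_coeff k * x ^ k) + (cos (t + 1/2 * real 4 * pi) / fact 4) * x ^ 4"
    using Maclaurin_cos_expansion[of x 4] by blast
  moreover have "(\<Sum>k<4. cos_coeff k * x ^ k) = 1 - x\<^sup>2 / 2"
  proof -
    have "{..<4} = {0, 1, 2, 3 :: nat}" by auto
    moreover have "cos_coeff 0 = 1" "cos_coeff 1 = 0" "cos_coeff 2 = - 1 / 2" "cos_coeff 3 = 0"
      by (simp_all add: cos_coeff_def)
    ultimately show ?thesis by simp
  qed
  moreover have "cos (t + 1/2 * real 4 * pi) * x ^ 4 \<le> 1 * x ^ 4"
    by (intro mult_right_mono) auto
  ultimately have "cos x \<le> 1 - x\<^sup>2 / 2 + x ^ 4 / 24" by (simp add: fact_numeral)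
  moreover have "x\<^sup>2 \<le> (3.2)\<^sup>2" using power_mono[OF order_trans[OF assms, of "3.2"], of 2] pi_approx by simp
  then have "x\<^sup>2 * x\<^sup>2 \<le> (3.2)\<^sup>2 * x\<^sup>2" by (intro mult_right_mono) auto
  then have "x ^ 4 \<le> 256 / 25 * x\<^sup>2" by (simp add: power4_eq_xxxx power2_eq_square)
  ultimately show ?thesis using zero_le_power2[of x] by linarith
qed

lemma exp_le_one_minus:
  fixes x :: real
  assumes "0 \<le> x" "x \<le> 1 / 2"
  shows "exp (- 2 * x) \<le> 1 - x"
proof -
  have "x * x \<le> (1 / 2) * x" using assms by (intro mult_right_mono) auto
  then have "- 2 * x \<le> - x - 2 * x\<^sup>2" by (simp add: power2_eq_square)
  also have "\<dots> \<le> ln (1 - x)" by (rule ln_one_minus_pos_lower_bound[OF assms])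
  finally show ?thesis using assms by (simp add: ln_ge_iff)
qed

lemma inverse_power_le:
  fixes x :: real
  assumes "0 \<le> x" "x \<le> 1 / 2"
  shows "1 / (1 - x) ^ k - 1 \<le> 2 ^ k * real k * x"
proof -
  have bern: "1 - (1 - x) ^ k \<le> real k * x"
    using Bernoulli_inequality[of "- x" k] assms by simp
  have half: "(1 / 2) ^ k \<le> (1 - x) ^ k" using assms by (intro power_mono) auto
  have pos: "0 < (1 - x) ^ k" using assms by simp
  have "1 / (1 - x) ^ k - 1 = (1 - (1 - x) ^ k) * (1 / (1 - x) ^ k)" using pos assms by (auto simp: diff_divide_distrib)
  also have "\<dots> \<le> (real k * x) * (1 / (1 / 2) ^ k)"
    using bern half pos assms by (intro mult_mono divide_left_mono) auto
  also have "\<dots> = 2 ^ k * real k * x" by (simp add: power_divide)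
  finally show ?thesis .
qed

context grid_cells begin

lemma width_power_le: "width ^ CARD('d) \<le> 1 / 2"
proof -
  have "width ^ CARD('d) \<le> width ^ 1" using width_le width_pos by (intro power_decreasing) auto
  then show ?thesis using width_le by simp
qed

text \<open>
  There are of order \<open>width ^ (- d)\<close> cells, a given cell has \<open>\<kappa>\<close> points in its core with probability of order
  \<open>(n r ^ d) ^ \<kappa>\<close>, and as \<open>n r ^ d\<close> stays bounded it has no further points with probability bounded
  away from 0.
\<close>

lemma mean_ge:
  assumes B0: "real n * r ^ CARD('d) \<le> B0"
  defines "\<alpha> \<equiv> 1 / \<epsilon> + 2 * (card (parcs \<Gamma>) + 1)"
  shows "(1 / (2 * \<alpha>)) ^ CARD('d) * (1 / \<kappa>) ^ \<kappa> * ((1 / \<epsilon>) ^ CARD('d)) ^ \<kappa> * exp (- 2 * (\<alpha> ^ CARD('d) * B0))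
     * (real n * (real n * r ^ CARD('d)) ^ (\<kappa> - 1)) \<le> mean"
proof -
  let ?d = "CARD('d)" and ?Q = "width ^ CARD('d)"
  have \<alpha>: "0 < \<alpha>" unfolding \<alpha>_def using \<epsilon>_pos by (simp add: add_pos_nonneg)
  have w: "width = r * \<alpha>" unfolding width_eq \<alpha>_def ..
  have cards: "(1 / (2 * width)) ^ ?d \<le> real (card B)"
    unfolding card_B using K_bounds(2) width_pos by (simp add: power_mono)
  have binom: "(real n / real \<kappa>) ^ \<kappa> \<le> real (n choose \<kappa>)"
    using n_large by (intro binomial_ge_n_over_k_pow_k) auto
  have Q: "0 \<le> ?Q" "?Q \<le> 1 / 2" using width_pos width_power_le by auto
  have nQ: "real n * ?Q \<le> \<alpha> ^ ?d * B0"
    using mult_left_mono[OF B0, of "\<alpha> ^ ?d"] \<alpha> by (simp add: w power_mult_distrib mult_ac)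
  have "exp (- 2 * (\<alpha> ^ ?d * B0)) \<le> exp (real n * (- 2 * ?Q))" using nQ by simp
  also have "\<dots> = exp (- 2 * ?Q) ^ n" by (rule exp_of_nat_mult)
  also have "\<dots> \<le> (1 - ?Q) ^ n" by (intro power_mono exp_le_one_minus Q) auto
  also have "\<dots> \<le> (1 - ?Q) ^ (n - \<kappa>)" using Q by (intro power_decreasing) auto
  finally have rest: "exp (- 2 * (\<alpha> ^ ?d * B0)) \<le> (1 - ?Q) ^ (n - \<kappa>)" .
  have lower: "(1 / (2 * width)) ^ ?d * ((real n / real \<kappa>) ^ \<kappa> * (side ^ ?d) ^ \<kappa> * exp (- 2 * (\<alpha> ^ ?d * B0))) \<le> mean"
    unfolding mean_def cell_prob_def
    using side_pos width_pos Q
    by (intro mult_mono cards binom rest order_refl mult_nonneg_nonneg) auto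
  have eq: "(1 / (2 * width)) ^ ?d * ((real n / real \<kappa>) ^ \<kappa> * (side ^ ?d) ^ \<kappa> * exp (- 2 * (\<alpha> ^ ?d * B0)))
    = (1 / (2 * \<alpha>)) ^ ?d * (1 / \<kappa>) ^ \<kappa> * ((1 / \<epsilon>) ^ ?d) ^ \<kappa> * exp (- 2 * (\<alpha> ^ ?d * B0)) * (real n * (real n * r ^ ?d) ^ (\<kappa> - 1))"
  proof -
    let ?x = "r ^ ?d"
    have x: "0 < ?x" using r_pos by simp
    have 1: "(1 / (2 * width)) ^ ?d = (1 / (2 * \<alpha>)) ^ ?d / ?x"
      by (simp add: w power_divide power_mult_distrib field_simps)
    have 2: "(real n / real \<kappa>) ^ \<kappa> = (1 / \<kappa>) ^ \<kappa> * real n ^ \<kappa>" by (simp add: power_divide)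
    have 3: "(side ^ ?d) ^ \<kappa> = ((1 / \<epsilon>) ^ ?d) ^ \<kappa> * ?x ^ \<kappa>"
      by (simp add: side_def power_divide power_mult_distrib)
    have 4: "real n ^ \<kappa> * ?x ^ \<kappa> / ?x = real n * (real n * ?x) ^ (\<kappa> - 1)"
    proof -
      have "real n ^ \<kappa> = real n * real n ^ (\<kappa> - 1)" "?x ^ \<kappa> = ?x * ?x ^ (\<kappa> - 1)"
        using \<kappa>_pos power_Suc[of "real n" "\<kappa> - 1"] power_Suc[of ?x "\<kappa> - 1"] by simp_all
      moreover have "(real n * a) * (?x * b) / ?x = real n * (a * b)" for a b :: real using r_pos by simp
      ultimately show ?thesis by (simp only: power_mult_distrib[of "real n" ?x])
    qed
    show ?thesis unfolding 1 2 3 4[symmetric] by simp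
  qed
  show ?thesis by (rule ord_eq_le_trans[OF eq[symmetric] lower])
qed

end

section \<open>Subgraph counts of a uniform sample\<close>

text \<open>
  The law of the count under the given sample is that of a U-statistic under a product of uniform
  distributions, where the two estimates above apply.
\<close>

locale uniform_sample = prob_space M for M :: "'w measure" +
  fixes X :: "nat \<Rightarrow> 'w \<Rightarrow> real ^ 'd" and \<Gamma> :: "'v pair_pre_digraph" and \<kappa> :: nat
  assumes indep: "indep_vars (\<lambda>_. borel) X {1..}"
    and uniform: "\<And>i. i \<ge> 1 \<Longrightarrow> distr M borel (X i) = cube"
    and \<kappa>_ge: "\<kappa> \<ge> 2"
    and \<Gamma>: "pair_graph \<Gamma>" "Digraph_Component.connected (with_proj \<Gamma>)" "card (pverts \<Gamma>) = \<kappa>"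
begin

abbreviation "Pn n \<equiv> PiM {1..n} (\<lambda>_. cube :: (real ^ 'd) measure)"
abbreviation index_sets :: "nat \<Rightarrow> nat set set" where
  "index_sets n \<equiv> {I. I \<subseteq> {1..n} \<and> card I = \<kappa>}"

definition cnt :: "nat \<Rightarrow> real \<Rightarrow> 'w \<Rightarrow> nat" where
  "cnt n s \<omega> = induced_count \<Gamma> (sample X n \<omega>) s"
definition ustat :: "nat \<Rightarrow> real \<Rightarrow> (nat \<Rightarrow> real ^ 'd) \<Rightarrow> real" where
  "ustat n s x = (\<Sum>I\<in>index_sets n. of_bool (forms \<Gamma> s I x))"

lemma fin_pverts: "finite (pverts \<Gamma>)"
  using \<Gamma>(3) \<kappa>_ge card.infinite by force

lemma X_measurable: "i \<ge> 1 \<Longrightarrow> X i \<in> borel_measurable M"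
  using indep by (auto simp: indep_vars_def)

lemma joint_measurable: "(\<lambda>\<omega>. \<lambda>i\<in>{1..n}. X i \<omega>) \<in> M \<rightarrow>\<^sub>M Pn n"
proof (rule measurable_restrict)
  fix i assume "i \<in> {1..n}"
  then show "X i \<in> M \<rightarrow>\<^sub>M cube" using X_measurable[of i] by (simp cong: measurable_cong_sets)
qed

lemma joint_distr:
  assumes n: "n \<ge> 1"
  shows "distr M (Pn n) (\<lambda>\<omega>. \<lambda>i\<in>{1..n}. X i \<omega>) = Pn n"
proof -
  have "indep_vars (\<lambda>_. borel) X {1..n}" by (rule indep_vars_subset[OF indep]) auto
  then have "distr M (PiM {1..n} (\<lambda>_. borel)) (\<lambda>\<omega>. \<lambda>i\<in>{1..n}. X i \<omega>) = PiM {1..n} (\<lambda>i. distr M borel (X i))"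
    using n by (subst indep_vars_iff_distr_eq_PiM'[symmetric]) (auto intro: X_measurable)
  also have "\<dots> = Pn n" by (rule PiM_cong) (auto simp: uniform)
  finally have "distr M (PiM {1..n} (\<lambda>_. borel)) (\<lambda>\<omega>. \<lambda>i\<in>{1..n}. X i \<omega>) = Pn n" .
  moreover have "distr M (Pn n) (\<lambda>\<omega>. \<lambda>i\<in>{1..n}. X i \<omega>) = distr M (PiM {1..n} (\<lambda>_. borel)) (\<lambda>\<omega>. \<lambda>i\<in>{1..n}. X i \<omega>)"
    by (rule distr_cong[OF refl _ refl]) (rule sets_PiM_cong, auto)
  ultimately show ?thesis by simp
qed

lemma forms_pred: "I \<in> index_sets n \<Longrightarrow> Measurable.pred (Pn n) (forms \<Gamma> s I)"
  by (rule pred_forms[OF fin_pverts]) auto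

lemma forms_X_pred:
  assumes "I \<in> index_sets n"
  shows "Measurable.pred M (\<lambda>\<omega>. forms \<Gamma> s I (\<lambda>i. X i \<omega>))"
proof -
  have "Measurable.pred M (\<lambda>\<omega>. forms \<Gamma> s I (\<lambda>i\<in>{1..n}. X i \<omega>))"
    by (rule measurable_compose[OF joint_measurable forms_pred[OF assms]])
  moreover have "forms \<Gamma> s I (\<lambda>i\<in>{1..n}. X i \<omega>) = forms \<Gamma> s I (\<lambda>i. X i \<omega>)" for \<omega>
    by (rule depends_onD[OF depends_on_forms]) (use assms in auto)
  ultimately show ?thesis by simp
qed

lemma cnt_eq_card: "cnt n s \<omega> = card {I \<in> index_sets n. first_visits (\<lambda>i. X i \<omega>) I \<and> forms \<Gamma> s I (\<lambda>i. X i \<omega>)}"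
  unfolding cnt_def sample_def induced_count_eq_card[OF \<Gamma>(1,2)] \<Gamma>(3)
  by (rule arg_cong[where f=card]) auto

lemma cnt_eq_sum: "real (cnt n s \<omega>) = (\<Sum>I\<in>index_sets n. of_bool (first_visits (\<lambda>i. X i \<omega>) I \<and> forms \<Gamma> s I (\<lambda>i. X i \<omega>)))"
  unfolding cnt_eq_card by (subst sum_of_bool_eq) (auto intro!: arg_cong[where f=card])

lemma cnt_le: "cnt n s \<omega> \<le> n choose \<kappa>"
proof -
  have "cnt n s \<omega> \<le> card (index_sets n)" unfolding cnt_eq_card by (intro card_mono) auto
  then show ?thesis using n_subsets[of "{1..n}" \<kappa>] by simp
qed

lemma cnt_measurable: "cnt n s \<in> measurable M (count_space UNIV)"
proof -
  have "Measurable.pred M (\<lambda>\<omega>. first_visits (\<lambda>i. X i \<omega>) I)" if I: "I \<in> index_sets n" for I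
  proof -
    have ne: "Measurable.pred M (\<lambda>\<omega>. X j \<omega> \<noteq> X i \<omega>)" if "1 \<le> i" "1 \<le> j" for i j
    proof -
      have "Measurable.pred M (\<lambda>\<omega>. 0 < norm (X j \<omega> - X i \<omega>))"
        using X_measurable[OF that(1)] X_measurable[OF that(2)] by measurable
      then show ?thesis by simp
    qed
    have fI: "finite I" using I by (auto intro: finite_subset)
    show ?thesis
      unfolding first_visits_def
      by (intro pred_intros_finite fI finite_atLeastLessThan ne) (use I in auto)
  qed
  then have "(\<lambda>\<omega>. real (cnt n s \<omega>)) \<in> borel_measurable M"
    unfolding cnt_eq_sum using forms_X_pred by (intro borel_measurable_sum) measurable
  then have "{\<omega> \<in> space M. real (cnt n s \<omega>) = real k} \<in> events" for k by measurable
  then show ?thesis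
    by (simp add: measurable_count_space_eq2_countable vimage_def Int_def conj_commute)
qed

lemma AE_distinct:
  assumes n: "n \<ge> 1"
  shows "AE \<omega> in M. \<forall>i\<in>{1..n}. \<forall>j\<in>{1..n}. i \<noteq> j \<longrightarrow> X j \<omega> \<noteq> X i \<omega>"
proof -
  interpret P: prob_space "Pn n" by (rule prob_space_PiM) (rule prob_space_cube)
  have "AE x in Pn n. x j \<noteq> x i" if ij: "i \<in> {1..n}" "j \<in> {1..n}" "i \<noteq> j" for i j
  proof -
    have "emeasure (Pn n) {x \<in> space (Pn n). norm (x j - x i) \<le> 0} = 0"
      using prob_close_le[of "{1..n}" i j 0, where 'd='d] ij by (simp add: power_0_left)
    moreover have "{x \<in> space (Pn n). norm (x j - x i) \<le> 0} \<in> sets (Pn n)"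
    proof -
      have "(\<lambda>x. (x i, x j)) \<in> Pn n \<rightarrow>\<^sub>M cube \<Otimes>\<^sub>M cube" using ij by (intro measurable_Pair measurable_component_singleton)
      from measurable_compose[OF this pred_close[of 0]] show ?thesis by (simp add: pred_def)
    qed
    ultimately show ?thesis by (intro AE_I[of _ _ "{x \<in> space (Pn n). norm (x j - x i) \<le> 0}"]) auto
  qed
  then have ij: "AE \<omega> in M. X j \<omega> \<noteq> X i \<omega>" if "i \<in> {1..n}" "j \<in> {1..n}" "i \<noteq> j" for i j
    using AE_distrD[OF joint_measurable[of n], of "\<lambda>x. x j \<noteq> x i"] that unfolding joint_distr[OF n] by auto
  then have "AE \<omega> in M. i \<noteq> j \<longrightarrow> X j \<omega> \<noteq> X i \<omega>" if "i \<in> {1..n}" "j \<in> {1..n}" for i j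
    using that by (cases "i = j") auto
  then show ?thesis by (intro AE_finite_allI) auto
qed

lemma AE_cnt_eq_ustat:
  assumes n: "n \<ge> 1"
  shows "AE \<omega> in M. real (cnt n s \<omega>) = ustat n s (\<lambda>i\<in>{1..n}. X i \<omega>)"
  using AE_distinct[OF n]
proof eventually_elim
  case (elim \<omega>)
  show ?case
    unfolding cnt_eq_sum ustat_def
  proof (intro sum.cong refl arg_cong[where f=of_bool])
    fix I assume I: "I \<in> index_sets n"
    have "first_visits (\<lambda>i. X i \<omega>) I"
      unfolding first_visits_def
    proof (intro ballI)
      fix i j assume "i \<in> I" "j \<in> {1..<i}"
      then have "i \<in> {1..n}" "j \<in> {1..n}" "i \<noteq> j" using I by auto
      then show "X j \<omega> \<noteq> X i \<omega>" using elim by blast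
    qed
    moreover have "forms \<Gamma> s I (\<lambda>i\<in>{1..n}. X i \<omega>) = forms \<Gamma> s I (\<lambda>i. X i \<omega>)"
      by (rule depends_onD[OF depends_on_forms]) (use I in auto)
    ultimately show "(first_visits (\<lambda>i. X i \<omega>) I \<and> forms \<Gamma> s I (\<lambda>i. X i \<omega>)) = forms \<Gamma> s I (\<lambda>i\<in>{1..n}. X i \<omega>)"
      by simp
  qed
qed

lemma ustat_measurable: "ustat n s \<in> borel_measurable (Pn n)"
  unfolding ustat_def[abs_def]
proof (rule borel_measurable_sum)
  fix I assume "I \<in> index_sets n"
  from measurable_compose[OF forms_pred[OF this], of "of_bool :: bool \<Rightarrow> real" borel]
  show "(\<lambda>x. of_bool (forms \<Gamma> s I x) :: real) \<in> borel_measurable (Pn n)" by simp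
qed

lemma expectation_cnt:
  fixes g :: "real \<Rightarrow> 'b::{banach, second_countable_topology}"
  assumes n: "n \<ge> 1" and g: "g \<in> borel_measurable borel"
  shows "expectation (\<lambda>\<omega>. g (real (cnt n s \<omega>))) = (\<integral>x. g (ustat n s x) \<partial>Pn n)"
proof -
  have gu: "(\<lambda>x. g (ustat n s x)) \<in> borel_measurable (Pn n)"
    by (rule measurable_compose[OF ustat_measurable g])
  have "expectation (\<lambda>\<omega>. g (real (cnt n s \<omega>))) = expectation (\<lambda>\<omega>. g (ustat n s (\<lambda>i\<in>{1..n}. X i \<omega>)))"
  proof (rule integral_cong_AE)
    show "AE \<omega> in M. g (real (cnt n s \<omega>)) = g (ustat n s (\<lambda>i\<in>{1..n}. X i \<omega>))"
      using AE_cnt_eq_ustat[OF n, of s] by eventually_elim simp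
    show "(\<lambda>\<omega>. g (real (cnt n s \<omega>))) \<in> borel_measurable M"
      by (rule measurable_compose[OF cnt_measurable]) simp
    show "(\<lambda>\<omega>. g (ustat n s (\<lambda>i\<in>{1..n}. X i \<omega>))) \<in> borel_measurable M"
      by (rule measurable_compose[OF joint_measurable gu])
  qed
  also have "\<dots> = (\<integral>x. g (ustat n s x) \<partial>distr M (Pn n) (\<lambda>\<omega>. \<lambda>i\<in>{1..n}. X i \<omega>))"
    by (rule integral_distr[OF joint_measurable gu, symmetric])
  finally show ?thesis unfolding joint_distr[OF n] .
qed

lemma ustatistic_locale:
  assumes s: "0 \<le> s" and p: "(2 * (real (card (parcs \<Gamma>)) * s)) ^ CARD('d) \<le> 1"
  shows "local_ustatistic (cube :: (real ^ 'd) measure) n \<kappa> (forms \<Gamma> s)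
    (\<lambda>x y. norm (y - x) \<le> real (card (parcs \<Gamma>)) * s) ((2 * (real (card (parcs \<Gamma>)) * s)) ^ CARD('d))"
proof -
  interpret C: prob_space "cube :: (real ^ 'd) measure" by (rule prob_space_cube)
  show ?thesis
  proof
    show "Measurable.pred (Pn n) (forms \<Gamma> s I)" if "I \<subseteq> {1..n}" for I
      by (rule pred_forms[OF fin_pverts]) (use that in auto)
    show "norm (x j - x i) \<le> real (card (parcs \<Gamma>)) * s" if "forms \<Gamma> s I x" "i \<in> I" "j \<in> I" for I i j and x :: "nat \<Rightarrow> real ^ 'd"
      by (rule forms_norm_le[OF \<Gamma>(1,2) that s])
    show "emeasure cube {y \<in> space cube. norm (y - x) \<le> real (card (parcs \<Gamma>)) * s}
        \<le> ennreal ((2 * (real (card (parcs \<Gamma>)) * s)) ^ CARD('d))" for x :: "real ^ 'd"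
      using emeasure_cube_ball[of "real (card (parcs \<Gamma>)) * s" x] s by simp
  qed (rule depends_on_forms pred_close p | use \<kappa>_ge s in simp)+
qed

text \<open>
  Here \<open>q\<close> is of order \<open>\<tau>\<^sup>2\<close>, so the bound at \<open>\<theta> = t / \<tau>\<close> is of order \<open>1 / \<tau>\<close>.
\<close>

theorem char_cnt_near_gaussian:
  assumes n: "n \<ge> 1" and s: "0 \<le> s" and p: "(2 * (real (card (parcs \<Gamma>)) * s)) ^ CARD('d) \<le> 1"
    and B: "real n * (2 * (real (card (parcs \<Gamma>)) * s)) ^ CARD('d) \<le> B"
  defines "q \<equiv> (\<Sum>k=\<kappa>..4 * \<kappa>. 16 ^ k * B ^ (k - \<kappa>))
      * (real n * (real n * (2 * (real (card (parcs \<Gamma>)) * s)) ^ CARD('d)) ^ (\<kappa> - 1))"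
    and "u \<equiv> expectation (\<lambda>\<omega>. real (cnt n s \<omega>))" and "v \<equiv> variance (\<lambda>\<omega>. real (cnt n s \<omega>))"
  shows "norm (expectation (\<lambda>\<omega>. cis (\<theta> * (real (cnt n s \<omega>) - u))) - exp (- v * \<theta>\<^sup>2 / 2))
    \<le> \<theta>\<^sup>2 * sqrt (8 * q) + 2 * \<bar>\<theta>\<bar> ^ 3 * q"
proof -
  interpret U: local_ustatistic "cube :: (real ^ 'd) measure" n \<kappa> "forms \<Gamma> s"
    "\<lambda>x y. norm (y - x) \<le> real (card (parcs \<Gamma>)) * s" "(2 * (real (card (parcs \<Gamma>)) * s)) ^ CARD('d)"
    by (rule ustatistic_locale[OF s p])
  have f: "U.f = ustat n s"
    unfolding U.f_def[abs_def] U.H_def ustat_def[abs_def] U.subsets_def ..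
  have sw: "(\<integral>z. g (U.W z) \<partial>U.N) = (\<integral>x. g (ustat n s x) \<partial>Pn n)"
    if g: "g \<in> borel_measurable borel" for g :: "real \<Rightarrow> 'z::{banach, second_countable_topology}"
    unfolding U.W_def f
    by (rule U.integral_swap[OF measurable_compose[OF ustat_measurable g] depends_on_comp[OF U.depends_on_f[unfolded f]]])
  have tr: "(\<integral>z. g (U.W z) \<partial>U.N) = expectation (\<lambda>\<omega>. g (real (cnt n s \<omega>)))"
    if g: "g \<in> borel_measurable borel" for g :: "real \<Rightarrow> 'z::{banach, second_countable_topology}"
    unfolding sw[OF g] by (rule expectation_cnt[OF n g, symmetric])
  have m: "U.m = u" unfolding U.m_def u_def by (rule tr) simp
  have v: "U.v = v" unfolding U.v_def v_def m u_def[symmetric] by (rule tr) simp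
  have \<phi>: "U.\<phi> \<theta> = expectation (\<lambda>\<omega>. cis (\<theta> * (real (cnt n s \<omega>) - u)))"
    unfolding U.\<phi>_def m by (rule tr) (simp add: cis_conv_exp)
  have Q: "U.Q \<le> q" unfolding q_def by (rule U.Q_le_power[OF B])
  have "norm (U.\<phi> \<theta> - exp (- U.v * \<theta>\<^sup>2 / 2)) \<le> \<theta>\<^sup>2 * sqrt (8 * U.Q) + 2 * \<bar>\<theta>\<bar> ^ 3 * U.Q"
    by (rule U.char_gaussian_bound)
  also have "\<dots> \<le> \<theta>\<^sup>2 * sqrt (8 * q) + 2 * \<bar>\<theta>\<bar> ^ 3 * q"
    using Q by (intro add_mono mult_left_mono) auto
  finally show ?thesis unfolding \<phi> v .
qed

text \<open>
  With \<open>\<tau>\<^sup>2 = \<tau>2\<close> one has \<open>s ^ d = O(1 / \<tau>\<^sup>2)\<close>, so at \<open>\<theta> = t / \<tau>\<close> the bound has the form \<open>exp (- c t\<^sup>2) + C / \<tau>\<^sup>2\<close>.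
\<close>

theorem norm_char_cnt_le:
  assumes n: "2 * \<kappa> \<le> n" and s: "0 < s" and \<epsilon>: "0 < \<epsilon>"
    and small: "s * (1 / \<epsilon> + 2 * (card (parcs \<Gamma>) + 1)) \<le> 1 / 2"
    and B0: "real n * s ^ CARD('d) \<le> B0"
  defines "\<alpha> \<equiv> 1 / \<epsilon> + 2 * (card (parcs \<Gamma>) + 1)"
    and "a \<equiv> pattern_prob \<Gamma> \<kappa> TYPE('d) \<epsilon> * (1 - pattern_prob \<Gamma> \<kappa> TYPE('d) \<epsilon>)"
  defines "c1 \<equiv> (1 / (2 * \<alpha>)) ^ CARD('d) * (1 / \<kappa>) ^ \<kappa> * ((1 / \<epsilon>) ^ CARD('d)) ^ \<kappa> * exp (- 2 * (\<alpha> ^ CARD('d) * B0))"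
    and "\<tau>2 \<equiv> real n * (real n * s ^ CARD('d)) ^ (\<kappa> - 1)"
  assumes \<theta>: "\<bar>\<theta>\<bar> \<le> pi"
  shows "norm (expectation (\<lambda>\<omega>. cis (\<theta> * (real (cnt n s \<omega>) - u))))
    \<le> exp (- (a * c1 / 32) * \<theta>\<^sup>2 * \<tau>2) + 4 * (1 / (c1 * \<tau>2) + 2 ^ (2 * \<kappa>) * real (2 * \<kappa>) * (\<alpha> ^ CARD('d) * s ^ CARD('d)))"
proof -
  interpret G: grid_cells \<Gamma> n \<kappa> s \<epsilon> "TYPE('d)"
    by (rule grid_cells.intro[OF \<Gamma> _ n s \<epsilon> small]) (use \<kappa>_ge in simp)
  have \<alpha>: "0 < \<alpha>" unfolding \<alpha>_def using \<epsilon> by (simp add: add_pos_nonneg)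
  have c1: "0 < c1" unfolding c1_def using \<alpha> \<epsilon> \<kappa>_ge by simp
  have \<tau>2: "0 < \<tau>2" unfolding \<tau>2_def using n s \<kappa>_ge by simp
  have mean: "c1 * \<tau>2 \<le> G.mean" unfolding c1_def \<tau>2_def \<alpha>_def by (rule G.mean_ge[OF B0])
  have c\<tau>: "0 < c1 * \<tau>2" using c1 \<tau>2 by simp
  have mean_pos: "0 < G.mean" by (rule less_le_trans[OF c\<tau> mean])
  have a: "0 \<le> a" "G.single_prob * (1 - G.single_prob) = a"
    unfolding a_def G.single_prob_def[symmetric] using G.single_prob_bounds by auto
  have w: "G.width ^ CARD('d) = \<alpha> ^ CARD('d) * s ^ CARD('d)"
    unfolding G.width_eq \<alpha>_def by (simp add: power_mult_distrib mult.commute)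
  have "expectation (\<lambda>\<omega>. cis (\<theta> * (real (cnt n s \<omega>) - u))) = expectation (\<lambda>\<omega>. cis (\<theta> * real (cnt n s \<omega>)) * cis (- \<theta> * u))"
    by (intro Bochner_Integration.integral_cong refl) (simp add: cis_mult algebra_simps)
  also have "\<dots> = expectation (\<lambda>\<omega>. cis (\<theta> * real (cnt n s \<omega>))) * cis (- \<theta> * u)"
    by (rule integral_mult_left_zero)
  also have "expectation (\<lambda>\<omega>. cis (\<theta> * real (cnt n s \<omega>))) = (\<integral>x. cis (\<theta> * ustat n s x) \<partial>Pn n)"
    by (rule expectation_cnt) (use n \<kappa>_ge in \<open>auto simp: cis_conv_exp\<close>)
  also have "\<dots> = (\<integral>x. cis (\<theta> * G.copies x) \<partial>G.P)"
    unfolding G.copies_def ustat_def G.subs_def ..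
  finally have "norm (expectation (\<lambda>\<omega>. cis (\<theta> * (real (cnt n s \<omega>) - u)))) = norm (\<integral>x. cis (\<theta> * G.copies x) \<partial>G.P)"
    by (simp add: norm_mult)
  also have "\<dots> \<le> exp (- (G.single_prob * (1 - G.single_prob) * (1 - cos \<theta>) * G.mean / 2))
     + 4 * (1 / G.mean + (1 / (1 - G.width ^ CARD('d)) ^ (2 * \<kappa>) - 1))"
    by (rule G.norm_char_copies[OF mean_pos])
  also have "\<dots> \<le> exp (- (a * c1 / 32) * \<theta>\<^sup>2 * \<tau>2) + 4 * (1 / (c1 * \<tau>2) + 2 ^ (2 * \<kappa>) * real (2 * \<kappa>) * (\<alpha> ^ CARD('d) * s ^ CARD('d)))"
  proof (intro add_mono mult_left_mono)
    have "\<theta>\<^sup>2 / 16 * (c1 * \<tau>2) \<le> (1 - cos \<theta>) * G.mean"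
      using one_minus_cos_ge[OF \<theta>] mean c\<tau> by (intro mult_mono) auto
    from mult_left_mono[OF this a(1)]
    show "exp (- (G.single_prob * (1 - G.single_prob) * (1 - cos \<theta>) * G.mean / 2)) \<le> exp (- (a * c1 / 32) * \<theta>\<^sup>2 * \<tau>2)"
      unfolding a(2) by (simp add: mult_ac)
    show "1 / G.mean \<le> 1 / (c1 * \<tau>2)" using mean c\<tau> by (intro divide_left_mono mult_pos_pos[OF mean_pos c\<tau>]) auto
    show "1 / (1 - G.width ^ CARD('d)) ^ (2 * \<kappa>) - 1 \<le> 2 ^ (2 * \<kappa>) * real (2 * \<kappa>) * (\<alpha> ^ CARD('d) * s ^ CARD('d))"
      unfolding w[symmetric] using G.width_power_le G.width_pos by (intro inverse_power_le) auto
  qed simp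
  finally show ?thesis .
qed

text \<open>
  Feasibility provides a radius with positive probability. Shrinking the radius keeps the probability positive, and
  makes it less than 1 because two given points are rarely close.
\<close>

lemma exists_nontrivial_radius:
  assumes "feasible M X \<Gamma>"
  shows "\<exists>\<epsilon>>0. 0 < pattern_prob \<Gamma> \<kappa> TYPE('d) \<epsilon> \<and> pattern_prob \<Gamma> \<kappa> TYPE('d) \<epsilon> < 1"
proof -
  obtain s where s: "0 < s" "0 < prob {\<omega> \<in> space M. graph_iso (geometric_graph (sample X \<kappa> \<omega>) s) \<Gamma>}"
    using assms unfolding feasible_def \<Gamma>(3) by auto
  let ?F = "{x \<in> space (Pn \<kappa>). forms \<Gamma> s {1..\<kappa>} x}" and ?J = "\<lambda>\<omega>. \<lambda>i\<in>{1..\<kappa>}. X i \<omega>"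
  have F: "?F \<in> sets (Pn \<kappa>)" using forms_pred[of "{1..\<kappa>}" \<kappa> s] by (simp add: pred_def)
  have "prob {\<omega> \<in> space M. graph_iso (geometric_graph (sample X \<kappa> \<omega>) s) \<Gamma>} \<le> prob (?J -` ?F \<inter> space M)"
  proof (rule finite_measure_mono)
    show "?J -` ?F \<inter> space M \<in> events" using joint_measurable F by (rule measurable_sets)
    show "{\<omega> \<in> space M. graph_iso (geometric_graph (sample X \<kappa> \<omega>) s) \<Gamma>} \<subseteq> ?J -` ?F \<inter> space M"
    proof
      fix \<omega> assume \<omega>: "\<omega> \<in> {\<omega> \<in> space M. graph_iso (geometric_graph (sample X \<kappa> \<omega>) s) \<Gamma>}"
      then have "forms \<Gamma> s {1..\<kappa>} (\<lambda>i. X i \<omega>)"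
        using graph_iso_geometric_card[OF \<Gamma>(1,2), of "{1..\<kappa>}" "\<lambda>i. X i \<omega>" s] \<Gamma>(3) by (simp add: sample_def)
      moreover have "forms \<Gamma> s {1..\<kappa>} (?J \<omega>) = forms \<Gamma> s {1..\<kappa>} (\<lambda>i. X i \<omega>)"
        by (rule depends_onD[OF depends_on_forms]) simp
      moreover have "?J \<omega> \<in> space (Pn \<kappa>)" by (auto simp: space_PiM)
      ultimately show "\<omega> \<in> ?J -` ?F \<inter> space M" using \<omega> by simp
    qed
  qed
  also have "\<dots> = measure (distr M (Pn \<kappa>) ?J) ?F"
    by (rule measure_distr[OF joint_measurable F, symmetric])
  also have "\<dots> = pattern_prob \<Gamma> \<kappa> TYPE('d) s"
    using \<kappa>_ge by (subst joint_distr) (auto simp: pattern_prob_def)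
  finally have pos: "0 < pattern_prob \<Gamma> \<kappa> TYPE('d) s" using s by simp
  \<comment> \<open>The choice makes the bound \<open>2 D s / L\<close> from \<open>pattern_prob_le\<close> at most 1/2, with \<open>D\<close> the number of arcs.\<close>
  define L where "L = max 1 (4 * (real (card (parcs \<Gamma>)) * s))"
  have L: "1 \<le> L" "4 * (real (card (parcs \<Gamma>)) * s) \<le> L" by (auto simp: L_def)
  have "0 < pattern_prob \<Gamma> \<kappa> TYPE('d) (s / L)"
    by (rule pattern_prob_shrink[OF fin_pverts _ L(1)]) (use pos L \<kappa>_ge in auto)
  moreover have "pattern_prob \<Gamma> \<kappa> TYPE('d) (s / L) < 1"
  proof -
    let ?b = "2 * (real (card (parcs \<Gamma>)) * (s / L))"
    have b: "0 \<le> ?b" "?b \<le> 1 / 2" using L s by (auto simp: field_simps)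
    have "pattern_prob \<Gamma> \<kappa> TYPE('d) (s / L) \<le> ?b ^ CARD('d)"
      by (rule pattern_prob_le[OF \<Gamma>(1,2) \<kappa>_ge]) (use L s in auto)
    also have "\<dots> \<le> ?b ^ 1" using b by (intro power_decreasing) auto
    finally show ?thesis using b by simp
  qed
  moreover have "0 < s / L" using s L by simp
  ultimately show ?thesis by blast
qed

end

section \<open>The local central limit theorem\<close>

theorem theorem4p1:
  fixes M :: "'w measure"
    and X :: "nat \<Rightarrow> 'w \<Rightarrow> real ^ 'd"
    and \<Gamma> :: "'v pair_pre_digraph"
    and \<kappa> :: nat
    and r :: "nat \<Rightarrow> real"
    and \<rho> \<sigma> :: real
  defines "\<tau> \<equiv> tau CARD('d) \<kappa> r"
    and "G \<equiv> (\<lambda>n \<omega>. induced_count \<Gamma> (sample X n \<omega>) (r n))"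
  assumes "prob_space M"
    and "prob_space.indep_vars M (\<lambda>_. borel) X {1..}"
    and "\<And>i. i \<ge> 1 \<Longrightarrow> distr M borel (X i) = uniform_measure lborel (cbox 0 1)"
    and "\<kappa> \<ge> 2"
    and "pair_graph \<Gamma>"
    and "card (pverts \<Gamma>) = \<kappa>"
    and "Digraph_Component.connected (with_proj \<Gamma>)"
    and "feasible M X \<Gamma>"
    and "\<And>n. n \<ge> 1 \<Longrightarrow> r n > 0"
    and "r \<longlonglongrightarrow> 0"
    and "\<rho> \<ge> 0"
    and "(\<lambda>n. real n * r n ^ CARD('d)) \<longlonglongrightarrow> \<rho>"
    and "filterlim (\<lambda>n. (\<tau> n)\<^sup>2) at_top sequentially"
    and "\<sigma> > 0"
    and "(\<lambda>n. prob_space.variance M (\<lambda>\<omega>. real (G n \<omega>)) / (\<tau> n)\<^sup>2) \<longlonglongrightarrow> \<sigma>\<^sup>2"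
  shows "(\<lambda>n. SUP j::int. \<bar>\<tau> n * measure M {\<omega> \<in> space M. int (G n \<omega>) = j}
            - 1 / \<sigma> * std_normal_density
                ((real_of_int j - prob_space.expectation M (\<lambda>\<omega>. real (G n \<omega>))) / (\<sigma> * \<tau> n))\<bar>)
         \<longlonglongrightarrow> 0"
proof -
  interpret uniform_sample M X \<Gamma> \<kappa>
    by (intro uniform_sample.intro uniform_sample_axioms.intro) (use assms in \<open>simp_all add: cube_def\<close>)
  have G: "G n \<omega> = cnt n (r n) \<omega>" for n \<omega> by (simp add: G_def cnt_def)
  let ?d = "CARD('d)" and ?D = "real (card (parcs \<Gamma>))"
  define u where "u n = expectation (\<lambda>\<omega>. real (cnt n (r n) \<omega>))" for n
  define v where "v n = variance (\<lambda>\<omega>. real (cnt n (r n) \<omega>))" for n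
  define \<phi> where "\<phi> n t = expectation (\<lambda>\<omega>. cis (t / \<tau> n * (real (cnt n (r n) \<omega>) - u n)))" for n t
  obtain B0 where B0: "0 < B0" "\<And>n. real n * r n ^ ?d \<le> B0"
  proof -
    have "Bseq (\<lambda>n. real n * r n ^ ?d)" using assms(14) by (intro convergent_imp_Bseq convergentI)
    then obtain K where "0 < K" "\<And>n. norm (real n * r n ^ ?d) \<le> K" unfolding Bseq_def by blast
    then show ?thesis using that[of K] by (auto simp: abs_le_iff)
  qed
  have r_pos: "0 < r n" if "n \<ge> 1" for n using assms(11) that by blast
  have \<tau>sq: "(\<tau> n)\<^sup>2 = real n * (real n * r n ^ ?d) ^ (\<kappa> - 1)" and \<tau>_pos: "0 < \<tau> n" if n: "n \<ge> 1" for n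
    using n r_pos[OF n] by (simp_all add: \<tau>_def tau_def less_imp_le)
  have \<tau>_lim: "filterlim \<tau> at_top sequentially"
  proof -
    have "filterlim (\<lambda>n. sqrt ((\<tau> n)\<^sup>2)) at_top sequentially"
      by (rule filterlim_compose[OF sqrt_at_top assms(15)])
    moreover have "eventually (\<lambda>n. sqrt ((\<tau> n)\<^sup>2) = \<tau> n) sequentially"
      using eventually_ge_at_top[of 1] by eventually_elim (use \<tau>_pos in \<open>simp add: less_imp_le\<close>)
    ultimately show ?thesis by (rule filterlim_mono_eventually[OF _ order_refl order_refl])
  qed
  have small: "eventually (\<lambda>n. r n * a \<le> 1 / 2) sequentially" for a
  proof -
    have "(\<lambda>n. r n * a) \<longlonglongrightarrow> 0" using tendsto_mult_left_zero[OF assms(12)] .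
    then have "eventually (\<lambda>n. r n * a < 1 / 2) sequentially" by (rule order_tendstoD) simp
    then show ?thesis by eventually_elim simp
  qed

  \<comment> \<open>Pointwise convergence: all constants are uniform in \<open>n\<close> since \<open>n r ^ d \<le> B0\<close>.\<close>
  define B where "B = (2 * ?D) ^ ?d * B0"
  define A where "A = (\<Sum>k=\<kappa>..4 * \<kappa>. 16 ^ k * B ^ (k - \<kappa>)) * ((2 * ?D) ^ ?d) ^ (\<kappa> - 1)"
  have clt: "eventually (\<lambda>n. norm (\<phi> n t - exp (- (v n / (\<tau> n)\<^sup>2) * t\<^sup>2 / 2))
      \<le> (t\<^sup>2 * sqrt (8 * A) + 2 * \<bar>t\<bar> ^ 3 * A) / \<tau> n) sequentially" for t
    using small[of ?D] eventually_ge_at_top[of 1]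
  proof eventually_elim
    case (elim n)
    let ?p = "(2 * (?D * r n)) ^ ?d" and ?\<theta> = "t / \<tau> n"
    have r0: "0 \<le> r n" using r_pos[OF elim(2)] by simp
    have p1: "?p \<le> 1" using elim r0 by (intro power_le_one) (auto simp: mult.commute)
    have p: "?p = (2 * ?D) ^ ?d * r n ^ ?d" by (simp add: power_mult_distrib mult_ac)
    have np: "real n * ?p \<le> B"
      unfolding p B_def using mult_left_mono[OF B0(2)[of n], of "(2 * ?D) ^ ?d"] by (simp add: mult_ac)
    have q: "(\<Sum>k=\<kappa>..4 * \<kappa>. 16 ^ k * B ^ (k - \<kappa>)) * (real n * (real n * ?p) ^ (\<kappa> - 1)) = A * (\<tau> n)\<^sup>2"
      unfolding p A_def \<tau>sq[OF elim(2)] by (simp add: power_mult_distrib mult_ac)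
    have "norm (\<phi> n t - exp (- v n * ?\<theta>\<^sup>2 / 2)) \<le> ?\<theta>\<^sup>2 * sqrt (8 * (A * (\<tau> n)\<^sup>2)) + 2 * \<bar>?\<theta>\<bar> ^ 3 * (A * (\<tau> n)\<^sup>2)"
      using char_cnt_near_gaussian[OF elim(2) r0 p1 np, of ?\<theta>] unfolding q \<phi>_def u_def v_def .
    also have "- v n * ?\<theta>\<^sup>2 / 2 = - (v n / (\<tau> n)\<^sup>2) * t\<^sup>2 / 2" by (simp add: power_divide)
    also have "?\<theta>\<^sup>2 * sqrt (8 * (A * (\<tau> n)\<^sup>2)) + 2 * \<bar>?\<theta>\<bar> ^ 3 * (A * (\<tau> n)\<^sup>2) = (t\<^sup>2 * sqrt (8 * A) + 2 * \<bar>t\<bar> ^ 3 * A) / \<tau> n"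
      using \<tau>_pos[OF elim(2)]
      by (simp add: real_sqrt_mult power_divide field_simps power2_eq_square power3_eq_cube)
    finally show ?case .
  qed
  have \<phi>_lim: "(\<lambda>n. \<phi> n t) \<longlonglongrightarrow> of_real (exp (- \<sigma>\<^sup>2 * t\<^sup>2 / 2))" for t
  proof -
    have "(\<lambda>n. (t\<^sup>2 * sqrt (8 * A) + 2 * \<bar>t\<bar> ^ 3 * A) / \<tau> n) \<longlonglongrightarrow> 0"
      by (rule tendsto_divide_0[OF tendsto_const filterlim_at_top_imp_at_infinity[OF \<tau>_lim]])
    from Lim_null_comparison[OF clt this]
    have "(\<lambda>n. \<phi> n t - of_real (exp (- (v n / (\<tau> n)\<^sup>2) * t\<^sup>2 / 2))) \<longlonglongrightarrow> 0" by simp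
    moreover have "(\<lambda>n. v n / (\<tau> n)\<^sup>2) \<longlonglongrightarrow> \<sigma>\<^sup>2"
      using assms(17) unfolding G v_def .
    then have "(\<lambda>n. complex_of_real (exp (- (v n / (\<tau> n)\<^sup>2) * t\<^sup>2 / 2))) \<longlonglongrightarrow> of_real (exp (- \<sigma>\<^sup>2 * t\<^sup>2 / 2))"
      by (intro tendsto_intros) auto
    ultimately show ?thesis using tendsto_add by fastforce
  qed

  \<comment> \<open>The dominating bound, for cores that are cubes of side \<open>r / \<epsilon>\<close>.\<close>
  obtain \<epsilon> where \<epsilon>: "0 < \<epsilon>" "0 < pattern_prob \<Gamma> \<kappa> TYPE('d) \<epsilon>" "pattern_prob \<Gamma> \<kappa> TYPE('d) \<epsilon> < 1"
    using exists_nontrivial_radius[OF assms(10)] by blast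
  define \<alpha> where "\<alpha> = 1 / \<epsilon> + 2 * (card (parcs \<Gamma>) + 1)"
  define a where "a = pattern_prob \<Gamma> \<kappa> TYPE('d) \<epsilon> * (1 - pattern_prob \<Gamma> \<kappa> TYPE('d) \<epsilon>)"
  define c1 where "c1 = (1 / (2 * \<alpha>)) ^ ?d * (1 / \<kappa>) ^ \<kappa> * ((1 / \<epsilon>) ^ ?d) ^ \<kappa> * exp (- 2 * (\<alpha> ^ ?d * B0))"
  define K1 where "K1 = 2 ^ (2 * \<kappa>) * real (2 * \<kappa>) * \<alpha> ^ ?d"
  have \<alpha>: "0 < \<alpha>" unfolding \<alpha>_def using \<epsilon> by (simp add: add_pos_nonneg)
  have c1: "0 < c1" unfolding c1_def using \<alpha> \<epsilon> assms(6) by simp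
  have a: "0 < a" unfolding a_def using \<epsilon> by simp
  have K1: "0 \<le> K1" unfolding K1_def using \<alpha> by simp
  have smooth: "eventually (\<lambda>n. \<forall>t. \<bar>t\<bar> \<le> pi * \<tau> n \<longrightarrow>
      norm (\<phi> n t) \<le> exp (- (a * c1 / 32) * t\<^sup>2) + 4 * (1 / c1 + K1 * B0 ^ \<kappa>) / (\<tau> n)\<^sup>2) sequentially"
    using small[of \<alpha>] eventually_ge_at_top[of "2 * \<kappa>"]
  proof eventually_elim
    case (elim n)
    have n: "n \<ge> 1" using elim(2) assms(6) by simp
    show ?case
    proof (intro allI impI)
      fix t assume t: "\<bar>t\<bar> \<le> pi * \<tau> n"
      let ?\<theta> = "t / \<tau> n"
      have \<theta>: "\<bar>?\<theta>\<bar> \<le> pi" using t \<tau>_pos[OF n] by (simp add: pos_divide_le_eq)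
      \<comment> \<open>\<open>r ^ d \<tau>\<^sup>2 = (n r ^ d) ^ \<kappa>\<close>\<close>
      have rd: "r n ^ ?d \<le> B0 ^ \<kappa> / (\<tau> n)\<^sup>2"
      proof -
        have "r n ^ ?d * (\<tau> n)\<^sup>2 = (real n * r n ^ ?d) ^ Suc (\<kappa> - 1)"
          unfolding \<tau>sq[OF n] by simp
        also have "Suc (\<kappa> - 1) = \<kappa>" using assms(6) by simp
        also have "(real n * r n ^ ?d) ^ \<kappa> \<le> B0 ^ \<kappa>"
          using B0(2) r_pos[OF n] by (intro power_mono) auto
        finally show ?thesis using \<tau>_pos[OF n] by (simp add: pos_le_divide_eq)
      qed
      have "norm (\<phi> n t) \<le> exp (- (a * c1 / 32) * ?\<theta>\<^sup>2 * (\<tau> n)\<^sup>2)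
          + 4 * (1 / (c1 * (\<tau> n)\<^sup>2) + 2 ^ (2 * \<kappa>) * real (2 * \<kappa>) * (\<alpha> ^ ?d * r n ^ ?d))"
        using norm_char_cnt_le[OF elim(2) r_pos[OF n] \<epsilon>(1) elim(1)[unfolded \<alpha>_def] B0(2) \<theta>, of "u n"]
        unfolding \<phi>_def \<tau>sq[OF n] a_def c1_def \<alpha>_def .
      also have "\<dots> = exp (- (a * c1 / 32) * t\<^sup>2) + 4 * (1 / c1 / (\<tau> n)\<^sup>2 + K1 * r n ^ ?d)"
        using \<tau>_pos[OF n] by (simp add: power_divide K1_def mult.assoc)
      also have "\<dots> \<le> exp (- (a * c1 / 32) * t\<^sup>2) + 4 * (1 / c1 / (\<tau> n)\<^sup>2 + K1 * (B0 ^ \<kappa> / (\<tau> n)\<^sup>2))"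
        using mult_left_mono[OF rd K1] by simp
      also have "\<dots> = exp (- (a * c1 / 32) * t\<^sup>2) + 4 * (1 / c1 + K1 * B0 ^ \<kappa>) / (\<tau> n)\<^sup>2"
        by (simp add: add_divide_distrib distrib_left)
      finally show "norm (\<phi> n t) \<le> exp (- (a * c1 / 32) * t\<^sup>2) + 4 * (1 / c1 + K1 * B0 ^ \<kappa>) / (\<tau> n)\<^sup>2" .
    qed
  qed

  have "(\<lambda>n. SUP j::int. \<bar>\<tau> n * prob {\<omega> \<in> space M. int (cnt n (r n) \<omega>) = j}
      - 1 / \<sigma> * std_normal_density ((real_of_int j - u n) / (\<sigma> * \<tau> n))\<bar>) \<longlonglongrightarrow> 0"
  proof (rule local_limit_from_char[where X="\<lambda>n. cnt n (r n)" and \<tau>=\<tau> and u=u and K="\<lambda>n. n choose \<kappa>"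
        and c="a * c1 / 32" and C="4 * (1 / c1 + K1 * B0 ^ \<kappa>)"])
    show "0 < a * c1 / 32" using a c1 by simp
    show "0 \<le> 4 * (1 / c1 + K1 * B0 ^ \<kappa>)" using c1 K1 B0 by simp
  qed (use cnt_measurable cnt_le \<tau>_lim assms(16) \<phi>_lim smooth in \<open>simp_all only: \<phi>_def\<close>)
  then show ?thesis unfolding G u_def .
qed

end
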